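(* Let $\mathcal{G}$ be a locally compact étale groupoid with unit space $\mathcal{G}^{(0)}$, and let $X$ be a dense subset of $\mathcal{G}^{(0)}$. For an extendable section $\sigma\in\Gamma_b(E_X)$, the following are equivalent: (1) there exists $T\in\mathcal{L}(L^2(\mathcal{G}))$ with $\Phi_x(T)=\sigma(x)$ for all $x\in X$; (2) for any $\varepsilon>0$ and $\xi\in C_c(\mathcal{G})$ there exists a compact subset $K\subseteq\mathcal{G}$ such that for any $x\in X$ and $A_x\subseteq\mathcal{G}_x$ with $A_x\cap K=\emptyset$ we have $\|\chi_{A_x}\cdot(\sigma(x)(\xi|_{\mathcal{G}_x}))\|<\varepsilon$ and $\|\chi_{A_x}\cdot(\sigma(x)^*(\xi|_{\mathcal{G}_x}))\|<\varepsilon$; (3) for any $\varepsilon>0$ and $\xi\in C_c(\mathcal{G})$ there exists a compact subset $K\subseteq\mathcal{G}$ such that for any $x\in X$ and $A_x,B_x\subseteq\mathcal{G}_x$ with $A_x\cap(KB_x)=\emptyset$ we have $\|(\chi_{A_x}\sigma(x)\chi_{B_x})(\xi|_{\mathcal{G}_x})\|<\varepsilon$ and $\|(\chi_{A_x}\sigma(x)^*\chi_{B_x})(\xi|_{\mathcal{G}_x})\|<\varepsilon$.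
   Context: Locally compact spaces are assumed Hausdorff. A locally compact étale groupoid $\mathcal{G}$ is a topological groupoid with locally compact topology whose range map $\mathrm{r}$ (hence source map $\mathrm{s}$) is a local homeomorphism; $\mathcal{G}_x=\mathrm{s}^{-1}(x)$ (discrete). For $A,B\subseteq\mathcal{G}$, $AB=\{\alpha\beta:\alpha\in A,\beta\in B,\mathrm{s}(\alpha)=\mathrm{r}(\beta)\}$. Characteristic functions act by pointwise multiplication. $L^2(\mathcal{G})$ is the Hilbert $C_0(\mathcal{G}^{(0)})$-module obtained by completing $C_c(\mathcal{G})$ for $\langle\eta,\xi\rangle(x)=\sum_{\gamma\in\mathcal{G}_x}\overline{\eta(\gamma)}\xi(\gamma)$, with $(\xi f)(\gamma)=\xi(\gamma)f(\mathrm{s}(\gamma))$; its elements are regarded as functions in $C_0(\mathcal{G})$. $\mathcal{L}(L^2(\mathcal{G}))$ is the $C^*$-algebra of adjointable operators. The slice $\Phi_x(T)\in\mathcal{B}(\ell^2(\mathcal{G}_x))$ of $T\in\mathcal{L}(L^2(\mathcal{G}))$ is defined by $\Phi_x(T)(\xi|_{\mathcal{G}_x})=T(\xi)|_{\mathcal{G}_x}$ for $\xi\in L^2(\mathcal{G})$. $E_X=\bigsqcup_{x\in X}\mathcal{B}(\ell^2(\mathcal{G}_x))$ with topology: a net $\sigma_{x_i}\in\mathcal{B}(\ell^2(\mathcal{G}_{x_i}))$ converges to $\sigma_x\in\mathcal{B}(\ell^2(\mathcal{G}_x))$ iff $x_i\to x$ and for any $\gamma_i'\to\gamma'$, $\gamma_i''\to\gamma''$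 in $\mathcal{G}$ with $\mathrm{s}(\gamma_i')=x_i=\mathrm{s}(\gamma_i'')$, $\langle\delta_{\gamma_i''},\sigma_{x_i}(\delta_{\gamma_i'})\rangle\to\langle\delta_{\gamma''},\sigma_x(\delta_{\gamma'})\rangle$. $\Gamma_b(E_X)$ is the set of continuous sections $\sigma$ of $E_X$ ($\sigma(x)\in\mathcal{B}(\ell^2(\mathcal{G}_x))$) with $\sup_{x\in X}\|\sigma(x)\|<\infty$. $\sigma\in\Gamma_b(E_X)$ is extendable if for any $\omega\in\mathcal{G}^{(0)}\setminus X$ and $\gamma',\gamma''\in\mathcal{G}_\omega$ there is $c_{\gamma',\gamma''}\in\mathbb{C}$ such that for any net $x_i\in X$ with $x_i\to\omega$ and any $\gamma_i',\gamma_i''\in\mathcal{G}_{x_i}$ with $\gamma_i'\to\gamma'$, $\gamma_i''\to\gamma''$, one has $\langle\delta_{\gamma_i''},\sigma(x_i)(\delta_{\gamma_i'})\rangle\to c_{\gamma',\gamma''}$. *)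

theory Defs
  imports "HOL-Analysis.Analysis"
begin

section \<open>Locally compact etale groupoids\<close>

text \<open>The arrows of a groupoid form a whole type; the composition \<open>gmul G a b\<close> is meaningful only
  when \<open>gsrc G a = grng G b\<close> and is unspecified otherwise. Units are arrows, so source and range
  take values in the same type.\<close>

record 'g groupoid =
  gsrc :: "'g \<Rightarrow> 'g"
  grng :: "'g \<Rightarrow> 'g"
  gmul :: "'g \<Rightarrow> 'g \<Rightarrow> 'g"
  ginv :: "'g \<Rightarrow> 'g"

definition units :: "'g groupoid \<Rightarrow> 'g set" where
  "units G = range (gsrc G)"

definition fiber :: "'g groupoid \<Rightarrow> 'g \<Rightarrow> 'g set" where
  "fiber G x = {\<gamma>. gsrc G \<gamma> = x}"

definition composable :: "'g groupoid \<Rightarrow> ('g \<times> 'g) set" where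
  "composable G = {(a, b). gsrc G a = grng G b}"

definition setmul :: "'g groupoid \<Rightarrow> 'g set \<Rightarrow> 'g set \<Rightarrow> 'g set" where
  "setmul G A B = {gmul G a b | a b. a \<in> A \<and> b \<in> B \<and> gsrc G a = grng G b}"

locale groupoid =
  fixes G :: "'g groupoid"
  assumes src_src: "gsrc G (gsrc G a) = gsrc G a"
    and rng_src: "grng G (gsrc G a) = gsrc G a"
    and src_rng: "gsrc G (grng G a) = grng G a"
    and rng_rng: "grng G (grng G a) = grng G a"
    and src_mul: "gsrc G a = grng G b \<Longrightarrow> gsrc G (gmul G a b) = gsrc G b"
    and rng_mul: "gsrc G a = grng G b \<Longrightarrow> grng G (gmul G a b) = grng G a"
    and mul_assoc: "gsrc G a = grng G b \<Longrightarrow> gsrc G b = grng G c \<Longrightarrow>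
          gmul G (gmul G a b) c = gmul G a (gmul G b c)"
    and mul_src: "gmul G a (gsrc G a) = a"
    and rng_mul_left: "gmul G (grng G a) a = a"
    and src_inv: "gsrc G (ginv G a) = grng G a"
    and rng_inv: "grng G (ginv G a) = gsrc G a"
    and inv_mul: "gmul G (ginv G a) a = gsrc G a"
    and mul_inv: "gmul G a (ginv G a) = grng G a"

text \<open>The Hausdorff property is the class \<open>t2_space\<close>. Continuity of source and range follows from
  that of composition and inversion. The unit space carries the subspace topology.\<close>

locale lc_etale_groupoid = groupoid G for G :: "'g::t2_space groupoid" +
  assumes continuous_mul: "continuous_on (composable G) (\<lambda>(a, b). gmul G a b)"
    and continuous_inv: "continuous_on UNIV (ginv G)"
    and locally_compact: "locally_compact_space (euclidean :: 'g topology)"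
    and rng_local_homeo: "\<exists>U h. open U \<and> a \<in> U
          \<and> openin (top_of_set (units G)) (grng G ` U)
          \<and> homeomorphism U (grng G ` U) (grng G) h"


section \<open>The Hilbert space of square-summable functions on a set, and its bounded operators\<close>

text \<open>A vector of \<open>\<ell>\<^sup>2(S)\<close>, for a subset \<open>S\<close> of a type, is a function on the whole type that vanishes
  off \<open>S\<close>. With this encoding the restriction \<open>\<xi>|S\<close> is the product of \<open>\<xi>\<close> with the characteristic
  function of \<open>S\<close>, so \<open>chi\<close> serves both for restriction and for multiplication by
  characteristic functions.\<close>

definition chi :: "'g set \<Rightarrow> ('g \<Rightarrow> complex) \<Rightarrow> 'g \<Rightarrow> complex" where
  "chi A f = (\<lambda>\<gamma>. indicator A \<gamma> * f \<gamma>)"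

definition delta :: "'g \<Rightarrow> 'g \<Rightarrow> complex" where
  "delta \<gamma> = indicator {\<gamma>}"

definition ell2 :: "'g set \<Rightarrow> ('g \<Rightarrow> complex) set" where
  "ell2 S = {f. (\<forall>\<gamma>. \<gamma> \<notin> S \<longrightarrow> f \<gamma> = 0) \<and> (\<lambda>\<gamma>. (cmod (f \<gamma>))\<^sup>2) summable_on S}"

text \<open>Inner products are conjugate-linear in the first variable.\<close>

definition inner2 :: "'g set \<Rightarrow> ('g \<Rightarrow> complex) \<Rightarrow> ('g \<Rightarrow> complex) \<Rightarrow> complex" where
  "inner2 S f g = (\<Sum>\<^sub>\<infinity>\<gamma>\<in>S. cnj (f \<gamma>) * g \<gamma>)"

definition norm2 :: "'g set \<Rightarrow> ('g \<Rightarrow> complex) \<Rightarrow> real" where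
  "norm2 S f = sqrt (\<Sum>\<^sub>\<infinity>\<gamma>\<in>S. (cmod (f \<gamma>))\<^sup>2)"

type_synonym 'g operator = "('g \<Rightarrow> complex) \<Rightarrow> 'g \<Rightarrow> complex"

text \<open>Operators are \<open>undefined\<close> outside their domain, so that equal operators are equal functions.\<close>

definition bounded_ops :: "'g set \<Rightarrow> 'g operator set" where
  "bounded_ops S = {T. T \<in> ell2 S \<rightarrow>\<^sub>E ell2 S
     \<and> (\<forall>f\<in>ell2 S. \<forall>g\<in>ell2 S. T (\<lambda>\<gamma>. f \<gamma> + g \<gamma>) = (\<lambda>\<gamma>. T f \<gamma> + T g \<gamma>))
     \<and> (\<forall>c. \<forall>f\<in>ell2 S. T (\<lambda>\<gamma>. c * f \<gamma>) = (\<lambda>\<gamma>. c * T f \<gamma>))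
     \<and> (\<exists>C. \<forall>f\<in>ell2 S. norm2 S (T f) \<le> C * norm2 S f)}"

definition opnorm :: "'g set \<Rightarrow> 'g operator \<Rightarrow> real" where
  "opnorm S T = Sup {norm2 S (T f) | f. f \<in> ell2 S \<and> norm2 S f \<le> 1}"

definition adj :: "'g set \<Rightarrow> 'g operator \<Rightarrow> 'g operator" where
  "adj S T = (THE R. R \<in> bounded_ops S \<and>
     (\<forall>f\<in>ell2 S. \<forall>g\<in>ell2 S. inner2 S (T f) g = inner2 S f (R g)))"

definition coeff :: "'g set \<Rightarrow> 'g operator \<Rightarrow> 'g \<Rightarrow> 'g \<Rightarrow> complex" where
  "coeff S T \<gamma>'' \<gamma>' = inner2 S (delta \<gamma>'') (T (delta \<gamma>'))"


section \<open>The Hilbert module of a groupoid, adjointable operators and slices\<close>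

definition Cc :: "'g::t2_space groupoid \<Rightarrow> ('g \<Rightarrow> complex) set" where
  "Cc G = {\<xi>. continuous_on UNIV \<xi> \<and> compact (closure {\<gamma>. \<xi> \<gamma> \<noteq> 0})}"

text \<open>The module-valued inner product of \<open>\<xi>\<close> and \<open>\<eta>\<close> at the unit \<open>x\<close> is \<open>inner2 (fiber G x) \<xi> \<eta>\<close>, and
  the module norm is the supremum over \<open>x\<close> of \<open>norm2 (fiber G x) \<xi>\<close>. The functions for which this
  supremum is finite form a Banach space (an \<open>\<ell>\<^sup>\<infinity>\<close>-sum of the spaces \<open>\<ell>\<^sup>2(fiber G x)\<close>), so the
  completion of \<open>Cc G\<close>, as a space of functions, is the closure of \<open>Cc G\<close> in it. Uniform limits of
  functions in \<open>Cc G\<close> lie in \<open>C\<^sub>0(G)\<close>, and the module norm dominates the uniform norm.\<close>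

definition L2 :: "'g::t2_space groupoid \<Rightarrow> ('g \<Rightarrow> complex) set" where
  "L2 G = {\<xi>. \<forall>\<epsilon>>0. \<exists>\<eta>\<in>Cc G. \<forall>x\<in>units G.
     (\<lambda>\<gamma>. (cmod (\<xi> \<gamma> - \<eta> \<gamma>))\<^sup>2) summable_on fiber G x
     \<and> norm2 (fiber G x) (\<lambda>\<gamma>. \<xi> \<gamma> - \<eta> \<gamma>) \<le> \<epsilon>}"

text \<open>As usual for Hilbert modules, linearity, module linearity and boundedness are consequences of
  the existence of an adjoint.\<close>

definition adjointable_ops :: "'g::t2_space groupoid \<Rightarrow> 'g operator set" where
  "adjointable_ops G = {T. T \<in> L2 G \<rightarrow>\<^sub>E L2 G \<and>
     (\<exists>R\<in>L2 G \<rightarrow>\<^sub>E L2 G. \<forall>\<xi>\<in>L2 G. \<forall>\<eta>\<in>L2 G. \<forall>x\<in>units G.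
        inner2 (fiber G x) (T \<xi>) \<eta> = inner2 (fiber G x) \<xi> (R \<eta>))}"

definition slice :: "'g::t2_space groupoid \<Rightarrow> 'g \<Rightarrow> 'g operator \<Rightarrow> 'g operator" where
  "slice G x T = (THE S. S \<in> bounded_ops (fiber G x) \<and>
     (\<forall>\<xi>\<in>L2 G. S (chi (fiber G x) \<xi>) = chi (fiber G x) (T \<xi>)))"


section \<open>Sections of the bundle of operator algebras\<close>

definition E_bundle :: "'g groupoid \<Rightarrow> 'g set \<Rightarrow> ('g \<times> 'g operator) set" where
  "E_bundle G X = Sigma X (\<lambda>x. bounded_ops (fiber G x))"

text \<open>Nets are families \<open>i \<mapsto> p i\<close> together with a filter on the index type, and conditions on the
  members of a net are required eventually.\<close>

definition E_tendsto ::
  "'g::t2_space groupoid \<Rightarrow> ('i \<Rightarrow> 'g \<times> 'g operator) \<Rightarrow> 'g \<times> 'g operator \<Rightarrow> 'i filter \<Rightarrow> bool" where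
  "E_tendsto G p q F \<longleftrightarrow>
     ((\<lambda>i. fst (p i)) \<longlongrightarrow> fst q) F \<and>
     (\<forall>g' g'' \<gamma>' \<gamma>''.
        (\<forall>\<^sub>F i in F. gsrc G (g' i) = fst (p i) \<and> gsrc G (g'' i) = fst (p i)) \<and>
        (g' \<longlongrightarrow> \<gamma>') F \<and> (g'' \<longlongrightarrow> \<gamma>'') F \<longrightarrow>
        ((\<lambda>i. coeff (fiber G (fst (p i))) (snd (p i)) (g'' i) (g' i))
           \<longlongrightarrow> coeff (fiber G (fst q)) (snd q) \<gamma>'' \<gamma>') F)"

text \<open>Continuity means preservation of convergence of nets. A definition cannot quantify over index
  types; the type \<open>'g \<times> 'g\<close> suffices, as \<open>continuous_sectionD\<close> and \<open>extendableD\<close> below show.\<close>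

definition continuous_section ::
  "'g::t2_space groupoid \<Rightarrow> 'g set \<Rightarrow> ('g \<Rightarrow> 'g operator) \<Rightarrow> bool" where
  "continuous_section G X \<sigma> \<longleftrightarrow>
     (\<forall>x\<in>X. (x, \<sigma> x) \<in> E_bundle G X) \<and>
     (\<forall>(F :: ('g \<times> 'g) filter) y. \<forall>x\<in>X.
        (\<forall>\<^sub>F i in F. y i \<in> X) \<and> (y \<longlongrightarrow> x) F \<longrightarrow>
        E_tendsto G (\<lambda>i. (y i, \<sigma> (y i))) (x, \<sigma> x) F)"

definition Gamma_b ::
  "'g::t2_space groupoid \<Rightarrow> 'g set \<Rightarrow> ('g \<Rightarrow> 'g operator) set" where
  "Gamma_b G X = {\<sigma>. continuous_section G X \<sigma> \<and>
     bdd_above ((\<lambda>x. opnorm (fiber G x) (\<sigma> x)) ` X)}"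

definition extendable ::
  "'g::t2_space groupoid \<Rightarrow> 'g set \<Rightarrow> ('g \<Rightarrow> 'g operator) \<Rightarrow> bool" where
  "extendable G X \<sigma> \<longleftrightarrow>
     (\<forall>\<omega>\<in>units G - X. \<forall>\<gamma>'\<in>fiber G \<omega>. \<forall>\<gamma>''\<in>fiber G \<omega>. \<exists>c.
        \<forall>(F :: ('g \<times> 'g) filter) y g' g''.
          (\<forall>\<^sub>F i in F. y i \<in> X \<and> g' i \<in> fiber G (y i) \<and> g'' i \<in> fiber G (y i)) \<and>
          (y \<longlongrightarrow> \<omega>) F \<and> (g' \<longlongrightarrow> \<gamma>') F \<and> (g'' \<longlongrightarrow> \<gamma>'') F \<longrightarrow>
          ((\<lambda>i. coeff (fiber G (y i)) (\<sigma> (y i)) (g'' i) (g' i)) \<longlongrightarrow> c) F)"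

lemma continuous_sectionD:
  fixes F :: "'i filter"
  assumes "continuous_section G X \<sigma>" "x \<in> X" "\<forall>\<^sub>F i in F. y i \<in> X" "(y \<longlongrightarrow> x) F"
  shows "E_tendsto G (\<lambda>i. (y i, \<sigma> (y i))) (x, \<sigma> x) F"
  unfolding E_tendsto_def fst_conv snd_conv
proof (intro conjI allI impI)
  show "(y \<longlongrightarrow> x) F" by fact
next
  fix g' g'' \<gamma>' \<gamma>''
  assume g: "(\<forall>\<^sub>F i in F. gsrc G (g' i) = y i \<and> gsrc G (g'' i) = y i) \<and>
    (g' \<longlongrightarrow> \<gamma>') F \<and> (g'' \<longlongrightarrow> \<gamma>'') F"
  define H where "H = filtermap (\<lambda>i. (g' i, g'' i)) F"
  define z where "z = (\<lambda>p::'a \<times> 'a. gsrc G (fst p))"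
  have zy: "\<forall>\<^sub>F i in F. z (g' i, g'' i) = y i"
    using g by (auto simp: z_def elim: eventually_mono)
  have "\<forall>\<^sub>F i in H. z i \<in> X"
    unfolding H_def eventually_filtermap using zy assms(3) by eventually_elim simp
  moreover have "(z \<longlongrightarrow> x) H"
    unfolding H_def tendsto_def eventually_filtermap
  proof (intro allI impI)
    fix S assume "open S" "x \<in> S"
    then have "\<forall>\<^sub>F i in F. y i \<in> S" using assms(4) by (simp add: tendsto_def)
    with zy show "\<forall>\<^sub>F i in F. z (g' i, g'' i) \<in> S" by eventually_elim simp
  qed
  ultimately have E: "E_tendsto G (\<lambda>i. (z i, \<sigma> (z i))) (x, \<sigma> x) H"
    using assms(1,2) unfolding continuous_section_def by blast
  have "\<forall>\<^sub>F i in H. gsrc G (fst i) = z i \<and> gsrc G (snd i) = z i"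
    unfolding H_def eventually_filtermap using zy g by (auto simp: z_def elim: eventually_mono)
  moreover have "(fst \<longlongrightarrow> \<gamma>') H" "(snd \<longlongrightarrow> \<gamma>'') H"
    using g by (simp_all add: H_def tendsto_def eventually_filtermap)
  ultimately have "((\<lambda>i. coeff (fiber G (z i)) (\<sigma> (z i)) (snd i) (fst i))
      \<longlongrightarrow> coeff (fiber G x) (\<sigma> x) \<gamma>'' \<gamma>') H"
    using E unfolding E_tendsto_def fst_conv snd_conv by blast
  then have "((\<lambda>i. coeff (fiber G (z (g' i, g'' i))) (\<sigma> (z (g' i, g'' i))) (g'' i) (g' i))
      \<longlongrightarrow> coeff (fiber G x) (\<sigma> x) \<gamma>'' \<gamma>') F"
    by (simp add: H_def filterlim_filtermap)
  then show "((\<lambda>i. coeff (fiber G (y i)) (\<sigma> (y i)) (g'' i) (g' i))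
      \<longlongrightarrow> coeff (fiber G x) (\<sigma> x) \<gamma>'' \<gamma>') F"
    by (rule Lim_transform_eventually) (use zy in eventually_elim, simp)
qed

lemma extendableD:
  assumes "extendable G X \<sigma>" "\<omega> \<in> units G - X" "\<gamma>' \<in> fiber G \<omega>" "\<gamma>'' \<in> fiber G \<omega>"
  obtains c where
    "\<And>(F :: 'i filter) y g' g''.
       \<forall>\<^sub>F i in F. y i \<in> X \<and> g' i \<in> fiber G (y i) \<and> g'' i \<in> fiber G (y i) \<Longrightarrow>
       (y \<longlongrightarrow> \<omega>) F \<Longrightarrow> (g' \<longlongrightarrow> \<gamma>') F \<Longrightarrow> (g'' \<longlongrightarrow> \<gamma>'') F \<Longrightarrow>
       ((\<lambda>i. coeff (fiber G (y i)) (\<sigma> (y i)) (g'' i) (g' i)) \<longlongrightarrow> c) F"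
proof -
  obtain c where c: "\<And>(F :: ('a \<times> 'a) filter) y g' g''.
      \<forall>\<^sub>F i in F. y i \<in> X \<and> g' i \<in> fiber G (y i) \<and> g'' i \<in> fiber G (y i) \<Longrightarrow>
      (y \<longlongrightarrow> \<omega>) F \<Longrightarrow> (g' \<longlongrightarrow> \<gamma>') F \<Longrightarrow> (g'' \<longlongrightarrow> \<gamma>'') F \<Longrightarrow>
      ((\<lambda>i. coeff (fiber G (y i)) (\<sigma> (y i)) (g'' i) (g' i)) \<longlongrightarrow> c) F"
    using assms unfolding extendable_def by meson
  show thesis
  proof (rule that)
    fix F :: "'i filter" and y g' g''
    assume g: "\<forall>\<^sub>F i in F. y i \<in> X \<and> g' i \<in> fiber G (y i) \<and> g'' i \<in> fiber G (y i)"
      "(y \<longlongrightarrow> \<omega>) F" "(g' \<longlongrightarrow> \<gamma>') F" "(g'' \<longlongrightarrow> \<gamma>'') F"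
    define H where "H = filtermap (\<lambda>i. (g' i, g'' i)) F"
    define z where "z = (\<lambda>p::'a \<times> 'a. gsrc G (fst p))"
    have zy: "\<forall>\<^sub>F i in F. z (g' i, g'' i) = y i"
      using g(1) by (auto simp: z_def fiber_def elim: eventually_mono)
    have "\<forall>\<^sub>F i in H. z i \<in> X \<and> fst i \<in> fiber G (z i) \<and> snd i \<in> fiber G (z i)"
      unfolding H_def eventually_filtermap using zy g(1) by eventually_elim simp
    moreover have "(z \<longlongrightarrow> \<omega>) H"
      unfolding H_def tendsto_def eventually_filtermap
    proof (intro allI impI)
      fix S assume "open S" "\<omega> \<in> S"
      then have "\<forall>\<^sub>F i in F. y i \<in> S" using g(2) by (simp add: tendsto_def)
      with zy show "\<forall>\<^sub>F i in F. z (g' i, g'' i) \<in> S" by eventually_elim simp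
    qed
    moreover have "(fst \<longlongrightarrow> \<gamma>') H" "(snd \<longlongrightarrow> \<gamma>'') H"
      using g(3,4) by (simp_all add: H_def tendsto_def eventually_filtermap)
    ultimately have "((\<lambda>i. coeff (fiber G (z i)) (\<sigma> (z i)) (snd i) (fst i)) \<longlongrightarrow> c) H"
      by (rule c)
    then have "((\<lambda>i. coeff (fiber G (z (g' i, g'' i))) (\<sigma> (z (g' i, g'' i))) (g'' i) (g' i))
        \<longlongrightarrow> c) F"
      by (simp add: H_def filterlim_filtermap)
    then show "((\<lambda>i. coeff (fiber G (y i)) (\<sigma> (y i)) (g'' i) (g' i)) \<longlongrightarrow> c) F"
      by (rule Lim_transform_eventually) (use zy in eventually_elim, simp)
  qed
qed

end

theory Submission
  imports Defs
begin

text \<open>Extendability and density of \<open>X\<close> turn the matrix coefficients of \<open>\<sigma>\<close> into a kernel \<open>k\<close> that is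
  continuous on the pairs of arrows with a common source, and the uniform bound on \<open>\<sigma>\<close> passes to the
  matrices of \<open>k\<close> on all fibers, since arrows over a unit move along local sections of the source map.
  Applying \<open>k\<close> to a function in \<open>Cc G\<close> gives a continuous function; condition (2) for \<open>\<sigma>\<close>, again
  carried from \<open>X\<close> to all units by local sections, says precisely that cutting it off outside a large
  compact set changes it little in the module norm. So \<open>k\<close> acts on \<open>L2 G\<close>, with the kernel
  \<open>cnj (k b a)\<close> as adjoint. Conversely, (2) holds for an adjointable \<open>T\<close> because \<open>T \<xi>\<close> and its
  counterpart for the adjoint are limits of functions in \<open>Cc G\<close>; its slices are bounded by the
  Hellinger-Toeplitz theorem, because restriction maps \<open>L2 G\<close> onto the \<open>\<ell>\<^sup>2\<close>-space of each fiber.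

  Condition (3) is additive in \<open>\<xi>\<close>, and \<open>Cc G\<close> is spanned by functions supported in a bisection. For
  these, restriction to \<open>B\<close> either kills the only value on a fiber, at \<open>b\<close> say, or changes nothing, and in
  the latter case a compact set \<open>K\<close> for (2) becomes \<open>K b\<inverse> \<subseteq> K (supp \<xi>)\<inverse>\<close> in (3).\<close>

section \<open>Square-summable functions and bounded matrices\<close>

text \<open>The section \<open>\<sigma>\<close> is known only over \<open>X\<close>, whereas
  membership in \<open>L2 G\<close> concerns all units at once. Fibers over different units are
  compared by moving finitely many arrows along local sections, so norms and operator bounds are
  phrased through finite sets (\<open>L2_set\<close>, \<open>matrix_bound\<close>): such an
  inequality involves finitely many values of continuous functions and survives the limit. What a
  bounded continuous kernel lacks is control at infinity: \<open>kernel_op k \<xi>\<close> is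
  continuous and uniformly square summable on fibers, but its mass may escape every compact set.
  This is the gap that (2) closes; its adjoint half is there because the candidate adjoint must also
  map \<open>L2 G\<close> to itself. \<open>adjointable_ops\<close> asks for neither linearity nor
  boundedness, and \<open>slice\<close> is a definite description, so linearity, boundedness and
  independence of the chosen lift have to be proved on each fiber before slices can be used. From
  (3) back to (2) one takes for \<open>B\<close> the part of the fiber inside a compact set
  \<open>L\<close> carrying \<open>\<xi>\<close>; then \<open>K B\<close> lies in the compact set
  \<open>K L\<close>.\<close>

lemma ell2_eq_0: "f \<in> ell2 S \<Longrightarrow> a \<notin> S \<Longrightarrow> f a = 0"
  by (simp add: ell2_def)

lemma ell2_summable: "f \<in> ell2 S \<Longrightarrow> (\<lambda>a. (cmod (f a))\<^sup>2) summable_on S"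
  by (simp add: ell2_def)

lemma norm2_nonneg [simp]: "0 \<le> norm2 S f"
  by (simp add: norm2_def infsum_nonneg)

lemma L2_set_le_norm2_summable:
  assumes "(\<lambda>a. (cmod (f a))\<^sup>2) summable_on S" "finite F" "F \<subseteq> S"
  shows "L2_set (\<lambda>a. cmod (f a)) F \<le> norm2 S f"
  unfolding L2_set_def norm2_def
  using assms by (intro real_sqrt_le_mono finite_sum_le_infsum) auto

lemma L2_set_le_norm2:
  assumes "f \<in> ell2 S" "finite F" "F \<subseteq> S"
  shows "L2_set (\<lambda>a. cmod (f a)) F \<le> norm2 S f"
  using assms by (intro L2_set_le_norm2_summable ell2_summable)

text \<open>A sum of nonnegative terms is the supremum of its finite partial sums. This turns bounds
  on finite subsets of a fiber, the only ones that are carried to neighbouring fibers, into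
  summability and a norm bound.\<close>

lemma sq_summable_bounded:
  assumes "\<And>F. finite F \<Longrightarrow> F \<subseteq> S \<Longrightarrow> L2_set (\<lambda>a. cmod (f a)) F \<le> C"
  shows "(\<lambda>a. (cmod (f a))\<^sup>2) summable_on S" and "norm2 S f \<le> C"
proof -
  have C: "0 \<le> C" using assms[of "{}"] by simp
  have le: "(\<Sum>a\<in>F. (cmod (f a))\<^sup>2) \<le> C\<^sup>2" if "finite F" "F \<subseteq> S" for F
    using assms[OF that] unfolding L2_set_def by (simp add: sqrt_le_D)
  show s: "(\<lambda>a. (cmod (f a))\<^sup>2) summable_on S"
    by (rule nonneg_bdd_above_summable_on) (auto intro!: bdd_aboveI[of _ "C\<^sup>2"] le)
  have "(\<Sum>\<^sub>\<infinity>a\<in>S. (cmod (f a))\<^sup>2) \<le> C\<^sup>2"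
    using s le by (rule infsum_le_finite_sums) auto
  then show "norm2 S f \<le> C" unfolding norm2_def by (rule real_le_lsqrt[OF C])
qed

lemma ell2I_bounded:
  assumes "\<And>a. a \<notin> S \<Longrightarrow> f a = 0"
    and "\<And>F. finite F \<Longrightarrow> F \<subseteq> S \<Longrightarrow> L2_set (\<lambda>a. cmod (f a)) F \<le> C"
  shows "f \<in> ell2 S" and "norm2 S f \<le> C"
  using assms sq_summable_bounded[of S f C] by (auto simp: ell2_def)

lemma norm2_cong: "(\<And>a. a \<in> S \<Longrightarrow> f a = g a) \<Longrightarrow> norm2 S f = norm2 S g"
  unfolding norm2_def by (simp cong: infsum_cong)

lemma inner2_cong:
  "(\<And>a. a \<in> S \<Longrightarrow> f a = f' a) \<Longrightarrow> (\<And>a. a \<in> S \<Longrightarrow> g a = g' a) \<Longrightarrow> inner2 S f g = inner2 S f' g'"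
  unfolding inner2_def by (simp cong: infsum_cong)

lemma chi_apply: "chi A f a = (if a \<in> A then f a else 0)"
  by (simp add: chi_def)

lemma norm2_chi [simp]: "norm2 S (chi S f) = norm2 S f"
  by (rule norm2_cong) (simp add: chi_apply)

text \<open>Functions on the groupoid do not vanish off a fiber; this is the passage from the
  summability in \<open>L2\<close> to genuine vectors of \<open>ell2\<close>.\<close>

lemma chi_in_ell2_iff: "chi S f \<in> ell2 S \<longleftrightarrow> (\<lambda>a. (cmod (f a))\<^sup>2) summable_on S"
  by (auto simp: ell2_def chi_apply cong: summable_on_cong)

lemma L2_set_cmod_add:
  "L2_set (\<lambda>a. cmod (f a + g a)) F \<le> L2_set (\<lambda>a. cmod (f a)) F + L2_set (\<lambda>a. cmod (g a)) F"
  by (rule order_trans[OF L2_set_mono L2_set_triangle_ineq]) (auto intro: norm_triangle_ineq)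

lemma ell2_add:
  assumes "f \<in> ell2 S" "g \<in> ell2 S"
  shows "(\<lambda>a. f a + g a) \<in> ell2 S" and norm2_triangle: "norm2 S (\<lambda>a. f a + g a) \<le> norm2 S f + norm2 S g"
proof -
  have *: "L2_set (\<lambda>a. cmod (f a + g a)) F \<le> norm2 S f + norm2 S g" if "finite F" "F \<subseteq> S" for F
    using L2_set_cmod_add[of f g F] L2_set_le_norm2[OF assms(1) that] L2_set_le_norm2[OF assms(2) that]
    by linarith
  show "(\<lambda>a. f a + g a) \<in> ell2 S" "norm2 S (\<lambda>a. f a + g a) \<le> norm2 S f + norm2 S g"
    using ell2I_bounded[of S "\<lambda>a. f a + g a", OF _ *] assms by (auto simp: ell2_eq_0)
qed

lemma norm2_cmult: "norm2 S (\<lambda>a. c * f a) = cmod c * norm2 S f"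
  unfolding norm2_def norm_mult power_mult_distrib
  by (subst infsum_cmult_right') (simp add: real_sqrt_mult)

lemma ell2_cmult: "f \<in> ell2 S \<Longrightarrow> (\<lambda>a. c * f a) \<in> ell2 S"
  by (auto simp: ell2_def norm_mult power_mult_distrib intro: summable_on_cmult_right)

lemma norm2_uminus: "norm2 S (\<lambda>a. - f a) = norm2 S f"
  by (simp add: norm2_def)

lemma ell2_uminus: "f \<in> ell2 S \<Longrightarrow> (\<lambda>a. - f a) \<in> ell2 S"
  by (simp add: ell2_def)

lemma ell2_diff:
  assumes "f \<in> ell2 S" "g \<in> ell2 S"
  shows "(\<lambda>a. f a - g a) \<in> ell2 S" and norm2_triangle_diff: "norm2 S (\<lambda>a. f a - g a) \<le> norm2 S f + norm2 S g"
  using ell2_add[OF assms(1) ell2_uminus[OF assms(2)]] norm2_uminus[of S g] by auto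

lemma ell2_zero [simp]: "(\<lambda>a. 0) \<in> ell2 S" and norm2_zero [simp]: "norm2 S (\<lambda>a. 0) = 0"
  by (auto simp: ell2_def norm2_def)

lemma ell2_sum: "(\<And>i. i \<in> I \<Longrightarrow> f i \<in> ell2 S) \<Longrightarrow> (\<lambda>a. \<Sum>i\<in>I. f i a) \<in> ell2 S"
  by (induction I rule: infinite_finite_induct) (auto intro!: ell2_add)

lemma norm2_sum_le:
  assumes "\<And>i. i \<in> I \<Longrightarrow> f i \<in> ell2 S"
  shows "norm2 S (\<lambda>a. \<Sum>i\<in>I. f i a) \<le> (\<Sum>i\<in>I. norm2 S (f i))"
  using assms
proof (induction I rule: infinite_finite_induct)
  case (insert i I)
  have "norm2 S (\<lambda>a. f i a + (\<Sum>i\<in>I. f i a)) \<le> norm2 S (f i) + norm2 S (\<lambda>a. \<Sum>i\<in>I. f i a)"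
    using insert by (intro norm2_triangle ell2_sum) auto
  then show ?case using insert by (auto intro: order_trans)
qed auto

lemma chi_in_ell2:
  assumes "f \<in> ell2 S"
  shows "chi A f \<in> ell2 S" and norm2_chi_le: "norm2 S (chi A f) \<le> norm2 S f"
proof -
  have *: "L2_set (\<lambda>a. cmod (chi A f a)) F \<le> norm2 S f" if "finite F" "F \<subseteq> S" for F
    using L2_set_le_norm2[OF assms that]
    by (rule order_trans[rotated]) (auto simp: chi_apply intro!: L2_set_mono)
  show "chi A f \<in> ell2 S" "norm2 S (chi A f) \<le> norm2 S f"
    using ell2I_bounded[of S "chi A f", OF _ *] assms by (auto simp: ell2_eq_0 chi_apply)
qed

lemma norm2_finite_support:
  assumes "finite F" "F \<subseteq> S" "\<And>a. a \<in> S \<Longrightarrow> a \<notin> F \<Longrightarrow> f a = 0"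
  shows "norm2 S f = L2_set (\<lambda>a. cmod (f a)) F"
proof -
  have "(\<Sum>\<^sub>\<infinity>a\<in>S. (cmod (f a))\<^sup>2) = (\<Sum>\<^sub>\<infinity>a\<in>F. (cmod (f a))\<^sup>2)"
    using assms by (intro infsum_cong_neutral) auto
  then show ?thesis using assms(1) by (simp add: norm2_def L2_set_def)
qed

lemma ell2_finite_support:
  assumes "finite F" "F \<subseteq> S" "\<And>a. a \<notin> F \<Longrightarrow> f a = 0"
  shows "f \<in> ell2 S"
proof -
  have "(\<lambda>a. (cmod (f a))\<^sup>2) summable_on F" using assms(1) by simp
  then have "(\<lambda>a. (cmod (f a))\<^sup>2) summable_on S"
    using assms by (subst summable_on_cong_neutral[where T=F and g="\<lambda>a. (cmod (f a))\<^sup>2"]) auto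
  then show ?thesis using assms by (auto simp: ell2_def)
qed

lemma delta_apply: "delta a b = (if b = a then 1 else 0)"
  by (simp add: delta_def)

lemma delta_in_ell2 [simp]: "a \<in> S \<Longrightarrow> delta a \<in> ell2 S"
  by (rule ell2_finite_support[of "{a}"]) (auto simp: delta_apply)

lemma cmod_le_norm2: "f \<in> ell2 S \<Longrightarrow> cmod (f a) \<le> norm2 S f"
  by (cases "a \<in> S") (use L2_set_le_norm2[of f S "{a}"] in \<open>auto simp: ell2_eq_0\<close>)

lemma chi_finite_eq_sum: "finite F \<Longrightarrow> chi F f = (\<lambda>a. \<Sum>b\<in>F. f b * delta b a)"
  by (rule ext) (simp add: chi_apply delta_apply if_distrib[of "(*) _"] sum.delta cong: if_cong)

text \<open>The finite set carries all but \<open>e\<^sup>2\<close> of the squared norm, so any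
  finite part of the remainder has squared norm at most \<open>e\<^sup>2\<close>.\<close>

lemma ell2_finite_approx:
  assumes f: "f \<in> ell2 S" and e: "e > 0"
  obtains F where "finite F" "F \<subseteq> S" "norm2 S (\<lambda>a. f a - chi F f a) \<le> e"
proof -
  let ?h = "\<lambda>a. (cmod (f a))\<^sup>2"
  obtain F where F: "finite F" "F \<subseteq> S" "dist (sum ?h F) (infsum ?h S) \<le> e\<^sup>2"
    using infsum_finite_approximation[OF ell2_summable[OF f], of "e\<^sup>2"] e by auto
  have "L2_set (\<lambda>a. cmod (f a - chi F f a)) H \<le> e" if H: "finite H" "H \<subseteq> S" for H
  proof -
    have "(\<Sum>a\<in>H. (cmod (f a - chi F f a))\<^sup>2) = (\<Sum>a\<in>H - F. ?h a)"
      using H by (intro sum.mono_neutral_cong_right) (auto simp: chi_apply)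
    also have "\<dots> = (\<Sum>a\<in>H \<union> F. ?h a) - sum ?h F"
    proof -
      have "H - F = (H \<union> F) - F" by auto
      then show ?thesis using F H by (simp add: sum_diff)
    qed
    also have "\<dots> \<le> infsum ?h S - sum ?h F"
      using F H by (intro diff_right_mono finite_sum_le_infsum ell2_summable[OF f]) auto
    also have "\<dots> \<le> e\<^sup>2" using F(3) by (simp add: dist_real_def)
    finally show ?thesis using e by (simp add: L2_set_def real_le_lsqrt)
  qed
  then have "norm2 S (\<lambda>a. f a - chi F f a) \<le> e" by (rule sq_summable_bounded)
  with F show thesis by (intro that)
qed

section \<open>Inner products\<close>

lemma inner2_Cauchy_Schwarz:
  assumes f: "f \<in> ell2 S" and g: "g \<in> ell2 S"
  shows inner2_summable: "(\<lambda>a. cmod (cnj (f a) * g a)) summable_on S"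
    and "cmod (inner2 S f g) \<le> norm2 S f * norm2 S g"
proof -
  have le: "(\<Sum>a\<in>F. cmod (cnj (f a) * g a)) \<le> norm2 S f * norm2 S g" if F: "finite F" "F \<subseteq> S" for F
  proof -
    have "(\<Sum>a\<in>F. cmod (cnj (f a) * g a)) \<le> L2_set (\<lambda>a. cmod (f a)) F * L2_set (\<lambda>a. cmod (g a)) F"
      using L2_set_mult_ineq[of "\<lambda>a. cmod (f a)" "\<lambda>a. cmod (g a)" F] by (simp add: norm_mult)
    also have "\<dots> \<le> norm2 S f * norm2 S g"
      by (intro mult_mono L2_set_le_norm2 f g F) auto
    finally show ?thesis .
  qed
  \<comment> \<open>Absolute summability is kept as a fact of its own: \<open>infsum\<close> is 0 by
    default on families that are not summable, so additivity of \<open>inner2\<close> relies on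
    it.\<close>
  show s: "(\<lambda>a. cmod (cnj (f a) * g a)) summable_on S"
    by (rule nonneg_bdd_above_summable_on) (auto intro!: bdd_aboveI le)
  have "cmod (inner2 S f g) \<le> (\<Sum>\<^sub>\<infinity>a\<in>S. cmod (cnj (f a) * g a))"
    unfolding inner2_def by (rule norm_infsum_bound[OF s])
  also have "\<dots> \<le> norm2 S f * norm2 S g"
    using s le by (rule infsum_le_finite_sums) auto
  finally show "cmod (inner2 S f g) \<le> norm2 S f * norm2 S g" .
qed

lemma inner2_commute: "inner2 S g f = cnj (inner2 S f g)"
proof -
  have "cnj (inner2 S f g) = (\<Sum>\<^sub>\<infinity>a\<in>S. cnj (cnj (f a) * g a))"
    unfolding inner2_def by (rule infsum_cnj[symmetric])
  then show ?thesis by (simp add: inner2_def mult.commute)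
qed

lemma inner2_add_right:
  assumes "f \<in> ell2 S" "g \<in> ell2 S" "h \<in> ell2 S"
  shows "inner2 S f (\<lambda>a. g a + h a) = inner2 S f g + inner2 S f h"
  unfolding inner2_def distrib_left
  by (intro infsum_add abs_summable_summable[OF inner2_summable] assms)

lemma inner2_cmult_right: "inner2 S f (\<lambda>a. c * g a) = c * inner2 S f g"
proof -
  have "inner2 S f (\<lambda>a. c * g a) = (\<Sum>\<^sub>\<infinity>a\<in>S. c * (cnj (f a) * g a))"
    by (simp add: inner2_def mult_ac)
  then show ?thesis by (simp only: infsum_cmult_right' inner2_def)
qed

lemma inner2_diff_right:
  assumes "f \<in> ell2 S" "g \<in> ell2 S" "h \<in> ell2 S"
  shows "inner2 S f (\<lambda>a. g a - h a) = inner2 S f g - inner2 S f h"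
proof -
  have "(\<lambda>a. -1 * h a) \<in> ell2 S" by (rule ell2_cmult[OF assms(3)])
  from inner2_add_right[OF assms(1,2) this] show ?thesis
    using inner2_cmult_right[of S f "-1" h] by simp
qed

lemma inner2_zero_right [simp]: "inner2 S f (\<lambda>a. 0) = 0"
  by (simp add: inner2_def)

lemma inner2_sum_right:
  assumes "f \<in> ell2 S" "\<And>i. i \<in> I \<Longrightarrow> g i \<in> ell2 S"
  shows "inner2 S f (\<lambda>a. \<Sum>i\<in>I. c i * g i a) = (\<Sum>i\<in>I. c i * inner2 S f (g i))"
  using assms(2)
proof (induction I rule: infinite_finite_induct)
  case (insert i I)
  have "inner2 S f (\<lambda>a. c i * g i a + (\<Sum>i\<in>I. c i * g i a))
      = inner2 S f (\<lambda>a. c i * g i a) + inner2 S f (\<lambda>a. \<Sum>i\<in>I. c i * g i a)"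
    using insert.prems by (intro inner2_add_right assms(1) ell2_cmult ell2_sum) auto
  then show ?case using insert by (simp add: inner2_cmult_right)
qed simp_all

lemma inner2_delta_left [simp]:
  assumes "a \<in> S" shows "inner2 S (delta a) f = f a"
proof -
  have "inner2 S (delta a) f = (\<Sum>\<^sub>\<infinity>b\<in>{a}. f b)"
    unfolding inner2_def using assms by (intro infsum_cong_neutral) (auto simp: delta_apply)
  then show ?thesis by simp
qed

lemma inner2_delta_right [simp]: "a \<in> S \<Longrightarrow> inner2 S f (delta a) = cnj (f a)"
  by (subst inner2_commute) simp

lemma inner2_self:
  assumes "f \<in> ell2 S" shows "inner2 S f f = complex_of_real ((norm2 S f)\<^sup>2)"
proof -
  have "inner2 S f f = (\<Sum>\<^sub>\<infinity>a\<in>S. complex_of_real ((cmod (f a))\<^sup>2))"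
    unfolding inner2_def
    by (intro infsum_cong) (metis complex_norm_square mult.commute)
  also have "\<dots> = complex_of_real (\<Sum>\<^sub>\<infinity>a\<in>S. (cmod (f a))\<^sup>2)"
    using has_sum_infsum[OF ell2_summable[OF assms]] by (intro infsumI) (simp only: has_sum_of_real_iff)
  also have "\<dots> = complex_of_real ((norm2 S f)\<^sup>2)"
    by (simp add: norm2_def infsum_nonneg)
  finally show ?thesis .
qed

text \<open>Linearity spreads the vanishing from basis vectors to finitely supported ones, and these
  are dense by \<open>ell2_finite_approx\<close>. Identities between operators are reduced to their
  entries in this way.\<close>

lemma ell2_functional_eq_0:
  assumes add: "\<And>f g. f \<in> ell2 S \<Longrightarrow> g \<in> ell2 S \<Longrightarrow> \<phi> (\<lambda>a. f a + g a) = \<phi> f + \<phi> g"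
    and scale: "\<And>c f. f \<in> ell2 S \<Longrightarrow> \<phi> (\<lambda>a. c * f a) = c * \<phi> f"
    and bound: "\<And>f. f \<in> ell2 S \<Longrightarrow> cmod (\<phi> f) \<le> C * norm2 S f"
    and delta: "\<And>a. a \<in> S \<Longrightarrow> \<phi> (delta a) = 0"
    and f: "f \<in> ell2 S"
  shows "\<phi> f = 0"
proof -
  have zero: "\<phi> (\<lambda>a. 0) = 0" using scale[of "\<lambda>a. 0" 0] by simp
  have fin: "\<phi> (\<lambda>a. \<Sum>b\<in>F. f b * delta b a) = 0" if "finite F" "F \<subseteq> S" for F
    using that
  proof (induction F)
    case (insert b F)
    have "\<phi> (\<lambda>a. f b * delta b a + (\<Sum>b\<in>F. f b * delta b a))
        = \<phi> (\<lambda>a. f b * delta b a) + \<phi> (\<lambda>a. \<Sum>b\<in>F. f b * delta b a)"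
      using insert.prems by (intro add ell2_cmult ell2_sum delta_in_ell2) auto
    then show ?case using insert by (simp add: scale delta)
  qed (simp add: zero)
  have "cmod (\<phi> f) \<le> \<bar>C\<bar> * e" if "e > 0" for e
  proof -
    obtain F where F: "finite F" "F \<subseteq> S" "norm2 S (\<lambda>a. f a - chi F f a) \<le> e"
      by (rule ell2_finite_approx[OF f \<open>e > 0\<close>])
    have "\<phi> (\<lambda>a. (f a - chi F f a) + chi F f a) = \<phi> (\<lambda>a. f a - chi F f a) + \<phi> (chi F f)"
      by (intro add ell2_diff chi_in_ell2 f)
    then have "\<phi> f = \<phi> (\<lambda>a. f a - chi F f a)"
      using fin[OF F(1,2)] chi_finite_eq_sum[OF F(1), of f] by simp
    also have "cmod \<dots> \<le> C * norm2 S (\<lambda>a. f a - chi F f a)"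
      by (intro bound ell2_diff chi_in_ell2 f)
    also have "\<dots> \<le> \<bar>C\<bar> * e" using F(3) by (intro mult_mono) auto
    finally show ?thesis .
  qed
  \<comment> \<open>The approximation error is scaled by \<open>1 / |C|\<close>, so
    \<open>C = 0\<close> is treated apart; there the estimate already reads 0.\<close>
  then have "cmod (\<phi> f) \<le> 0"
  proof (cases "C = 0")
    case False
    show ?thesis
    proof (rule field_le_epsilon)
      fix e :: real assume "e > 0"
      then show "cmod (\<phi> f) \<le> 0 + e"
        using \<open>\<And>e. e > 0 \<Longrightarrow> cmod (\<phi> f) \<le> \<bar>C\<bar> * e\<close>[of "e / \<bar>C\<bar>"] False by simp
    qed
  qed (use \<open>\<And>e. e > 0 \<Longrightarrow> cmod (\<phi> f) \<le> \<bar>C\<bar> * e\<close>[of 1] in simp)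
  then show ?thesis by simp
qed

section \<open>Bounded operators and their matrices\<close>

lemma bounded_opsD:
  assumes "T \<in> bounded_ops S"
  shows bounded_ops_mem: "f \<in> ell2 S \<Longrightarrow> T f \<in> ell2 S"
    and bounded_ops_add: "f \<in> ell2 S \<Longrightarrow> g \<in> ell2 S \<Longrightarrow> T (\<lambda>a. f a + g a) = (\<lambda>a. T f a + T g a)"
    and bounded_ops_scale: "f \<in> ell2 S \<Longrightarrow> T (\<lambda>a. c * f a) = (\<lambda>a. c * T f a)"
    and bounded_ops_outside: "f \<notin> ell2 S \<Longrightarrow> T f = undefined"
  using assms by (auto simp: bounded_ops_def)

lemma bounded_ops_bound:
  assumes "T \<in> bounded_ops S"
  obtains C where "C \<ge> 0" "\<And>f. f \<in> ell2 S \<Longrightarrow> norm2 S (T f) \<le> C * norm2 S f"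
proof -
  have "\<exists>C. \<forall>f\<in>ell2 S. norm2 S (T f) \<le> C * norm2 S f"
    using assms by (simp add: bounded_ops_def)
  then obtain C where C: "\<And>f. f \<in> ell2 S \<Longrightarrow> norm2 S (T f) \<le> C * norm2 S f"
    by blast
  have "norm2 S (T f) \<le> max C 0 * norm2 S f" if "f \<in> ell2 S" for f
    using C[OF that] by (meson max.cobounded1 mult_right_mono norm2_nonneg order_trans)
  then show thesis by (intro that[of "max C 0"]) auto
qed

lemma bounded_ops_zero:
  assumes "T \<in> bounded_ops S" shows "T (\<lambda>a. 0) = (\<lambda>a. 0)"
  using bounded_ops_scale[OF assms ell2_zero, of 0] by simp

lemma bounded_ops_diff:
  assumes "T \<in> bounded_ops S" "f \<in> ell2 S" "g \<in> ell2 S"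
  shows "T (\<lambda>a. f a - g a) = (\<lambda>a. T f a - T g a)"
  using bounded_ops_add[OF assms(1,2) ell2_cmult[OF assms(3)], of "-1"]
    bounded_ops_scale[OF assms(1,3), of "-1"] by simp

lemma bounded_ops_sum:
  assumes T: "T \<in> bounded_ops S" and f: "\<And>i. i \<in> I \<Longrightarrow> f i \<in> ell2 S"
  shows "T (\<lambda>a. \<Sum>i\<in>I. c i * f i a) = (\<lambda>a. \<Sum>i\<in>I. c i * T (f i) a)"
  using f
proof (induction I rule: infinite_finite_induct)
  case (insert i I)
  have "T (\<lambda>a. c i * f i a + (\<Sum>i\<in>I. c i * f i a))
      = (\<lambda>a. T (\<lambda>a. c i * f i a) a + T (\<lambda>a. \<Sum>i\<in>I. c i * f i a) a)"
    using insert.prems by (intro bounded_ops_add[OF T] ell2_cmult ell2_sum) auto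
  then show ?case using insert by (simp add: bounded_ops_scale[OF T])
qed (simp_all add: bounded_ops_zero[OF T])

text \<open>Each coordinate of the difference is a bounded functional, so
  \<open>ell2_functional_eq_0\<close> applies. Outside \<open>ell2 S\<close> both operators are
  \<open>undefined\<close>, hence they are equal as functions; this settles uniqueness in the
  descriptions \<open>adj\<close> and \<open>slice\<close>.\<close>

lemma bounded_ops_eqI:
  assumes T: "T \<in> bounded_ops S" and R: "R \<in> bounded_ops S"
    and eq: "\<And>a b. a \<in> S \<Longrightarrow> b \<in> S \<Longrightarrow> T (delta b) a = R (delta b) a"
  shows "T = R"
proof
  fix f
  show "T f = R f"
  proof (cases "f \<in> ell2 S")
    case True
    obtain C where C: "\<And>f. f \<in> ell2 S \<Longrightarrow> norm2 S (T f) \<le> C * norm2 S f"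
      using bounded_ops_bound[OF T] by metis
    obtain D where D: "\<And>f. f \<in> ell2 S \<Longrightarrow> norm2 S (R f) \<le> D * norm2 S f"
      using bounded_ops_bound[OF R] by metis
    have "T f a - R f a = 0" if "a \<in> S" for a
    proof (rule ell2_functional_eq_0[where S=S and \<phi>="\<lambda>f. T f a - R f a" and C="C + D"])
      fix f assume f: "f \<in> ell2 S"
      have "cmod (T f a - R f a) \<le> cmod (T f a) + cmod (R f a)" by (rule norm_triangle_ineq4)
      also have "\<dots> \<le> norm2 S (T f) + norm2 S (R f)"
        by (intro add_mono cmod_le_norm2 bounded_ops_mem[OF T] bounded_ops_mem[OF R] f)
      also have "\<dots> \<le> (C + D) * norm2 S f" using C[OF f] D[OF f] by (simp add: distrib_right)
      finally show "cmod (T f a - R f a) \<le> (C + D) * norm2 S f" .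
    qed (use True that eq bounded_opsD(2,3)[OF T] bounded_opsD(2,3)[OF R] in \<open>auto simp: algebra_simps\<close>)
    then have "T f a = R f a" for a
      using ell2_eq_0[OF bounded_ops_mem[OF T True]] ell2_eq_0[OF bounded_ops_mem[OF R True]]
      by (cases "a \<in> S") auto
    then show ?thesis by auto
  qed (simp add: bounded_ops_outside[OF T] bounded_ops_outside[OF R])
qed

text \<open>Boundedness of \<open>T\<close> makes the set in \<open>opnorm\<close> bounded above, so
  its supremum is meaningful; a vector of norm 0 cannot be normalised and is treated apart.\<close>

lemma norm2_le_opnorm:
  assumes T: "T \<in> bounded_ops S" and f: "f \<in> ell2 S"
  shows "norm2 S (T f) \<le> opnorm S T * norm2 S f"
proof -
  obtain C where C: "C \<ge> 0" "\<And>f. f \<in> ell2 S \<Longrightarrow> norm2 S (T f) \<le> C * norm2 S f"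
    using bounded_ops_bound[OF T] by metis
  show ?thesis
  proof (cases "norm2 S f = 0")
    case True
    then show ?thesis using C(2)[OF f] by simp
  next
    case False
    let ?n = "norm2 S f" and ?c = "complex_of_real (inverse (norm2 S f))"
    have n: "?n > 0" using False norm2_nonneg[of S f] by linarith
    have "norm2 S (T (\<lambda>a. ?c * f a)) \<le> opnorm S T"
      unfolding opnorm_def
    proof (rule cSup_upper)
      have "norm2 S (\<lambda>a. ?c * f a) \<le> 1" using n by (simp add: norm2_cmult norm_inverse)
      then show "norm2 S (T (\<lambda>a. ?c * f a)) \<in> {norm2 S (T f) |f. f \<in> ell2 S \<and> norm2 S f \<le> 1}"
        using ell2_cmult[OF f, of ?c] by blast
      show "bdd_above {norm2 S (T f) |f. f \<in> ell2 S \<and> norm2 S f \<le> 1}"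
        using C by (auto intro!: bdd_aboveI[of _ C] intro: order_trans mult_left_le)
    qed
    then have "inverse ?n * norm2 S (T f) \<le> opnorm S T"
      by (simp only: bounded_ops_scale[OF T f] norm2_cmult norm_of_real) simp
    then show ?thesis using n by (simp add: field_simps)
  qed
qed

text \<open>The matrix \<open>k\<close> on \<open>S\<close> has operator norm at most
  \<open>C\<close>, tested on finitely supported vectors. Each instance involves finitely many
  entries, so the property is stable under entrywise limits. The clause \<open>0 \<le> C\<close> has
  content when \<open>S\<close> is empty.\<close>

definition matrix_bound :: "'a set \<Rightarrow> ('a \<Rightarrow> 'a \<Rightarrow> complex) \<Rightarrow> real \<Rightarrow> bool" where
  "matrix_bound S k C \<longleftrightarrow> 0 \<le> C \<and>
     (\<forall>F H f g. finite F \<and> F \<subseteq> S \<and> finite H \<and> H \<subseteq> S \<longrightarrow>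
       cmod (\<Sum>a\<in>F. \<Sum>b\<in>H. cnj (g a) * k a b * f b)
         \<le> C * L2_set (\<lambda>a. cmod (g a)) F * L2_set (\<lambda>b. cmod (f b)) H)"

text \<open>The conjugate undoes the one in the first slot of \<open>inner2\<close>: the value at
  \<open>a\<close> is the sum of \<open>k a b * f b\<close> over \<open>b\<close>.\<close>

definition matrix_op :: "'a set \<Rightarrow> ('a \<Rightarrow> 'a \<Rightarrow> complex) \<Rightarrow> 'a operator" where
  "matrix_op S k = (\<lambda>f\<in>ell2 S. \<lambda>a. if a \<in> S then inner2 S (\<lambda>b. cnj (k a b)) f else 0)"

lemma matrix_boundD:
  assumes "matrix_bound S k C" "finite F" "F \<subseteq> S" "finite H" "H \<subseteq> S"
  shows "cmod (\<Sum>a\<in>F. \<Sum>b\<in>H. cnj (g a) * k a b * f b)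
    \<le> C * L2_set (\<lambda>a. cmod (g a)) F * L2_set (\<lambda>b. cmod (f b)) H"
  using assms unfolding matrix_bound_def by blast

lemma matrix_bound_nonneg: "matrix_bound S k C \<Longrightarrow> 0 \<le> C"
  by (simp add: matrix_bound_def)

text \<open>Conjugating the double sum and exchanging the summations swaps the roles of
  \<open>F\<close> and \<open>H\<close>.\<close>

lemma matrix_bound_adjoint:
  assumes "matrix_bound S k C" shows "matrix_bound S (\<lambda>a b. cnj (k b a)) C"
  unfolding matrix_bound_def
proof (intro conjI allI impI matrix_bound_nonneg[OF assms])
  fix F H and f g :: "'a \<Rightarrow> complex"
  assume *: "finite F \<and> F \<subseteq> S \<and> finite H \<and> H \<subseteq> S"
  have "(\<Sum>a\<in>F. \<Sum>b\<in>H. cnj (g a) * cnj (k b a) * f b)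
      = cnj (\<Sum>b\<in>H. \<Sum>a\<in>F. cnj (f b) * k b a * g a)"
    by (subst sum.swap) (simp add: mult_ac)
  then have "cmod (\<Sum>a\<in>F. \<Sum>b\<in>H. cnj (g a) * cnj (k b a) * f b)
      = cmod (\<Sum>b\<in>H. \<Sum>a\<in>F. cnj (f b) * k b a * g a)" by (simp only: complex_mod_cnj)
  also have "\<dots> \<le> C * L2_set (\<lambda>b. cmod (f b)) H * L2_set (\<lambda>a. cmod (g a)) F"
    using * by (intro matrix_boundD[OF assms]) auto
  finally show "cmod (\<Sum>a\<in>F. \<Sum>b\<in>H. cnj (g a) * cnj (k b a) * f b)
      \<le> C * L2_set (\<lambda>a. cmod (g a)) F * L2_set (\<lambda>b. cmod (f b)) H"
    by (simp add: mult_ac)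
qed

text \<open>\<open>h\<close> is the adjoint matrix applied to the part of \<open>g\<close> on
  \<open>F\<close>. With \<open>h\<close> itself as test vector on a finite set \<open>H\<close>,
  the squared norm of \<open>h\<close> on \<open>H\<close> is at most \<open>C\<close> times the
  norm of \<open>g\<close> times the norm of \<open>h\<close> on \<open>H\<close>, and one factor
  cancels.\<close>

lemma matrix_bound_columns:
  fixes g :: "'a \<Rightarrow> complex"
  assumes k: "matrix_bound S k C" and F: "finite F" "F \<subseteq> S"
  defines "h \<equiv> chi S (\<lambda>b. \<Sum>a\<in>F. g a * cnj (k a b))"
  shows "h \<in> ell2 S" and "norm2 S h \<le> C * L2_set (\<lambda>a. cmod (g a)) F"
proof -
  let ?G = "L2_set (\<lambda>a. cmod (g a)) F"
  have "L2_set (\<lambda>b. cmod (h b)) H \<le> C * ?G" if H: "finite H" "H \<subseteq> S" for H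
  proof -
    let ?n = "L2_set (\<lambda>b. cmod (h b)) H"
    have "complex_of_real (?n\<^sup>2) = (\<Sum>b\<in>H. cnj (h b) * h b)"
      by (simp add: L2_set_def sum_nonneg complex_norm_square mult.commute del: of_real_power)
    also have "\<dots> = (\<Sum>a\<in>F. \<Sum>b\<in>H. cnj (g a) * k a b * h b)"
      using H by (subst sum.swap) (auto simp: h_def chi_apply sum_distrib_right intro!: sum.cong)
    finally have "?n\<^sup>2 = cmod (\<Sum>a\<in>F. \<Sum>b\<in>H. cnj (g a) * k a b * h b)"
      by (metis norm_of_real abs_power2 power2_abs abs_of_nonneg zero_le_power2)
    also have "\<dots> \<le> C * ?G * ?n" by (rule matrix_boundD[OF k F H])
    finally have "?n * ?n \<le> (C * ?G) * ?n" by (simp add: power2_eq_square)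
    then show ?thesis
      using matrix_bound_nonneg[OF k] L2_set_nonneg[of "\<lambda>b. cmod (h b)" H]
      by (cases "?n = 0") (auto intro: mult_right_le_imp_le)
  qed
  then show "h \<in> ell2 S" "norm2 S h \<le> C * ?G"
    using ell2I_bounded[of S h] by (auto simp: h_def chi_apply)
qed

lemma matrix_bound_row:
  assumes "matrix_bound S k C" "a \<in> S"
  shows "chi S (\<lambda>b. cnj (k a b)) \<in> ell2 S"
  using matrix_bound_columns(1)[OF assms(1), of "{a}" "\<lambda>a. 1"] assms(2) by simp

lemma matrix_op_apply:
  assumes "f \<in> ell2 S" "a \<in> S"
  shows "matrix_op S k f a = inner2 S (chi S (\<lambda>b. cnj (k a b))) f"
  using assms by (auto simp: matrix_op_def chi_apply intro: inner2_cong)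

text \<open>Duality: on a finite set \<open>F\<close> the squared norm of the image is the inner
  product of \<open>f\<close> with the adjoint matrix applied to that part of the image.
  Cauchy-Schwarz and \<open>matrix_bound_columns\<close> leave one factor to cancel.\<close>

lemma matrix_op_bound:
  assumes k: "matrix_bound S k C" and f: "f \<in> ell2 S"
  shows "matrix_op S k f \<in> ell2 S" and norm2_matrix_op: "norm2 S (matrix_op S k f) \<le> C * norm2 S f"
proof -
  let ?T = "matrix_op S k f"
  have "L2_set (\<lambda>a. cmod (?T a)) F \<le> C * norm2 S f" if F: "finite F" "F \<subseteq> S" for F
  proof -
    let ?n = "L2_set (\<lambda>a. cmod (?T a)) F"
    define h where "h = chi S (\<lambda>b. \<Sum>a\<in>F. ?T a * cnj (k a b))"
    have row: "chi S (\<lambda>b. cnj (k a b)) \<in> ell2 S" if "a \<in> F" for a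
      using that F matrix_bound_row[OF k] by auto
    have "complex_of_real (?n\<^sup>2) = (\<Sum>a\<in>F. ?T a * cnj (?T a))"
      by (simp add: L2_set_def sum_nonneg complex_norm_square del: of_real_power)
    also have "\<dots> = (\<Sum>a\<in>F. ?T a * inner2 S f (chi S (\<lambda>b. cnj (k a b))))"
      using F by (intro sum.cong refl arg_cong2[where f="(*)"])
        (metis matrix_op_apply[OF f] inner2_commute subsetD)
    also have "\<dots> = inner2 S f (\<lambda>b. \<Sum>a\<in>F. ?T a * chi S (\<lambda>b. cnj (k a b)) b)"
      by (rule inner2_sum_right[symmetric, OF f row])
    also have "\<dots> = inner2 S f h"
      by (rule inner2_cong) (auto simp: h_def chi_apply)
    finally have "?n\<^sup>2 = cmod (inner2 S f h)"
      by (metis norm_of_real abs_power2 power2_abs abs_of_nonneg zero_le_power2)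
    also have "\<dots> \<le> norm2 S f * norm2 S h"
      unfolding h_def by (intro inner2_Cauchy_Schwarz f matrix_bound_columns(1)[OF k F])
    also have "\<dots> \<le> norm2 S f * (C * ?n)"
      unfolding h_def by (intro mult_left_mono matrix_bound_columns(2)[OF k F] norm2_nonneg)
    finally have "?n * ?n \<le> (C * norm2 S f) * ?n" by (simp add: power2_eq_square mult_ac)
    then show ?thesis
      using matrix_bound_nonneg[OF k] L2_set_nonneg[of "\<lambda>a. cmod (?T a)" F]
      by (cases "?n = 0") (auto intro: mult_right_le_imp_le)
  qed
  then show "?T \<in> ell2 S" "norm2 S ?T \<le> C * norm2 S f"
    using ell2I_bounded[of S ?T] by (auto simp: matrix_op_def f)
qed

lemma matrix_op_in_bounded_ops:
  assumes k: "matrix_bound S k C" shows "matrix_op S k \<in> bounded_ops S"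
  unfolding bounded_ops_def
proof (intro CollectI conjI)
  show "matrix_op S k \<in> ell2 S \<rightarrow>\<^sub>E ell2 S"
    using matrix_op_bound(1)[OF k] by (auto simp: matrix_op_def)
  have out: "matrix_op S k f a = 0" if "f \<in> ell2 S" "a \<notin> S" for f a
    using that by (simp add: matrix_op_def)
  show "\<forall>f\<in>ell2 S. \<forall>g\<in>ell2 S. matrix_op S k (\<lambda>a. f a + g a) = (\<lambda>a. matrix_op S k f a + matrix_op S k g a)"
  proof (intro ballI ext)
    fix f g a assume fg: "f \<in> ell2 S" "g \<in> ell2 S"
    then show "matrix_op S k (\<lambda>a. f a + g a) a = matrix_op S k f a + matrix_op S k g a"
      by (cases "a \<in> S")
        (auto simp: out matrix_op_apply ell2_add inner2_add_right[OF matrix_bound_row[OF k]])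
  qed
  show "\<forall>c. \<forall>f\<in>ell2 S. matrix_op S k (\<lambda>a. c * f a) = (\<lambda>a. c * matrix_op S k f a)"
  proof (intro ballI allI ext)
    fix c f a assume f: "f \<in> ell2 S"
    then show "matrix_op S k (\<lambda>a. c * f a) a = c * matrix_op S k f a"
      by (cases "a \<in> S") (auto simp: out matrix_op_apply ell2_cmult inner2_cmult_right)
  qed
  show "\<exists>C. \<forall>f\<in>ell2 S. norm2 S (matrix_op S k f) \<le> C * norm2 S f"
    using norm2_matrix_op[OF k] by blast
qed

lemma matrix_op_delta:
  "a \<in> S \<Longrightarrow> b \<in> S \<Longrightarrow> matrix_op S k (delta b) a = k a b"
  by (simp add: matrix_op_apply chi_apply)

lemma matrix_op_cong:
  assumes "\<And>a b. a \<in> S \<Longrightarrow> b \<in> S \<Longrightarrow> k a b = k' a b"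
  shows "matrix_op S k = matrix_op S k'"
proof -
  have "inner2 S (\<lambda>b. cnj (k a b)) f = inner2 S (\<lambda>b. cnj (k' a b)) f" if "a \<in> S" for a f
    using that assms by (intro inner2_cong) auto
  then show ?thesis unfolding matrix_op_def by (intro restrict_ext ext) auto
qed

text \<open>The double sum is the inner product of \<open>chi F g\<close> with
  \<open>T (chi H f)\<close>, to which Cauchy-Schwarz applies.\<close>

lemma bounded_op_matrix_bound:
  assumes T: "T \<in> bounded_ops S" and C: "C \<ge> 0" "\<And>f. f \<in> ell2 S \<Longrightarrow> norm2 S (T f) \<le> C * norm2 S f"
  shows "matrix_bound S (\<lambda>a b. T (delta b) a) C"
  unfolding matrix_bound_def
proof (intro conjI allI impI C(1))
  fix F H and f g :: "'a \<Rightarrow> complex"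
  assume "finite F \<and> F \<subseteq> S \<and> finite H \<and> H \<subseteq> S"
  then have F: "finite F" "F \<subseteq> S" and H: "finite H" "H \<subseteq> S" by auto
  have f: "chi H f \<in> ell2 S" by (rule ell2_finite_support[OF H]) (simp add: chi_apply)
  have g: "chi F g \<in> ell2 S" by (rule ell2_finite_support[OF F]) (simp add: chi_apply)
  have "T (chi H f) = (\<lambda>a. \<Sum>b\<in>H. f b * T (delta b) a)"
    unfolding chi_finite_eq_sum[OF H(1)] using H by (intro bounded_ops_sum[OF T] delta_in_ell2) auto
  then have "(\<Sum>a\<in>F. \<Sum>b\<in>H. cnj (g a) * T (delta b) a * f b) = (\<Sum>a\<in>F. cnj (g a) * T (chi H f) a)"
    by (simp add: sum_distrib_left mult_ac)
  also have "\<dots> = (\<Sum>\<^sub>\<infinity>a\<in>F. cnj (g a) * T (chi H f) a)" using F by simp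
  also have "\<dots> = inner2 S (chi F g) (T (chi H f))"
    unfolding inner2_def using F by (intro infsum_cong_neutral) (auto simp: chi_apply)
  finally have "cmod (\<Sum>a\<in>F. \<Sum>b\<in>H. cnj (g a) * T (delta b) a * f b)
      \<le> norm2 S (chi F g) * norm2 S (T (chi H f))"
    using inner2_Cauchy_Schwarz(2)[OF g bounded_ops_mem[OF T f]] by simp
  also have "\<dots> \<le> norm2 S (chi F g) * (C * norm2 S (chi H f))"
    by (intro mult_left_mono C f) auto
  also have "norm2 S (chi F g) = L2_set (\<lambda>a. cmod (g a)) F"
    by (subst norm2_finite_support[OF F]) (auto simp: chi_apply cong: L2_set_cong)
  also have "norm2 S (chi H f) = L2_set (\<lambda>a. cmod (f a)) H"
    by (subst norm2_finite_support[OF H]) (auto simp: chi_apply cong: L2_set_cong)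
  finally show "cmod (\<Sum>a\<in>F. \<Sum>b\<in>H. cnj (g a) * T (delta b) a * f b)
      \<le> C * L2_set (\<lambda>a. cmod (g a)) F * L2_set (\<lambda>b. cmod (f b)) H"
    by (simp add: mult_ac)
qed

lemma bounded_op_eq_matrix_op:
  assumes T: "T \<in> bounded_ops S" shows "T = matrix_op S (\<lambda>a b. T (delta b) a)"
proof -
  obtain C where "C \<ge> 0" "\<And>f. f \<in> ell2 S \<Longrightarrow> norm2 S (T f) \<le> C * norm2 S f"
    using bounded_ops_bound[OF T] by metis
  from matrix_op_in_bounded_ops[OF bounded_op_matrix_bound[OF T this]]
  show ?thesis by (intro bounded_ops_eqI[OF T]) (auto simp: matrix_op_delta)
qed

text \<open>For fixed \<open>f\<close> both sides are bounded and linear in \<open>g\<close>, so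
  basis vectors suffice. There the right side pairs \<open>f\<close> with a column of the adjoint,
  which is a conjugated row of \<open>k\<close>.\<close>

lemma inner2_matrix_op:
  assumes k: "matrix_bound S k C" and f: "f \<in> ell2 S" and g: "g \<in> ell2 S"
  shows "inner2 S (matrix_op S k f) g = inner2 S f (matrix_op S (\<lambda>a b. cnj (k b a)) g)"
proof -
  let ?T = "matrix_op S k" and ?R = "matrix_op S (\<lambda>a b. cnj (k b a))"
  note k' = matrix_bound_adjoint[OF k]
  note R = matrix_op_in_bounded_ops[OF k']
  note Tf = matrix_op_bound(1)[OF k f]
  have "inner2 S (?T f) g - inner2 S f (?R g) = 0"
  proof (rule ell2_functional_eq_0[where S=S and \<phi>="\<lambda>g. inner2 S (?T f) g - inner2 S f (?R g)"
        and C="2 * C * norm2 S f"])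
    fix g h assume gh: "g \<in> ell2 S" "h \<in> ell2 S"
    then show "inner2 S (?T f) (\<lambda>a. g a + h a) - inner2 S f (?R (\<lambda>a. g a + h a)) =
        inner2 S (?T f) g - inner2 S f (?R g) + (inner2 S (?T f) h - inner2 S f (?R h))"
      by (simp add: bounded_ops_add[OF R gh] inner2_add_right Tf f bounded_ops_mem[OF R])
  next
    fix c g assume g: "g \<in> ell2 S"
    show "inner2 S (?T f) (\<lambda>a. c * g a) - inner2 S f (?R (\<lambda>a. c * g a)) =
        c * (inner2 S (?T f) g - inner2 S f (?R g))"
      by (simp add: bounded_ops_scale[OF R g] inner2_cmult_right algebra_simps)
  next
    fix g assume g: "g \<in> ell2 S"
    have "cmod (inner2 S (?T f) g - inner2 S f (?R g)) \<le> cmod (inner2 S (?T f) g) + cmod (inner2 S f (?R g))"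
      by (rule norm_triangle_ineq4)
    also have "\<dots> \<le> norm2 S (?T f) * norm2 S g + norm2 S f * norm2 S (?R g)"
      by (intro add_mono inner2_Cauchy_Schwarz Tf f g bounded_ops_mem[OF R])
    also have "\<dots> \<le> (C * norm2 S f) * norm2 S g + norm2 S f * (C * norm2 S g)"
      by (intro add_mono mult_mono norm2_matrix_op[OF k f] norm2_matrix_op[OF k' g])
        (auto simp: matrix_bound_nonneg[OF k])
    finally show "cmod (inner2 S (?T f) g - inner2 S f (?R g)) \<le> 2 * C * norm2 S f * norm2 S g"
      by (simp add: algebra_simps)
  next
    fix a assume a: "a \<in> S"
    have "inner2 S f (?R (delta a)) = inner2 S f (chi S (\<lambda>b. cnj (k a b)))"
      using a by (intro inner2_cong) (auto simp: matrix_op_delta chi_apply)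
    then show "inner2 S (?T f) (delta a) - inner2 S f (?R (delta a)) = 0"
      using a by (simp add: matrix_op_apply[OF f a]) (subst inner2_commute, simp)
  qed (rule g)
  then show ?thesis by simp
qed

lemma adj_matrix_op:
  assumes k: "matrix_bound S k C"
  shows "adj S (matrix_op S k) = matrix_op S (\<lambda>a b. cnj (k b a))"
  unfolding adj_def
proof (rule the_equality)
  show "matrix_op S (\<lambda>a b. cnj (k b a)) \<in> bounded_ops S \<and>
    (\<forall>f\<in>ell2 S. \<forall>g\<in>ell2 S. inner2 S (matrix_op S k f) g = inner2 S f (matrix_op S (\<lambda>a b. cnj (k b a)) g))"
    using inner2_matrix_op[OF k] matrix_op_in_bounded_ops[OF matrix_bound_adjoint[OF k]] by blast
next
  fix R assume R: "R \<in> bounded_ops S \<and>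
    (\<forall>f\<in>ell2 S. \<forall>g\<in>ell2 S. inner2 S (matrix_op S k f) g = inner2 S f (R g))"
  show "R = matrix_op S (\<lambda>a b. cnj (k b a))"
  proof (rule bounded_ops_eqI)
    fix a b assume ab: "a \<in> S" "b \<in> S"
    have "inner2 S (matrix_op S k (delta a)) (delta b) = inner2 S (delta a) (R (delta b))"
      using R ab by (meson delta_in_ell2)
    then show "R (delta b) a = matrix_op S (\<lambda>a b. cnj (k b a)) (delta b) a"
      using ab by (simp add: matrix_op_delta)
  qed (use R matrix_op_in_bounded_ops[OF matrix_bound_adjoint[OF k]] in auto)
qed

text \<open>The adjoint exists because the conjugate transpose of the matrix of \<open>T\<close>
  satisfies the same bound; this gives the description \<open>adj\<close> its meaning.\<close>

lemma adj_bounded_op: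
  assumes "T \<in> bounded_ops S"
  shows "adj S T \<in> bounded_ops S"
    and inner2_adj: "f \<in> ell2 S \<Longrightarrow> g \<in> ell2 S \<Longrightarrow> inner2 S (T f) g = inner2 S f (adj S T g)"
proof -
  let ?k = "\<lambda>a b. T (delta b) a"
  obtain C where "C \<ge> 0" "\<And>f. f \<in> ell2 S \<Longrightarrow> norm2 S (T f) \<le> C * norm2 S f"
    using bounded_ops_bound[OF assms] by metis
  note k = bounded_op_matrix_bound[OF assms this]
  have T: "T = matrix_op S ?k" by (rule bounded_op_eq_matrix_op[OF assms])
  have adj: "adj S T = matrix_op S (\<lambda>a b. cnj (T (delta a) b))"
    using adj_matrix_op[OF k] T by simp
  show "adj S T \<in> bounded_ops S"
    unfolding adj by (rule matrix_op_in_bounded_ops[OF matrix_bound_adjoint[OF k]])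
  show "inner2 S (T f) g = inner2 S f (adj S T g)" if "f \<in> ell2 S" "g \<in> ell2 S"
    using inner2_matrix_op[OF k that] T adj by simp
qed

section \<open>Convergent series and the Hellinger-Toeplitz theorem\<close>

lemma ell2_series:
  assumes f: "\<And>n. f n \<in> ell2 S" and sum: "summable (\<lambda>n. norm2 S (f n))"
  shows "summable (\<lambda>n. f n a)"
    and "(\<lambda>a. \<Sum>n. f n a) \<in> ell2 S"
    and norm2_series_le: "norm2 S (\<lambda>a. \<Sum>n. f n a) \<le> (\<Sum>n. norm2 S (f n))"
proof -
  show s: "summable (\<lambda>n. f n a)" for a
    by (rule summable_comparison_test'[OF sum]) (rule cmod_le_norm2[OF f])
  \<comment> \<open>On a finite set the norm is continuous in the coordinates, so the bound for the
    partial sums passes to the limit.\<close>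
  have *: "L2_set (\<lambda>a. cmod (\<Sum>n. f n a)) F \<le> (\<Sum>n. norm2 S (f n))" if F: "finite F" "F \<subseteq> S" for F
  proof (rule LIMSEQ_le_const2)
    show "(\<lambda>N. L2_set (\<lambda>a. cmod (\<Sum>n<N. f n a)) F) \<longlonglongrightarrow> L2_set (\<lambda>a. cmod (\<Sum>n. f n a)) F"
      unfolding L2_set_def by (intro tendsto_intros summable_LIMSEQ s)
    have "L2_set (\<lambda>a. cmod (\<Sum>n<N. f n a)) F \<le> (\<Sum>n. norm2 S (f n))" for N
    proof -
      have "L2_set (\<lambda>a. cmod (\<Sum>n<N. f n a)) F \<le> norm2 S (\<lambda>a. \<Sum>n<N. f n a)"
        by (intro L2_set_le_norm2 ell2_sum f F)
      also have "\<dots> \<le> (\<Sum>n<N. norm2 S (f n))" by (intro norm2_sum_le f)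
      also have "\<dots> \<le> (\<Sum>n. norm2 S (f n))" by (intro sum_le_suminf sum) auto
      finally show ?thesis .
    qed
    then show "\<exists>N. \<forall>n\<ge>N. L2_set (\<lambda>a. cmod (\<Sum>n<n. f n a)) F \<le> (\<Sum>n. norm2 S (f n))" by blast
  qed
  show "(\<lambda>a. \<Sum>n. f n a) \<in> ell2 S" "norm2 S (\<lambda>a. \<Sum>n. f n a) \<le> (\<Sum>n. norm2 S (f n))"
    using ell2I_bounded[of S "\<lambda>a. \<Sum>n. f n a", OF _ *] by (auto simp: ell2_eq_0[OF f])
qed


text \<open>The uniform boundedness principle for the functionals \<open>inner2 S (T (g n))\<close>, by the gliding hump:
  a vector \<open>f\<close> on which they are unbounded is a sum of steps of length \<open>(1/3) ^ n\<close>, the sign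
  of the \<open>n\<close>-th step being chosen such that the \<open>n\<close>-th functional is large after it.\<close>

lemma Hellinger_Toeplitz_bound:
  assumes T: "\<And>f. f \<in> ell2 S \<Longrightarrow> T f \<in> ell2 S" and R: "\<And>f. f \<in> ell2 S \<Longrightarrow> R f \<in> ell2 S"
    and scale: "\<And>c f. f \<in> ell2 S \<Longrightarrow> T (\<lambda>a. c * f a) = (\<lambda>a. c * T f a)"
    and adj: "\<And>f g. f \<in> ell2 S \<Longrightarrow> g \<in> ell2 S \<Longrightarrow> inner2 S (T f) g = inner2 S f (R g)"
  shows "\<exists>C. \<forall>f\<in>ell2 S. norm2 S (T f) \<le> C * norm2 S f"
proof (rule ccontr)
  assume "\<nexists>C. \<forall>f\<in>ell2 S. norm2 S (T f) \<le> C * norm2 S f"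
  then have unbounded: "\<exists>f\<in>ell2 S. norm2 S (T f) > C * norm2 S f" for C
    by (meson not_le)
  \<comment> \<open>The growth \<open>4 ^ n\<close> has to beat the step length
    \<open>(1/3) ^ n\<close>; what remains is \<open>(4/3) ^ n\<close>.\<close>
  have "\<exists>g\<in>ell2 S. norm2 S g = 1 \<and> norm2 S (T g) \<ge> 4 ^ n" for n
  proof -
    obtain f where f: "f \<in> ell2 S" "norm2 S (T f) > 4 ^ n * norm2 S f"
      using unbounded by blast
    have "norm2 S f \<noteq> 0"
    proof
      assume 0: "norm2 S f = 0"
      then have "f a = 0" for a using cmod_le_norm2[OF f(1), of a] by simp
      then have "f = (\<lambda>a. 0 * f a)" by auto
      then have "T f = (\<lambda>a. 0)" using scale[OF f(1), of 0] by simp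
      with f(2) 0 show False by simp
    qed
    then have pos: "norm2 S f > 0" using norm2_nonneg[of S f] by linarith
    let ?c = "complex_of_real (inverse (norm2 S f))"
    have n: "norm2 S (\<lambda>a. ?c * f a) = 1" using pos by (simp add: norm2_cmult norm_inverse)
    have "norm2 S (T (\<lambda>a. ?c * f a)) = inverse (norm2 S f) * norm2 S (T f)"
      using pos by (simp only: scale[OF f(1)] norm2_cmult norm_of_real) simp
    moreover have "4 ^ n < norm2 S (T f) / norm2 S f" using f(2) pos by (simp add: pos_less_divide_eq)
    ultimately have "norm2 S (T (\<lambda>a. ?c * f a)) \<ge> 4 ^ n" by (simp add: divide_inverse mult.commute)
    with n ell2_cmult[OF f(1), of ?c] show ?thesis by blast
  qed
  then obtain g where g: "\<And>n. g n \<in> ell2 S" "\<And>n. norm2 S (g n) = 1" "\<And>n. norm2 S (T (g n)) \<ge> 4 ^ n"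
    by metis
  define h where "h n = T (g n)" for n :: nat
  define N where "N n = norm2 S (h n)" for n
  define d where "d n = (\<lambda>a. complex_of_real ((1/3) ^ n / N n) * h n a)" for n
  have h: "h n \<in> ell2 S" for n unfolding h_def by (rule T[OF g(1)])
  have N4: "4 ^ n \<le> N n" for n unfolding N_def h_def by (rule g(3))
  have Npos: "N n > 0" for n by (rule less_le_trans[OF _ N4]) simp
  have d: "d n \<in> ell2 S" for n unfolding d_def by (rule ell2_cmult[OF h])
  have norm_d: "norm2 S (d n) = (1/3) ^ n" for n
  proof -
    have "norm2 S (d n) = cmod (complex_of_real ((1/3) ^ n / N n)) * N n"
      by (simp only: d_def norm2_cmult N_def)
    then show ?thesis using Npos[of n] by (simp only: norm_of_real) simp
  qed
  have hd: "inner2 S (h n) (d n) = complex_of_real ((1/3) ^ n * N n)" for n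
  proof -
    have "inner2 S (h n) (d n) = complex_of_real ((1/3) ^ n / N n) * complex_of_real ((N n)\<^sup>2)"
      by (simp only: d_def inner2_cmult_right inner2_self[OF h] N_def)
    also have "\<dots> = complex_of_real ((1/3) ^ n / N n * (N n)\<^sup>2)" by (rule of_real_mult[symmetric])
    also have "(1/3) ^ n / N n * (N n)\<^sup>2 = (1/3) ^ n * N n"
      using Npos[of n] by (simp add: power2_eq_square)
    finally show ?thesis .
  qed
  define step where "step n x =
      (if cmod (inner2 S (h n) (\<lambda>a. x a + d n a)) \<ge> (1/3) ^ n * N n then d n else (\<lambda>a. - d n a))" for n x
  define x where "x = rec_nat (\<lambda>a. 0) (\<lambda>n x a. x a + step n x a)"
  have x0: "x 0 = (\<lambda>a. 0)" and xSuc: "x (Suc n) = (\<lambda>a. x n a + step n (x n) a)" for n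
    by (simp_all add: x_def)
  define e where "e n = step n (x n)" for n
  have e: "e n \<in> ell2 S" for n
    by (auto simp: e_def step_def d ell2_uminus)
  have norm_e: "norm2 S (e n) = (1/3) ^ n" for n
    by (simp add: e_def step_def norm_d norm2_uminus)
  have x_sum: "x n a = (\<Sum>m<n. e m a)" for n a
    by (induction n) (simp_all add: x0 xSuc e_def)
  have x: "x n \<in> ell2 S" for n
  proof -
    have "x n = (\<lambda>a. \<Sum>m<n. e m a)" using x_sum by blast
    then show ?thesis by (simp add: ell2_sum e)
  qed
  have large: "cmod (inner2 S (h n) (x (Suc n))) \<ge> (1/3) ^ n * N n" for n
  proof (cases "cmod (inner2 S (h n) (\<lambda>a. x n a + d n a)) \<ge> (1/3) ^ n * N n")
    case True
    then show ?thesis by (simp add: xSuc step_def)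
  next
    case False
    let ?p = "inner2 S (h n) (\<lambda>a. x n a + d n a)" and ?q = "inner2 S (h n) (\<lambda>a. x n a - d n a)"
    \<comment> \<open>The two candidate values differ by twice the required size, so if the plus
      sign fails, the minus sign succeeds.\<close>
    have "?p - ?q = 2 * complex_of_real ((1/3) ^ n * N n)"
      by (simp add: inner2_add_right inner2_diff_right h x d hd)
    then have "2 * ((1/3) ^ n * N n) = cmod (?p - ?q)"
      using Npos[of n] by (simp add: norm_mult norm_divide norm_power)
    also have "\<dots> \<le> cmod ?p + cmod ?q" by (rule norm_triangle_ineq4)
    finally have "(1/3) ^ n * N n \<le> cmod ?q" using False by linarith
    then show ?thesis using False by (simp add: xSuc step_def)
  qed
  have summ: "summable (\<lambda>n. norm2 S (e n))"
    unfolding norm_e by (rule summable_geometric) simp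
  define f where "f = (\<lambda>a. \<Sum>n. e n a)"
  have f: "f \<in> ell2 S" unfolding f_def by (rule ell2_series(2)[OF e summ])
  \<comment> \<open>All later steps together have half the length of the \<open>n\<close>-th one, so
    they undo at most half of what the \<open>n\<close>-th functional gained.\<close>
  have tail: "norm2 S (\<lambda>a. f a - x (Suc n) a) \<le> (1/3) ^ n / 2" for n
  proof -
    have s': "summable (\<lambda>m. norm2 S (e (m + Suc n)))"
      using summ by (subst summable_iff_shift)
    have "f a - x (Suc n) a = (\<Sum>m. e (m + Suc n) a)" for a
      unfolding f_def x_sum using suminf_split_initial_segment[OF ell2_series(1)[OF e summ], of a "Suc n"]
      by simp
    then have "norm2 S (\<lambda>a. f a - x (Suc n) a) \<le> (\<Sum>m. norm2 S (e (m + Suc n)))"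
      using norm2_series_le[of "\<lambda>m. e (m + Suc n)", OF e s'] by simp
    also have "\<dots> = (\<Sum>m. (1/3) ^ Suc n * (1/3) ^ m :: real)"
      unfolding norm_e by (simp add: power_add mult_ac)
    also have "\<dots> = (1/3) ^ Suc n * (\<Sum>m. (1/3) ^ m)"
      by (rule suminf_mult) (simp add: summable_geometric)
    also have "\<dots> = (1/3) ^ n / 2" by (simp add: suminf_geometric)
    finally show ?thesis .
  qed
  \<comment> \<open>The adjoint relation bounds the \<open>n\<close>-th functional at
    \<open>f\<close> by \<open>norm2 S (R f)\<close>, independently of \<open>n\<close>, while by
    construction its value has modulus at least \<open>(4/3) ^ n / 2\<close>.\<close>
  have bound: "(4/3) ^ n / 2 \<le> norm2 S (R f)" for n
  proof -
    let ?x = "x (Suc n)"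
    have "(4/3) ^ n = (1/3) ^ n * (4::real) ^ n" by (simp add: power_divide)
    also have "\<dots> \<le> (1/3) ^ n * N n" by (intro mult_left_mono N4) auto
    finally have "(4/3) ^ n / 2 \<le> (1/3) ^ n * N n - N n * ((1/3) ^ n / 2)"
      by (simp add: mult.commute)
    also have "\<dots> \<le> cmod (inner2 S (h n) ?x) - cmod (inner2 S (h n) (\<lambda>a. f a - ?x a))"
    proof (intro diff_mono large)
      have "cmod (inner2 S (h n) (\<lambda>a. f a - ?x a)) \<le> N n * norm2 S (\<lambda>a. f a - ?x a)"
        unfolding N_def by (intro inner2_Cauchy_Schwarz h ell2_diff f x)
      also have "\<dots> \<le> N n * ((1/3) ^ n / 2)"
        using Npos[of n] by (intro mult_left_mono tail) auto
      finally show "cmod (inner2 S (h n) (\<lambda>a. f a - ?x a)) \<le> N n * ((1/3) ^ n / 2)" .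
    qed
    also have "\<dots> \<le> cmod (inner2 S (h n) ?x + inner2 S (h n) (\<lambda>a. f a - ?x a))"
      by (metis add.commute diff_le_eq norm_diff_ineq add_diff_cancel_left')
    also have "\<dots> = cmod (inner2 S (h n) f)"
      by (simp add: inner2_diff_right h f x)
    also have "\<dots> = cmod (inner2 S (g n) (R f))" unfolding h_def by (simp add: adj g f)
    also have "\<dots> \<le> norm2 S (g n) * norm2 S (R f)" by (intro inner2_Cauchy_Schwarz g R f)
    finally show ?thesis by (simp add: g)
  qed
  obtain n where "2 * norm2 S (R f) < (4/3) ^ n"
    using real_arch_pow[of "4/3"] by auto
  with bound[of n] show False by simp
qed

text \<open>Linearity comes from the adjoint as well: the value of \<open>T f\<close> at
  \<open>a\<close> is the inner product of the fixed vector \<open>R (delta a)\<close> with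
  \<open>f\<close>.\<close>

theorem Hellinger_Toeplitz:
  assumes T: "\<And>f. f \<in> ell2 S \<Longrightarrow> T f \<in> ell2 S" and R: "\<And>f. f \<in> ell2 S \<Longrightarrow> R f \<in> ell2 S"
    and adj: "\<And>f g. f \<in> ell2 S \<Longrightarrow> g \<in> ell2 S \<Longrightarrow> inner2 S (T f) g = inner2 S f (R g)"
  shows "restrict T (ell2 S) \<in> bounded_ops S"
proof -
  have entry: "T f a = (if a \<in> S then inner2 S (R (delta a)) f else 0)" if f: "f \<in> ell2 S" for f a
  proof (cases "a \<in> S")
    case True
    then have "T f a = cnj (inner2 S (T f) (delta a))" by simp
    also have "\<dots> = cnj (inner2 S f (R (delta a)))"
      using True f by (simp only: adj delta_in_ell2)
    also have "\<dots> = inner2 S (R (delta a)) f" by (rule inner2_commute[symmetric])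
    finally show ?thesis using True by simp
  qed (simp add: ell2_eq_0[OF T[OF f]])
  have scale: "T (\<lambda>a. c * f a) = (\<lambda>a. c * T f a)" if f: "f \<in> ell2 S" for c f
    by (auto simp: entry f ell2_cmult inner2_cmult_right)
  have add: "T (\<lambda>a. f a + g a) = (\<lambda>a. T f a + T g a)" if "f \<in> ell2 S" "g \<in> ell2 S" for f g
    using that by (auto simp: entry ell2_add inner2_add_right R)
  show ?thesis
    using Hellinger_Toeplitz_bound[OF T R scale adj]
    by (auto simp: bounded_ops_def T scale add ell2_cmult ell2_add)
qed

text \<open>On an open \<open>W\<close> around \<open>p\<close> the values of \<open>f\<close> on
  \<open>D\<close> stay within \<open>e / 2\<close> of \<open>c p\<close>. Since \<open>W\<close> is
  also a neighbourhood of each of its points \<open>q\<close>, the limit \<open>c q\<close> inherits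
  the closed bound.\<close>

lemma tendsto_extension_from_dense:
  fixes f c :: "'a::topological_space \<Rightarrow> 'b::metric_space"
  assumes lim: "\<And>p. p \<in> P \<Longrightarrow> (f \<longlongrightarrow> c p) (inf (nhds p) (principal D))"
    and dense: "\<And>p. p \<in> P \<Longrightarrow> inf (nhds p) (principal D) \<noteq> bot"
    and p: "p \<in> P"
  shows "(c \<longlongrightarrow> c p) (inf (nhds p) (principal P))"
proof (rule tendstoI)
  fix e :: real assume "e > 0"
  then have "\<forall>\<^sub>F q in inf (nhds p) (principal D). dist (f q) (c p) < e / 2"
    by (intro tendstoD[OF lim[OF p]]) simp
  then obtain W where W: "open W" "p \<in> W" "\<And>q. q \<in> W \<Longrightarrow> q \<in> D \<Longrightarrow> dist (f q) (c p) < e / 2"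
    unfolding eventually_inf_principal eventually_nhds by blast
  have "dist (c q) (c p) < e" if q: "q \<in> W" "q \<in> P" for q
  proof -
    have "dist (c q) (c p) \<le> e / 2"
    proof (rule tendsto_upperbound[OF _ _ dense[OF q(2)]])
      show "((\<lambda>r. dist (f r) (c p)) \<longlongrightarrow> dist (c q) (c p)) (inf (nhds q) (principal D))"
        by (intro tendsto_dist lim q tendsto_const)
      show "\<forall>\<^sub>F r in inf (nhds q) (principal D). dist (f r) (c p) \<le> e / 2"
        unfolding eventually_inf_principal using eventually_nhds_in_open[OF W(1) q(1)]
        by eventually_elim (use W(3) in \<open>auto intro: less_imp_le\<close>)
    qed
    then show ?thesis using \<open>e > 0\<close> by simp
  qed
  then show "\<forall>\<^sub>F q in inf (nhds p) (principal P). dist (c q) (c p) < e"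
    unfolding eventually_inf_principal using eventually_nhds_in_open[OF W(1,2)]
    by (auto elim: eventually_mono)
qed

lemma continuous_on_UNIV_iff_nhds: "continuous_on UNIV f \<longleftrightarrow> (\<forall>a. (f \<longlongrightarrow> f a) (nhds a))"
  by (simp add: continuous_on_def tendsto_at_iff_tendsto_nhds)

section \<open>Local sections and compactly supported functions\<close>

context lc_etale_groupoid
begin

lemma ginv_ginv [simp]: "ginv G (ginv G a) = a"
proof -
  let ?b = "ginv G (ginv G a)"
  have s: "gsrc G ?b = grng G (ginv G a)" "gsrc G (ginv G a) = grng G a" by (auto simp: src_inv rng_inv)
  have "?b = gmul G ?b (gsrc G ?b)" by (simp add: mul_src)
  also have "gsrc G ?b = gmul G (ginv G a) a" by (simp add: inv_mul src_inv rng_inv)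
  also have "gmul G ?b \<dots> = gmul G (gmul G ?b (ginv G a)) a" by (rule mul_assoc[OF s, symmetric])
  also have "\<dots> = a" by (simp add: inv_mul src_inv rng_mul_left)
  finally show ?thesis .
qed

lemma src_in_units [simp]: "gsrc G a \<in> units G"
  by (simp add: units_def)

lemma fiber_iff: "a \<in> fiber G x \<longleftrightarrow> gsrc G a = x"
  by (simp add: fiber_def)

text \<open>The source of \<open>a\<close> is the product of \<open>ginv G a\<close> and
  \<open>a\<close>.\<close>

lemma continuous_src: "continuous_on UNIV (gsrc G)"
proof -
  have "continuous_on UNIV (\<lambda>a. (\<lambda>(a, b). gmul G a b) (ginv G a, a))"
    by (rule continuous_on_compose2[OF continuous_mul])
      (auto intro!: continuous_intros continuous_inv simp: composable_def src_inv)
  then show ?thesis by (simp add: inv_mul)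
qed

lemma continuous_rng: "continuous_on UNIV (grng G)"
proof -
  have "continuous_on UNIV (\<lambda>a. gsrc G (ginv G a))"
    by (rule continuous_on_compose2[OF continuous_src continuous_inv]) auto
  then show ?thesis by (simp add: src_inv)
qed

lemma src_tendsto: "(gsrc G \<longlongrightarrow> gsrc G a) (nhds a)"
  using continuous_src
  by (metis UNIV_I continuous_on_def tendsto_at_iff_tendsto_nhds)

text \<open>The source is the range of the inverse, so a local inverse of the range map, followed by
  inversion, is a local section of the source. Relative openness of the image supplies
  \<open>W\<close>.\<close>

lemma src_local_section:
  obtains V W sec where "open V" "a \<in> V" "open W"
    "\<And>v. v \<in> V \<Longrightarrow> gsrc G v \<in> W \<and> sec (gsrc G v) = v"
    "\<And>y. y \<in> W \<inter> units G \<Longrightarrow> sec y \<in> V \<and> gsrc G (sec y) = y"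
    "continuous_on (W \<inter> units G) sec"
proof -
  obtain U h where U: "open U" "ginv G a \<in> U" "openin (top_of_set (units G)) (grng G ` U)"
    and h: "homeomorphism U (grng G ` U) (grng G) h"
    using rng_local_homeo[of "ginv G a"] by blast
  obtain W where W: "open W" "grng G ` U = units G \<inter> W"
    using U(3) by (auto simp: openin_open)
  show thesis
  proof (rule that[of "ginv G -` U" W "\<lambda>y. ginv G (h y)"])
    show "open (ginv G -` U)" by (rule open_vimage[OF U(1) continuous_inv])
    show "continuous_on (W \<inter> units G) (\<lambda>y. ginv G (h y))"
      using h W(2) continuous_on_compose2[OF continuous_inv, of "W \<inter> units G" h]
      by (auto simp: homeomorphism_def Int_commute)
    show "gsrc G v \<in> W \<and> ginv G (h (gsrc G v)) = v" if "v \<in> ginv G -` U" for v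
    proof -
      have v: "ginv G v \<in> U" "grng G (ginv G v) = gsrc G v" using that by (auto simp: rng_inv)
      then have "gsrc G v \<in> grng G ` U" by (metis imageI)
      moreover have "h (gsrc G v) = ginv G v" using h v by (metis homeomorphism_apply1)
      ultimately show ?thesis using W(2) by auto
    qed
    show "ginv G (h y) \<in> ginv G -` U \<and> gsrc G (ginv G (h y)) = y" if "y \<in> W \<inter> units G" for y
    proof -
      have y: "y \<in> grng G ` U" using that W(2) by auto
      then have "h y \<in> U" using h by (metis homeomorphism_def imageI)
      moreover have "grng G (h y) = y" using h y by (metis homeomorphism_apply2)
      ultimately show ?thesis by (simp add: src_inv)
    qed
  qed (use U W in auto)
qed

lemma open_bisection_exists:
  obtains V where "open V" "a \<in> V" "inj_on (gsrc G) V"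
  using src_local_section[of a] by (metis inj_on_inverseI)

abbreviation near_unit :: "'g \<Rightarrow> 'g filter" where
  "near_unit x \<equiv> inf (nhds x) (principal (units G))"

text \<open>The filter form of \<open>src_local_section\<close>, in which limits over units
  approaching the source of \<open>a\<close> can be composed with the section.\<close>

lemma local_section_near:
  obtains sec where "sec (gsrc G a) = a" "(sec \<longlongrightarrow> a) (near_unit (gsrc G a))"
    "\<forall>\<^sub>F y in near_unit (gsrc G a). gsrc G (sec y) = y"
    "\<forall>\<^sub>F g in nhds a. sec (gsrc G g) = g"
proof -
  obtain V W sec where V: "open V" "a \<in> V" "open W"
    and VW: "\<And>v. v \<in> V \<Longrightarrow> gsrc G v \<in> W \<and> sec (gsrc G v) = v"
    and WV: "\<And>y. y \<in> W \<inter> units G \<Longrightarrow> sec y \<in> V \<and> gsrc G (sec y) = y"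
    and cont: "continuous_on (W \<inter> units G) sec"
    using src_local_section[of a] by metis
  have aW: "gsrc G a \<in> W" "sec (gsrc G a) = a" using VW[OF V(2)] by auto
  have W: "\<forall>\<^sub>F y in near_unit (gsrc G a). y \<in> W \<inter> units G"
    unfolding eventually_inf_principal using eventually_nhds_in_open[OF V(3) aW(1)] by eventually_elim auto
  show thesis
  proof (rule that[of sec])
    show "(sec \<longlongrightarrow> a) (near_unit (gsrc G a))"
    proof (rule topological_tendstoI)
      fix S assume "open S" "a \<in> S"
      then obtain A where A: "open A" "A \<inter> (W \<inter> units G) = sec -` S \<inter> (W \<inter> units G)"
        using cont unfolding continuous_on_open_invariant by blast
      have "gsrc G a \<in> sec -` S \<inter> (W \<inter> units G)" using aW \<open>a \<in> S\<close> by simp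
      then have "gsrc G a \<in> A" unfolding A(2)[symmetric] by (rule IntD1)
      then have "\<forall>\<^sub>F y in near_unit (gsrc G a). y \<in> A"
        unfolding eventually_inf_principal
        by (rule eventually_mono[OF eventually_nhds_in_open[OF A(1)]]) auto
      then show "\<forall>\<^sub>F y in near_unit (gsrc G a). sec y \<in> S"
        using W by eventually_elim (use A(2) in auto)
    qed
    show "\<forall>\<^sub>F y in near_unit (gsrc G a). gsrc G (sec y) = y"
      using W by eventually_elim (use WV in auto)
    show "\<forall>\<^sub>F g in nhds a. sec (gsrc G g) = g"
      using eventually_nhds_in_open[OF V(1,2)] by eventually_elim (use VW in auto)
  qed (rule aW)
qed

lemma finite_bisection_fiber:
  assumes "inj_on (gsrc G) V" shows "finite (V \<inter> fiber G x)"
proof (rule finite_imageD)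
  show "finite (gsrc G ` (V \<inter> fiber G x))"
    by (rule finite_subset[of _ "{x}"]) (auto simp: fiber_iff)
  show "inj_on (gsrc G) (V \<inter> fiber G x)" using assms by (rule inj_on_subset) auto
qed

text \<open>In a Hausdorff space the pairs on which source and range agree form a closed set; its
  part in \<open>K \<times> L\<close> is compact and multiplication is continuous there.\<close>

lemma compact_setmul:
  assumes "compact K" "compact L" shows "compact (setmul G K L)"
proof -
  have "closed {p :: 'g \<times> 'g. gsrc G (fst p) = grng G (snd p)}"
    by (intro closed_Collect_eq continuous_on_compose2[OF continuous_src]
        continuous_on_compose2[OF continuous_rng] continuous_intros) auto
  then have "compact (K \<times> L \<inter> {p. gsrc G (fst p) = grng G (snd p)})"
    by (intro compact_Int_closed compact_Times assms)
  moreover have "continuous_on (K \<times> L \<inter> {p. gsrc G (fst p) = grng G (snd p)}) (\<lambda>(a, b). gmul G a b)"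
    by (rule continuous_on_subset[OF continuous_mul]) (auto simp: composable_def)
  ultimately have "compact ((\<lambda>(a, b). gmul G a b) ` (K \<times> L \<inter> {p. gsrc G (fst p) = grng G (snd p)}))"
    by (intro compact_continuous_image)
  also have "(\<lambda>(a, b). gmul G a b) ` (K \<times> L \<inter> {p. gsrc G (fst p) = grng G (snd p)}) = setmul G K L"
    by (force simp: setmul_def)
  finally show ?thesis .
qed

section \<open>Bump functions and compactly supported functions\<close>

lemma Hausdorff: "Hausdorff_space (euclidean :: 'g topology)"
  unfolding Hausdorff_space_def by (metis disjnt_def hausdorff open_openin)

text \<open>A compact neighbourhood \<open>M\<close> of \<open>K\<close> need not lie in
  \<open>V\<close>. Regularity separates \<open>K\<close> from the complement of \<open>V\<close>,
  and an open set \<open>Q\<close> around that complement is removed from \<open>M\<close>.\<close>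

lemma compact_neighbourhood:
  fixes K V :: "'g set"
  assumes K: "compact K" and V: "open V" "K \<subseteq> V"
  obtains W L where "open W" "compact L" "K \<subseteq> W" "W \<subseteq> L" "L \<subseteq> V"
proof -
  have "regular_space (euclidean :: 'g topology)"
    using locally_compact_Hausdorff_imp_regular_space locally_compact Hausdorff by blast
  moreover have "closedin euclidean (- V)" "disjnt K (- V)" using V by (auto simp: disjnt_def)
  ultimately obtain P Q where PQ: "open P" "open Q" "K \<subseteq> P" "- V \<subseteq> Q" "disjnt P Q"
    using regular_space_compact_closed_separation[of "euclidean :: 'g topology" K "- V"] K
    unfolding compactin_euclidean_iff open_openin[symmetric] by blast
  obtain U M where U: "open U" "compact M" "K \<subseteq> U" "U \<subseteq> M"
    using locally_compact Hausdorff K locally_compact_space_compact_closed_compact[of "euclidean :: 'g topology"]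
    by (auto simp: open_openin[symmetric])
  show thesis
    by (rule that[of "P \<inter> U" "M - Q"]) (use PQ U compact_diff in \<open>auto simp: disjnt_def\<close>)
qed

text \<open>The function is made to vanish off the open set \<open>W\<close> of
  \<open>compact_neighbourhood\<close>, not merely off \<open>V\<close>; this gives a support inside
  the compact set \<open>L\<close>.\<close>

lemma Urysohn_compact_support:
  assumes K: "compact K" and V: "open V" "K \<subseteq> V"
  obtains b :: "'g \<Rightarrow> real" and L where "continuous_on UNIV b" "compact L" "L \<subseteq> V"
    "\<And>a. a \<notin> L \<Longrightarrow> b a = 0" "\<And>a. a \<in> K \<Longrightarrow> b a = 1" "\<And>a. 0 \<le> b a" "\<And>a. b a \<le> 1"
proof -
  obtain W L where W: "open W" "compact L" "K \<subseteq> W" "W \<subseteq> L" "L \<subseteq> V"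
    using compact_neighbourhood[OF assms] by metis
  have "completely_regular_space (euclidean :: 'g topology)"
    using locally_compact_regular_imp_completely_regular_space locally_compact Hausdorff by blast
  then obtain b :: "'g \<Rightarrow> real" where b: "continuous_map euclidean (top_of_set {0..1}) b"
      "b ` (- W) \<subseteq> {0}" "b ` K \<subseteq> {1}"
    using Urysohn_completely_regular_compact_closed[of 0 1 euclidean K "- W"] K W
    by (auto simp: disjnt_def closed_closedin[symmetric])
  then have "continuous_on UNIV b" "\<And>a. b a \<in> {0..1}"
    by (auto simp: continuous_map_in_subtopology)
  then show thesis
    using b W by (intro that[of b L]) (auto simp: image_subset_iff)
qed

lemma CcI:
  assumes "continuous_on UNIV \<xi>" "compact L" "\<And>a. a \<notin> L \<Longrightarrow> \<xi> a = 0"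
  shows "\<xi> \<in> Cc G"
proof -
  have "closure {a. \<xi> a \<noteq> 0} \<subseteq> L"
    using assms by (intro closure_minimal compact_imp_closed) auto
  then have "compact (closure {a. \<xi> a \<noteq> 0})"
    using compact_Int_closed[OF assms(2) closed_closure, of "{a. \<xi> a \<noteq> 0}"] by (simp add: Int_absorb1)
  then show ?thesis using assms(1) by (simp add: Cc_def)
qed

lemma CcE:
  assumes "\<xi> \<in> Cc G"
  obtains L where "continuous_on UNIV \<xi>" "compact L" "\<And>a. a \<notin> L \<Longrightarrow> \<xi> a = 0"
proof (rule that[of "closure {a. \<xi> a \<noteq> 0}"])
  show "\<xi> a = 0" if "a \<notin> closure {a. \<xi> a \<noteq> 0}" for a
    using that closure_subset[of "{a. \<xi> a \<noteq> 0}"] by auto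
qed (use assms in \<open>auto simp: Cc_def\<close>)

lemma Cc_mult:
  assumes "\<xi> \<in> Cc G" "continuous_on UNIV \<phi>" shows "(\<lambda>a. \<phi> a * \<xi> a) \<in> Cc G"
  using assms(1) by (rule CcE) (auto intro!: CcI continuous_intros assms(2))

lemma Cc_add:
  assumes "\<xi> \<in> Cc G" "\<eta> \<in> Cc G" shows "(\<lambda>a. \<xi> a + \<eta> a) \<in> Cc G"
proof -
  obtain K where K: "continuous_on UNIV \<xi>" "compact K" "\<And>a. a \<notin> K \<Longrightarrow> \<xi> a = 0"
    using CcE[OF assms(1)] by metis
  obtain L where L: "continuous_on UNIV \<eta>" "compact L" "\<And>a. a \<notin> L \<Longrightarrow> \<eta> a = 0"
    using CcE[OF assms(2)] by metis
  show ?thesis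
    by (rule CcI[of _ "K \<union> L"]) (use K L in \<open>auto intro!: continuous_intros\<close>)
qed

lemma Cc_zero: "(\<lambda>a. 0) \<in> Cc G"
  by (rule CcI[of _ "{}"]) auto

lemma Cc_sum: "(\<And>i. i \<in> I \<Longrightarrow> \<xi> i \<in> Cc G) \<Longrightarrow> (\<lambda>a. \<Sum>i\<in>I. \<xi> i a) \<in> Cc G"
  by (induction I rule: infinite_finite_induct) (auto intro: Cc_add Cc_zero)

text \<open>In place of a partition of unity: if \<open>b i = 1\<close> near the \<open>i\<close>-th piece of the support of \<open>\<xi>\<close>, then
  \<open>\<xi> * (\<Prod>i. 1 - b i) = 0\<close>, and one splits off the summands \<open>\<xi> * b i\<close> one at a time.\<close>

lemma Cc_bisection_induct [consumes 1, case_names add bisection]: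
  assumes \<xi>: "\<xi> \<in> Cc G"
    and add: "\<And>\<xi> \<eta>. \<xi> \<in> Cc G \<Longrightarrow> \<eta> \<in> Cc G \<Longrightarrow> P \<xi> \<Longrightarrow> P \<eta> \<Longrightarrow> P (\<lambda>a. \<xi> a + \<eta> a)"
    and bisection: "\<And>\<xi> V L. \<xi> \<in> Cc G \<Longrightarrow> open V \<Longrightarrow> inj_on (gsrc G) V \<Longrightarrow> compact L \<Longrightarrow> L \<subseteq> V \<Longrightarrow>
      (\<And>a. a \<notin> L \<Longrightarrow> \<xi> a = 0) \<Longrightarrow> P \<xi>"
  shows "P \<xi>"
proof -
  obtain C where C: "compact C" "\<And>a. a \<notin> C \<Longrightarrow> \<xi> a = 0" using CcE[OF \<xi>] by metis
  have "\<exists>V L b W. open V \<and> inj_on (gsrc G) V \<and> compact L \<and> L \<subseteq> V \<and> continuous_on UNIV (b :: 'g \<Rightarrow> real)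
      \<and> (\<forall>g. g \<notin> L \<longrightarrow> b g = 0) \<and> open W \<and> a \<in> W \<and> (\<forall>g\<in>W. b g = 1)" for a
  proof -
    obtain V where V: "open V" "a \<in> V" "inj_on (gsrc G) V" using open_bisection_exists .
    obtain W K where W: "open W" "compact K" "{a} \<subseteq> W" "W \<subseteq> K" "K \<subseteq> V"
      using compact_neighbourhood[of "{a}" V] V by auto
    obtain b :: "'g \<Rightarrow> real" and L where b: "continuous_on UNIV b" "compact L" "L \<subseteq> V"
        "\<And>g. g \<notin> L \<Longrightarrow> b g = 0" "\<And>g. g \<in> K \<Longrightarrow> b g = 1"
      using Urysohn_compact_support[OF W(2) V(1) W(5)] by metis
    have "open V \<and> inj_on (gsrc G) V \<and> compact L \<and> L \<subseteq> V \<and> continuous_on UNIV b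
      \<and> (\<forall>g. g \<notin> L \<longrightarrow> b g = 0) \<and> open W \<and> a \<in> W \<and> (\<forall>g\<in>W. b g = 1)"
      using V W b by auto
    then show ?thesis by blast
  qed
  then obtain V L W and b :: "'g \<Rightarrow> 'g \<Rightarrow> real" where V: "\<And>a. open (V a)" "\<And>a. inj_on (gsrc G) (V a)"
    and L: "\<And>a. compact (L a)" "\<And>a. L a \<subseteq> V a"
    and b: "\<And>a. continuous_on UNIV (b a)" "\<And>a g. g \<notin> L a \<Longrightarrow> b a g = 0"
    and W: "\<And>a. open (W a)" "\<And>a. a \<in> W a" "\<And>a g. g \<in> W a \<Longrightarrow> b a g = 1"
    by metis
  obtain D where D: "finite D" "C \<subseteq> (\<Union>a\<in>D. W a)"
    by (rule compactE_image[OF C(1), of C W]) (use W in auto)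
  \<comment> \<open>Generalised to every \<open>\<eta>\<close> killed by the product, because the
    remainder \<open>?v\<close> is killed by the product over the smaller index set.\<close>
  have "P \<eta>" if "\<eta> \<in> Cc G" "\<And>g. \<eta> g * complex_of_real (\<Prod>a\<in>D. 1 - b a g) = 0" for \<eta>
    using D(1) that
  proof (induction D arbitrary: \<eta>)
    case empty
    \<comment> \<open>The empty product is 1, so \<open>\<eta>\<close> is zero and counts as
      supported in the empty bisection.\<close>
    show ?case by (rule bisection[OF empty.prems(1), of "{}" "{}"]) (use empty.prems in auto)
  next
    case (insert a D)
    let ?u = "\<lambda>g. complex_of_real (b a g) * \<eta> g" and ?v = "\<lambda>g. complex_of_real (1 - b a g) * \<eta> g"
    have uv: "?u \<in> Cc G" "?v \<in> Cc G"
      by (intro Cc_mult insert.prems continuous_intros b)+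
    have "P ?u" by (rule bisection[OF uv(1) V L]) (use b in auto)
    moreover have "P ?v"
      by (rule insert.IH[OF uv(2)]) (use insert.prems insert.hyps in \<open>simp add: mult_ac\<close>)
    moreover have "\<eta> = (\<lambda>g. ?u g + ?v g)" by (auto simp: algebra_simps)
    ultimately show ?case using add[OF uv] by simp
  qed
  moreover have "\<xi> g * complex_of_real (\<Prod>a\<in>D. 1 - b a g) = 0" for g
  proof (cases "g \<in> C")
    case True
    then obtain a where "a \<in> D" "g \<in> W a" using D by auto
    then have "(\<Prod>a\<in>D. 1 - b a g) = 0" using D(1) W(3) by (intro prod_zero) auto
    then show ?thesis by simp
  qed (simp add: C)
  ultimately show ?thesis using \<xi> by blast
qed

section \<open>Lifting finitely supported vectors from a fiber\<close>

lemma finite_disjoint_neighbourhoods: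
  assumes "finite F"
  obtains U :: "'g \<Rightarrow> 'g set" where "\<And>a. open (U a)" "\<And>a. a \<in> U a"
    "\<And>a b. a \<in> F \<Longrightarrow> b \<in> F \<Longrightarrow> a \<noteq> b \<Longrightarrow> U a \<inter> U b = {}"
proof -
  have "\<exists>U V. a \<noteq> b \<longrightarrow> open U \<and> open V \<and> a \<in> U \<and> b \<in> V \<and> U \<inter> V = {}" for a b :: 'g
    using hausdorff[of a b] by (cases "a = b") auto
  then obtain P Q where PQ: "\<And>a b :: 'g. a \<noteq> b \<Longrightarrow>
      open (P a b) \<and> open (Q a b) \<and> a \<in> P a b \<and> b \<in> Q a b \<and> P a b \<inter> Q a b = {}" by metis
  \<comment> \<open>The separating pair chosen for \<open>(a, b)\<close> need not be the reverse of
    the one chosen for \<open>(b, a)\<close>, so the neighbourhood of \<open>a\<close> uses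
    both.\<close>
  show thesis
  proof (rule that[of "\<lambda>a. \<Inter>b\<in>F - {a}. P a b \<inter> Q b a"])
    show "open (\<Inter>b\<in>F - {a}. P a b \<inter> Q b a)" for a
      using assms PQ by (intro open_INT) auto
    show "a \<in> (\<Inter>b\<in>F - {a}. P a b \<inter> Q b a)" for a
    proof (rule INT_I)
      fix b assume "b \<in> F - {a}"
      then show "a \<in> P a b \<inter> Q b a" using PQ[of a b] PQ[of b a] by auto
    qed
    show "(\<Inter>c\<in>F - {a}. P a c \<inter> Q c a) \<inter> (\<Inter>c\<in>F - {b}. P b c \<inter> Q c b) = {}"
      if "a \<in> F" "b \<in> F" "a \<noteq> b" for a b
    proof -
      have "(\<Inter>c\<in>F - {a}. P a c \<inter> Q c a) \<subseteq> P a b" "(\<Inter>c\<in>F - {b}. P b c \<inter> Q c b) \<subseteq> Q a b"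
        using that by auto
      then show ?thesis using PQ[OF that(3)] by blast
    qed
  qed
qed

text \<open>The bumps live in disjoint bisections, so each meets any fiber in at most one arrow,
  with a value of modulus at most that of \<open>f a\<close>. The lift is thus no larger on any
  fiber than \<open>f\<close> on \<open>F\<close>; this uniform control is what makes a series of
  lifts summable in the module norm.\<close>

lemma finite_lift:
  assumes F: "finite F" "F \<subseteq> fiber G x"
  obtains \<xi> where "\<xi> \<in> Cc G" "chi (fiber G x) \<xi> = chi F f"
    "\<And>y. chi (fiber G y) \<xi> \<in> ell2 (fiber G y)"
    "\<And>y. norm2 (fiber G y) \<xi> \<le> L2_set (\<lambda>a. cmod (f a)) F"
proof -
  obtain U :: "'g \<Rightarrow> 'g set" where U: "\<And>a. open (U a)" "\<And>a. a \<in> U a"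
      "\<And>a b. a \<in> F \<Longrightarrow> b \<in> F \<Longrightarrow> a \<noteq> b \<Longrightarrow> U a \<inter> U b = {}"
    using finite_disjoint_neighbourhoods[OF F(1)] by metis
  have "\<exists>V. open V \<and> a \<in> V \<and> inj_on (gsrc G) V" for a
    using open_bisection_exists by metis
  then obtain V where V: "\<And>a. open (V a)" "\<And>a. a \<in> V a" "\<And>a. inj_on (gsrc G) (V a)" by metis
  have "\<exists>b L. continuous_on UNIV (b :: 'g \<Rightarrow> real) \<and> compact L \<and> L \<subseteq> U a \<inter> V a
      \<and> (\<forall>g. g \<notin> L \<longrightarrow> b g = 0) \<and> b a = 1 \<and> (\<forall>g. 0 \<le> b g \<and> b g \<le> 1)" for a
    by (rule Urysohn_compact_support[of "{a}" "U a \<inter> V a"]) (use U V in \<open>auto 4 3\<close>)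
  then obtain b :: "'g \<Rightarrow> 'g \<Rightarrow> real" and L where b: "\<And>a. continuous_on UNIV (b a)" "\<And>a. compact (L a)"
      "\<And>a. L a \<subseteq> U a \<inter> V a" "\<And>a g. g \<notin> L a \<Longrightarrow> b a g = 0" "\<And>a. b a a = 1"
      "\<And>a g. 0 \<le> b a g" "\<And>a g. b a g \<le> 1"
    by metis
  define \<xi> where "\<xi> g = (\<Sum>a\<in>F. f a * complex_of_real (b a g))" for g
  have \<xi>_in: "\<xi> g = f a * complex_of_real (b a g)" if "a \<in> F" "g \<in> U a" for a g
  proof -
    have "b c g = 0" if "c \<in> F" "c \<noteq> a" for c
      using b(3)[of c] b(4)[of g c] U(3)[of c a] that \<open>a \<in> F\<close> \<open>g \<in> U a\<close> by auto
    then have "\<xi> g = (\<Sum>c\<in>{a}. f c * complex_of_real (b c g))"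
      unfolding \<xi>_def using F that by (intro sum.mono_neutral_right) auto
    then show ?thesis by simp
  qed
  have \<xi>_out: "\<xi> g = 0" if "\<And>a. a \<in> F \<Longrightarrow> g \<notin> U a \<inter> V a" for g
    unfolding \<xi>_def using b(3,4) that by (intro sum.neutral ballI) (metis mult_zero_right of_real_0 subsetD)
  have 1: "\<xi> \<in> Cc G"
    unfolding \<xi>_def
    by (intro Cc_sum CcI[of _ "L _"]) (auto intro!: continuous_intros b)
  have 2: "chi (fiber G x) \<xi> = chi F f"
  proof
    fix g
    show "chi (fiber G x) \<xi> g = chi F f g"
    proof (cases "g \<in> F")
      case True
      then show ?thesis using F(2) \<xi>_in[OF True U(2)] b(5) by (auto simp: chi_apply)
    next
      case False
      have "\<xi> g = 0" if "g \<in> fiber G x"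
      proof (rule \<xi>_out)
        fix a assume "a \<in> F"
        then have "gsrc G a = gsrc G g" "g \<noteq> a" using F(2) that False by (auto simp: fiber_iff)
        then show "g \<notin> U a \<inter> V a" using V(2,3)[of a] by (metis IntE inj_onD)
      qed
      with False show ?thesis by (simp add: chi_apply)
    qed
  qed
  have 3: "L2_set (\<lambda>g. cmod (\<xi> g)) H \<le> L2_set (\<lambda>a. cmod (f a)) F"
    if H: "finite H" "H \<subseteq> fiber G y" for H y
    unfolding L2_set_def
  proof (rule real_sqrt_le_mono)
    have "(cmod (\<xi> g))\<^sup>2 \<le> (\<Sum>a\<in>F. if g \<in> U a \<inter> V a then (cmod (f a))\<^sup>2 else 0)" for g
    proof (cases "\<exists>a\<in>F. g \<in> U a \<inter> V a")
      case True
      then obtain a where a: "a \<in> F" "g \<in> U a \<inter> V a" by blast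
      have "cmod (\<xi> g) = cmod (f a) * b a g" using \<xi>_in[OF a(1)] a(2) b(6) by (simp add: norm_mult)
      also have "\<dots> \<le> cmod (f a)" using b(6,7) by (simp add: mult_left_le)
      finally have "(cmod (\<xi> g))\<^sup>2 \<le> (if g \<in> U a \<inter> V a then (cmod (f a))\<^sup>2 else 0)" using a by simp
      also have "\<dots> \<le> (\<Sum>a\<in>F. if g \<in> U a \<inter> V a then (cmod (f a))\<^sup>2 else 0)"
        using a F by (intro member_le_sum) auto
      finally show ?thesis .
    next
      case False
      then show ?thesis using \<xi>_out[of g] by (auto intro!: sum_nonneg)
    qed
    then have "(\<Sum>g\<in>H. (cmod (\<xi> g))\<^sup>2) \<le> (\<Sum>g\<in>H. \<Sum>a\<in>F. if g \<in> U a \<inter> V a then (cmod (f a))\<^sup>2 else 0)"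
      by (rule sum_mono)
    also have "\<dots> = (\<Sum>a\<in>F. \<Sum>g\<in>H. if g \<in> U a \<inter> V a then (cmod (f a))\<^sup>2 else 0)"
      by (rule sum.swap)
    also have "\<dots> = (\<Sum>a\<in>F. real (card (H \<inter> (U a \<inter> V a))) * (cmod (f a))\<^sup>2)"
      using H by (simp add: sum.If_cases Int_def)
    also have "\<dots> \<le> (\<Sum>a\<in>F. 1 * (cmod (f a))\<^sup>2)"
    proof (intro sum_mono mult_right_mono)
      fix a
      \<comment> \<open>Two arrows of one fiber inside the bisection \<open>V a\<close>
        coincide.\<close>
      have "g = h" if "g \<in> H \<inter> (U a \<inter> V a)" "h \<in> H \<inter> (U a \<inter> V a)" for g h
        using that H(2) V(3)[of a] by (auto simp: fiber_iff inj_on_def subset_iff)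
      then have "card (H \<inter> (U a \<inter> V a)) \<le> Suc 0"
        using H(1) by (subst card_le_Suc0_iff_eq) auto
      then show "real (card (H \<inter> (U a \<inter> V a))) \<le> 1" by simp
    qed auto
    finally show "(\<Sum>g\<in>H. (cmod (\<xi> g))\<^sup>2) \<le> (\<Sum>a\<in>F. (cmod (f a))\<^sup>2)" by simp
  qed
  show thesis
    by (rule that[OF 1 2]) (use sq_summable_bounded[OF 3] in \<open>auto simp: chi_in_ell2_iff\<close>)
qed

lemma delta_lift:
  assumes "a \<in> fiber G x"
  obtains \<eta> where "\<eta> \<in> Cc G" "chi (fiber G x) \<eta> = delta a"
proof -
  obtain \<eta> where "\<eta> \<in> Cc G" "chi (fiber G x) \<eta> = chi {a} (\<lambda>_. 1)"
    by (rule finite_lift[of "{a}" x "\<lambda>_. 1"]) (use assms in auto)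
  moreover have "chi {a} (\<lambda>_. 1) = delta a" by (auto simp: chi_apply delta_apply)
  ultimately show thesis using that by auto
qed

text \<open>A function supported in a bisection has finite support on each fiber, and square
  summability is additive.\<close>

lemma Cc_fiber_ell2:
  assumes "\<xi> \<in> Cc G" shows "chi (fiber G x) \<xi> \<in> ell2 (fiber G x)"
  using assms
proof (induction rule: Cc_bisection_induct)
  case (add \<xi> \<eta>)
  have "chi (fiber G x) (\<lambda>a. \<xi> a + \<eta> a) = (\<lambda>a. chi (fiber G x) \<xi> a + chi (fiber G x) \<eta> a)"
    by (auto simp: chi_apply)
  then show ?case using add by (simp add: ell2_add)
next
  case (bisection \<xi> V L)
  show ?case
    by (rule ell2_finite_support[of "V \<inter> fiber G x"])
      (use bisection finite_bisection_fiber in \<open>auto simp: chi_apply\<close>)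
qed

section \<open>The Hilbert module and its slices\<close>

lemma Cc_subset_L2: "Cc G \<subseteq> L2 G"
proof
  fix \<xi> assume \<xi>: "\<xi> \<in> Cc G"
  then show "\<xi> \<in> L2 G" unfolding L2_def by (auto intro!: bexI[of _ \<xi>])
qed

lemma L2_approx:
  assumes "\<xi> \<in> L2 G" "\<epsilon> > 0"
  obtains \<eta> where "\<eta> \<in> Cc G" "\<And>x. x \<in> units G \<Longrightarrow> chi (fiber G x) (\<lambda>a. \<xi> a - \<eta> a) \<in> ell2 (fiber G x)"
    "\<And>x. x \<in> units G \<Longrightarrow> norm2 (fiber G x) (\<lambda>a. \<xi> a - \<eta> a) \<le> \<epsilon>"
  using assms unfolding L2_def chi_in_ell2_iff by blast

lemma L2_closed:
  assumes "\<And>\<epsilon>. \<epsilon> > 0 \<Longrightarrow> \<exists>\<eta>\<in>L2 G. \<forall>x\<in>units G.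
    chi (fiber G x) (\<lambda>a. \<xi> a - \<eta> a) \<in> ell2 (fiber G x) \<and> norm2 (fiber G x) (\<lambda>a. \<xi> a - \<eta> a) \<le> \<epsilon>"
  shows "\<xi> \<in> L2 G"
  unfolding L2_def
proof (intro CollectI allI impI)
  fix \<epsilon> :: real assume \<epsilon>: "\<epsilon> > 0"
  obtain \<eta> where \<eta>: "\<eta> \<in> L2 G" "\<And>x. x \<in> units G \<Longrightarrow>
      chi (fiber G x) (\<lambda>a. \<xi> a - \<eta> a) \<in> ell2 (fiber G x) \<and> norm2 (fiber G x) (\<lambda>a. \<xi> a - \<eta> a) \<le> \<epsilon> / 2"
    using assms[of "\<epsilon> / 2"] \<epsilon> by auto
  obtain \<zeta> where \<zeta>: "\<zeta> \<in> Cc G" "\<And>x. x \<in> units G \<Longrightarrow>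
      chi (fiber G x) (\<lambda>a. \<eta> a - \<zeta> a) \<in> ell2 (fiber G x) \<and> norm2 (fiber G x) (\<lambda>a. \<eta> a - \<zeta> a) \<le> \<epsilon> / 2"
    by (rule L2_approx[OF \<eta>(1) half_gt_zero[OF \<epsilon>]]) blast
  show "\<exists>\<zeta>\<in>Cc G. \<forall>x\<in>units G. (\<lambda>a. (cmod (\<xi> a - \<zeta> a))\<^sup>2) summable_on fiber G x \<and>
      norm2 (fiber G x) (\<lambda>a. \<xi> a - \<zeta> a) \<le> \<epsilon>"
  proof (intro bexI[OF _ \<zeta>(1)] ballI)
    fix x assume x: "x \<in> units G"
    let ?S = "fiber G x"
    let ?f = "chi ?S (\<lambda>a. \<xi> a - \<eta> a)" and ?g = "chi ?S (\<lambda>a. \<eta> a - \<zeta> a)"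
    have eq: "chi ?S (\<lambda>a. \<xi> a - \<zeta> a) = (\<lambda>a. ?f a + ?g a)" by (auto simp: chi_apply)
    have "norm2 ?S (chi ?S (\<lambda>a. \<xi> a - \<zeta> a)) \<le> norm2 ?S ?f + norm2 ?S ?g"
      unfolding eq using \<eta>(2)[OF x] \<zeta>(2)[OF x] by (intro norm2_triangle) auto
    also have "\<dots> \<le> \<epsilon>" using \<eta>(2)[OF x] \<zeta>(2)[OF x] by simp
    finally have "norm2 ?S (\<lambda>a. \<xi> a - \<zeta> a) \<le> \<epsilon>" by simp
    moreover have "chi ?S (\<lambda>a. \<xi> a - \<zeta> a) \<in> ell2 ?S"
      unfolding eq using \<eta>(2)[OF x] \<zeta>(2)[OF x] by (intro ell2_add) auto
    ultimately show "(\<lambda>a. (cmod (\<xi> a - \<zeta> a))\<^sup>2) summable_on ?S \<and> norm2 ?S (\<lambda>a. \<xi> a - \<zeta> a) \<le> \<epsilon>"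
      by (simp add: chi_in_ell2_iff)
  qed
qed

lemma L2_fiber_ell2:
  assumes "\<xi> \<in> L2 G" "x \<in> units G" shows "chi (fiber G x) \<xi> \<in> ell2 (fiber G x)"
proof -
  obtain \<eta> where \<eta>: "\<eta> \<in> Cc G" "chi (fiber G x) (\<lambda>a. \<xi> a - \<eta> a) \<in> ell2 (fiber G x)"
    by (rule L2_approx[OF assms(1) zero_less_one]) (use assms(2) in blast)
  have "chi (fiber G x) \<xi> = (\<lambda>a. chi (fiber G x) (\<lambda>a. \<xi> a - \<eta> a) a + chi (fiber G x) \<eta> a)"
    by (auto simp: chi_apply)
  then show ?thesis using ell2_add(1)[OF \<eta>(2) Cc_fiber_ell2[OF \<eta>(1)]] by simp
qed

text \<open>The vector \<open>f\<close> is a telescoping series of finitely supported differences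
  with geometrically decaying norms. By \<open>finite_lift\<close> each lift is no larger on any
  other fiber, so the series of lifts converges uniformly over all units.\<close>

lemma L2_fiber_surj:
  assumes f: "f \<in> ell2 (fiber G x)"
  obtains \<xi> where "\<xi> \<in> L2 G" "chi (fiber G x) \<xi> = f"
proof -
  let ?S = "fiber G x"
  have "\<exists>F. finite F \<and> F \<subseteq> ?S \<and> norm2 ?S (\<lambda>a. f a - chi F f a) \<le> (1/2) ^ n" for n
    using ell2_finite_approx[OF f, of "(1/2) ^ n"] by (metis zero_less_power half_gt_zero_iff zero_less_one)
  then obtain F where F: "\<And>n. finite (F n)" "\<And>n. F n \<subseteq> ?S"
      "\<And>n. norm2 ?S (\<lambda>a. f a - chi (F n) f a) \<le> (1/2) ^ n"
    by metis
  \<comment> \<open>The approximations are shifted by one so that \<open>p 0\<close> is zero and the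
    differences \<open>d n\<close> sum to all of \<open>f\<close>; the decay estimate accordingly
    starts at \<open>d (Suc n)\<close>.\<close>
  define p where "p n = (case n of 0 \<Rightarrow> (\<lambda>a. 0) | Suc m \<Rightarrow> chi (F m) f)" for n
  define E where "E n = (case n of 0 \<Rightarrow> {} | Suc m \<Rightarrow> F m)" for n
  define d where "d n = (\<lambda>a. p (Suc n) a - p n a)" for n
  define D where "D n = E (Suc n) \<union> E n" for n
  have E: "finite (E n)" "E n \<subseteq> ?S" "\<And>a. a \<notin> E n \<Longrightarrow> p n a = 0" for n
    using F by (auto simp: E_def p_def chi_apply split: nat.split)
  have D: "finite (D n)" "D n \<subseteq> ?S" "\<And>a. a \<notin> D n \<Longrightarrow> d n a = 0" for n
    using E by (auto simp: D_def d_def)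
  have p: "p n \<in> ell2 ?S" for n by (rule ell2_finite_support[OF E])
  have d: "d n \<in> ell2 ?S" for n by (rule ell2_finite_support[OF D])
  have norm_d: "norm2 ?S (d (Suc n)) \<le> 2 * (1/2) ^ n" for n
  proof -
    have eq: "d (Suc n) = (\<lambda>a. (f a - chi (F n) f a) - (f a - chi (F (Suc n)) f a))"
      by (auto simp: d_def p_def)
    have "norm2 ?S (d (Suc n)) \<le> norm2 ?S (\<lambda>a. f a - chi (F n) f a) + norm2 ?S (\<lambda>a. f a - chi (F (Suc n)) f a)"
      unfolding eq by (intro norm2_triangle_diff ell2_diff f chi_in_ell2)
    also have "\<dots> \<le> (1/2) ^ n + (1/2) ^ Suc n" by (intro add_mono F)
    also have "\<dots> \<le> 2 * (1/2) ^ n" by simp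
    finally show ?thesis .
  qed
  have summ: "summable (\<lambda>n. norm2 ?S (d n))"
  proof (subst summable_Suc_iff[symmetric], rule summable_comparison_test')
    show "summable (\<lambda>n. 2 * (1/2) ^ n :: real)" by (intro summable_mult summable_geometric) simp
    show "norm (norm2 ?S (d (Suc n))) \<le> 2 * (1/2) ^ n" for n using norm_d by simp
  qed
  have "\<exists>\<xi>. \<xi> \<in> Cc G \<and> chi ?S \<xi> = d n \<and> (\<forall>y. chi (fiber G y) \<xi> \<in> ell2 (fiber G y)
      \<and> norm2 (fiber G y) \<xi> \<le> norm2 ?S (d n))" for n
  proof -
    have "chi (D n) (d n) = d n" using D(3) by (auto simp: chi_apply)
    moreover have "norm2 ?S (d n) = L2_set (\<lambda>a. cmod (d n a)) (D n)"
      by (rule norm2_finite_support) (use D in auto)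
    ultimately show ?thesis using finite_lift[OF D(1,2), of n "d n"] by metis
  qed
  then obtain \<xi> where \<xi>: "\<And>n. \<xi> n \<in> Cc G" "\<And>n. chi ?S (\<xi> n) = d n"
      "\<And>n y. chi (fiber G y) (\<xi> n) \<in> ell2 (fiber G y)"
      "\<And>n y. norm2 (fiber G y) (\<xi> n) \<le> norm2 ?S (d n)"
    by metis
  define \<zeta> where "\<zeta> a = (\<Sum>n. \<xi> n a)" for a
  have summ_y: "summable (\<lambda>n. norm2 (fiber G y) (chi (fiber G y) (\<xi> n)))" for y
    by (rule summable_comparison_test'[OF summ]) (use \<xi>(4) in auto)
  \<comment> \<open>The bound does not depend on \<open>y\<close>, so the partial sums approximate
    \<open>\<zeta>\<close> in the module norm.\<close>
  have tail: "chi (fiber G y) (\<lambda>a. \<zeta> a - (\<Sum>n<N. \<xi> n a)) \<in> ell2 (fiber G y)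
      \<and> norm2 (fiber G y) (\<lambda>a. \<zeta> a - (\<Sum>n<N. \<xi> n a)) \<le> (\<Sum>n. norm2 ?S (d (n + N)))" for y N
  proof -
    let ?Y = "fiber G y"
    let ?h = "\<lambda>n. chi ?Y (\<xi> (n + N))"
    have s: "summable (\<lambda>n. norm2 ?Y (?h n))" using summ_y[of y] by (subst summable_iff_shift)
    have eq: "chi ?Y (\<lambda>a. \<zeta> a - (\<Sum>n<N. \<xi> n a)) = (\<lambda>a. \<Sum>n. ?h n a)"
    proof
      fix a
      show "chi ?Y (\<lambda>a. \<zeta> a - (\<Sum>n<N. \<xi> n a)) a = (\<Sum>n. ?h n a)"
      proof (cases "a \<in> ?Y")
        case True
        then have "summable (\<lambda>n. \<xi> n a)"
          using ell2_series(1)[OF \<xi>(3) summ_y[of y], of a] by (simp add: chi_apply)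
        from suminf_split_initial_segment[OF this, of N] True show ?thesis
          by (simp add: \<zeta>_def chi_apply)
      qed (simp add: chi_apply)
    qed
    have "norm2 ?Y (\<lambda>a. \<Sum>n. ?h n a) \<le> (\<Sum>n. norm2 ?Y (?h n))"
      by (rule norm2_series_le[OF \<xi>(3) s])
    also have "\<dots> \<le> (\<Sum>n. norm2 ?S (d (n + N)))"
      using \<xi>(4) by (intro suminf_le[OF _ s] summable_ignore_initial_segment summ) auto
    finally have "norm2 ?Y (chi ?Y (\<lambda>a. \<zeta> a - (\<Sum>n<N. \<xi> n a))) \<le> (\<Sum>n. norm2 ?S (d (n + N)))"
      unfolding eq .
    moreover have "chi ?Y (\<lambda>a. \<zeta> a - (\<Sum>n<N. \<xi> n a)) \<in> ell2 ?Y"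
      unfolding eq by (rule ell2_series(2)[OF \<xi>(3) s])
    ultimately show ?thesis by simp
  qed
  have "\<zeta> \<in> L2 G"
  proof (rule L2_closed)
    fix \<epsilon> :: real assume "\<epsilon> > 0"
    then obtain N where N: "norm (\<Sum>n. norm2 ?S (d (n + N))) < \<epsilon>"
      using suminf_exist_split[OF _ summ] by blast
    have L2: "(\<lambda>a. \<Sum>n<N. \<xi> n a) \<in> L2 G"
      using Cc_subset_L2 Cc_sum[of "{..<N}" \<xi>] \<xi>(1) by blast
    have le: "(\<Sum>n. norm2 ?S (d (n + N))) \<le> \<epsilon>" using N by simp
    show "\<exists>\<eta>\<in>L2 G. \<forall>x\<in>units G. chi (fiber G x) (\<lambda>a. \<zeta> a - \<eta> a) \<in> ell2 (fiber G x)
        \<and> norm2 (fiber G x) (\<lambda>a. \<zeta> a - \<eta> a) \<le> \<epsilon>"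
    proof (intro bexI[OF _ L2] ballI)
      fix z
      show "chi (fiber G z) (\<lambda>a. \<zeta> a - (\<Sum>n<N. \<xi> n a)) \<in> ell2 (fiber G z)
          \<and> norm2 (fiber G z) (\<lambda>a. \<zeta> a - (\<Sum>n<N. \<xi> n a)) \<le> \<epsilon>"
        using tail[of z N] le by simp
    qed
  qed
  moreover have "chi ?S \<zeta> = f"
  proof
    fix a
    show "chi ?S \<zeta> a = f a"
    proof (cases "a \<in> ?S")
      case True
      have "(\<lambda>n. d n a) sums (f a - p 0 a)"
        unfolding d_def
      proof (rule telescope_sums)
        show "(\<lambda>n. p n a) \<longlonglongrightarrow> f a"
        proof (subst filterlim_sequentially_Suc[symmetric], rule Lim_transform)
          show "(\<lambda>n. f a) \<longlonglongrightarrow> f a" by simp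
          show "(\<lambda>n. p (Suc n) a - f a) \<longlonglongrightarrow> 0"
          proof (rule Lim_null_comparison)
            show "(\<lambda>n. (1/2) ^ n :: real) \<longlonglongrightarrow> 0" by (rule LIMSEQ_realpow_zero) auto
            show "\<forall>\<^sub>F n in sequentially. norm (p (Suc n) a - f a) \<le> (1/2) ^ n"
              using order_trans[OF cmod_le_norm2[OF ell2_diff(1)[OF f chi_in_ell2(1)[OF f]]] F(3)]
              by (auto simp: p_def norm_minus_commute)
          qed
        qed
      qed
      moreover have "d n a = \<xi> n a" for n using \<xi>(2)[of n] True by (metis chi_apply)
      ultimately show ?thesis using True by (simp add: chi_apply \<zeta>_def p_def sums_unique[symmetric])
    qed (simp add: chi_apply ell2_eq_0[OF f])
  qed
  ultimately show thesis using that by blast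
qed

section \<open>Slices of adjointable operators\<close>

lemma adjointable_opsE:
  assumes "T \<in> adjointable_ops G"
  obtains R where "\<And>\<xi>. \<xi> \<in> L2 G \<Longrightarrow> T \<xi> \<in> L2 G" "\<And>\<xi>. \<xi> \<in> L2 G \<Longrightarrow> R \<xi> \<in> L2 G"
    "\<And>\<xi> \<eta> x. \<xi> \<in> L2 G \<Longrightarrow> \<eta> \<in> L2 G \<Longrightarrow> x \<in> units G \<Longrightarrow>
      inner2 (fiber G x) (T \<xi>) \<eta> = inner2 (fiber G x) \<xi> (R \<eta>)"
proof -
  have T: "T \<in> L2 G \<rightarrow>\<^sub>E L2 G" and
    "\<exists>R\<in>L2 G \<rightarrow>\<^sub>E L2 G. \<forall>\<xi>\<in>L2 G. \<forall>\<eta>\<in>L2 G. \<forall>x\<in>units G.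
      inner2 (fiber G x) (T \<xi>) \<eta> = inner2 (fiber G x) \<xi> (R \<eta>)"
    using assms by (simp_all add: adjointable_ops_def)
  then obtain R where R: "R \<in> L2 G \<rightarrow>\<^sub>E L2 G"
      "\<forall>\<xi>\<in>L2 G. \<forall>\<eta>\<in>L2 G. \<forall>x\<in>units G. inner2 (fiber G x) (T \<xi>) \<eta> = inner2 (fiber G x) \<xi> (R \<eta>)"
    by (elim bexE)
  show thesis
  proof (rule that)
    show "\<xi> \<in> L2 G \<Longrightarrow> T \<xi> \<in> L2 G" "\<xi> \<in> L2 G \<Longrightarrow> R \<xi> \<in> L2 G" for \<xi>
      using T R(1) by (auto dest: PiE_mem)
  qed (simp add: R(2))
qed

text \<open>The restriction of \<open>T \<xi>\<close> to the fiber depends only on that of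
  \<open>\<xi>\<close>, because its value at \<open>a\<close> is a pairing of \<open>\<xi>\<close>
  with \<open>R \<eta>\<close> for a lift \<open>\<eta>\<close> of \<open>delta a\<close>. Every
  vector has a lift, so the slice is defined on all of \<open>ell2\<close>; Hellinger-Toeplitz,
  applied to \<open>T\<close> and \<open>R\<close> after lifting, makes it bounded.\<close>

lemma slice_ex1:
  assumes T: "T \<in> adjointable_ops G" and x: "x \<in> units G"
  shows "\<exists>!S. S \<in> bounded_ops (fiber G x) \<and> (\<forall>\<xi>\<in>L2 G. S (chi (fiber G x) \<xi>) = chi (fiber G x) (T \<xi>))"
proof -
  let ?S = "fiber G x" and ?r = "chi (fiber G x)"
  obtain R where T_mem: "\<And>\<xi>. \<xi> \<in> L2 G \<Longrightarrow> T \<xi> \<in> L2 G" and R_mem: "\<And>\<xi>. \<xi> \<in> L2 G \<Longrightarrow> R \<xi> \<in> L2 G"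
    and adj: "\<And>\<xi> \<eta>. \<xi> \<in> L2 G \<Longrightarrow> \<eta> \<in> L2 G \<Longrightarrow> inner2 ?S (T \<xi>) \<eta> = inner2 ?S \<xi> (R \<eta>)"
    by (rule adjointable_opsE[OF T]) (use x in blast)
  have inner_r: "inner2 ?S f (?r g) = inner2 ?S f g" "inner2 ?S (?r f) g = inner2 ?S f g" for f g
    by (auto intro!: inner2_cong simp: chi_apply)
  define lift where "lift f = (SOME \<xi>. \<xi> \<in> L2 G \<and> ?r \<xi> = f)" for f
  have lift: "lift f \<in> L2 G" "?r (lift f) = f" if "f \<in> ell2 ?S" for f
    using someI_ex[of "\<lambda>\<xi>. \<xi> \<in> L2 G \<and> ?r \<xi> = f"] L2_fiber_surj[OF that] unfolding lift_def by metis+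
  have adj_lift: "inner2 ?S (?r (T (lift f))) g = inner2 ?S f (?r (R (lift g)))"
    if "f \<in> ell2 ?S" "g \<in> ell2 ?S" for f g
    using adj[OF lift(1)[OF that(1)] lift(1)[OF that(2)]] lift(2)[OF that(1)] lift(2)[OF that(2)] inner_r
    by metis
  let ?T = "restrict (\<lambda>f. ?r (T (lift f))) (ell2 ?S)"
  have T_bounded: "?T \<in> bounded_ops ?S"
    by (rule Hellinger_Toeplitz[where R="\<lambda>f. ?r (R (lift f))"])
      (auto intro!: L2_fiber_ell2 T_mem R_mem lift x adj_lift)
  have T_slice: "?T (?r \<xi>) = ?r (T \<xi>)" if \<xi>: "\<xi> \<in> L2 G" for \<xi>
  proof
    fix a
    have r\<xi>: "?r \<xi> \<in> ell2 ?S" by (rule L2_fiber_ell2[OF \<xi> x])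
    let ?\<zeta> = "lift (?r \<xi>)"
    show "?T (?r \<xi>) a = ?r (T \<xi>) a"
    proof (cases "a \<in> ?S")
      case True
      obtain \<eta> where "\<eta> \<in> Cc G" and \<eta>: "?r \<eta> = delta a" using delta_lift[OF True] .
      then have \<eta>_mem: "\<eta> \<in> L2 G" using Cc_subset_L2 by auto
      \<comment> \<open>The lift of \<open>?r \<xi>\<close> and \<open>\<xi>\<close> itself restrict
        to the same vector, and the right side sees only that restriction.\<close>
      have entry: "T \<zeta> a = cnj (inner2 ?S (?r \<zeta>) (R \<eta>))" if "\<zeta> \<in> L2 G" for \<zeta>
        using adj[OF that \<eta>_mem] inner_r inner2_delta_right[OF True, of "T \<zeta>"] \<eta>
        by (metis complex_cnj_cnj)
      show ?thesis
        using True r\<xi> entry[OF \<xi>] entry[OF lift(1)[OF r\<xi>]] lift(2)[OF r\<xi>] by (simp add: chi_apply)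
    qed (use r\<xi> in \<open>simp add: chi_apply\<close>)
  qed
  show ?thesis
  proof (rule ex1I[of _ ?T])
    show "?T \<in> bounded_ops ?S \<and> (\<forall>\<xi>\<in>L2 G. ?T (?r \<xi>) = ?r (T \<xi>))"
      using T_bounded T_slice by blast
  next
    fix P assume P: "P \<in> bounded_ops ?S \<and> (\<forall>\<xi>\<in>L2 G. P (?r \<xi>) = ?r (T \<xi>))"
    show "P = ?T"
    proof (rule bounded_ops_eqI[OF _ T_bounded])
      fix a b assume "a \<in> ?S" "b \<in> ?S"
      obtain \<eta> where "\<eta> \<in> Cc G" and \<eta>: "?r \<eta> = delta b" using delta_lift[OF \<open>b \<in> ?S\<close>] .
      then have "\<eta> \<in> L2 G" using Cc_subset_L2 by auto
      then show "P (delta b) a = ?T (delta b) a"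
        using P T_slice[of \<eta>] \<eta> by metis
    qed (use P in blast)
  qed
qed

lemma slice_bounded:
  assumes "T \<in> adjointable_ops G" "x \<in> units G"
  shows "slice G x T \<in> bounded_ops (fiber G x)"
    and slice_chi: "\<xi> \<in> L2 G \<Longrightarrow> slice G x T (chi (fiber G x) \<xi>) = chi (fiber G x) (T \<xi>)"
  using theI'[OF slice_ex1[OF assms]] unfolding slice_def by blast+

lemma slice_eqI:
  assumes "T \<in> adjointable_ops G" "x \<in> units G" "S \<in> bounded_ops (fiber G x)"
    "\<And>\<xi>. \<xi> \<in> L2 G \<Longrightarrow> S (chi (fiber G x) \<xi>) = chi (fiber G x) (T \<xi>)"
  shows "slice G x T = S"
  using the1_equality[OF slice_ex1[OF assms(1,2)], of S] assms(3,4) unfolding slice_def by blast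

section \<open>Continuous kernels\<close>

definition same_src :: "('g \<times> 'g) set" where
  "same_src = {(a, b). gsrc G a = gsrc G b}"

text \<open>Joint continuity relative to pairs over a common unit; the values of \<open>k\<close> at
  other pairs are left unconstrained.\<close>

definition continuous_kernel :: "('g \<Rightarrow> 'g \<Rightarrow> complex) \<Rightarrow> bool" where
  "continuous_kernel k \<longleftrightarrow>
     (\<forall>p\<in>same_src. (case_prod k \<longlongrightarrow> case_prod k p) (inf (nhds p) (principal same_src)))"

lemma continuous_kernelD:
  assumes "continuous_kernel k" "gsrc G a = gsrc G b"
    and "(u \<longlongrightarrow> a) F" "(v \<longlongrightarrow> b) F" "\<forall>\<^sub>F i in F. gsrc G (u i) = gsrc G (v i)"
  shows "((\<lambda>i. k (u i) (v i)) \<longlongrightarrow> k a b) F"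
proof -
  have "filterlim (\<lambda>i. (u i, v i)) (inf (nhds (a, b)) (principal same_src)) F"
    using assms(5) by (auto simp: filterlim_inf filterlim_principal same_src_def intro: tendsto_Pair assms(3,4))
  moreover have "(case_prod k \<longlongrightarrow> k a b) (inf (nhds (a, b)) (principal same_src))"
    using assms(1,2) by (auto simp: continuous_kernel_def same_src_def)
  ultimately show ?thesis using filterlim_compose by fastforce
qed

lemma continuous_kernel_adjoint:
  assumes "continuous_kernel k" shows "continuous_kernel (\<lambda>a b. cnj (k b a))"
  unfolding continuous_kernel_def
proof
  fix p assume p: "p \<in> same_src"
  let ?F = "inf (nhds p) (principal same_src)"
  have id: "((\<lambda>q. q) \<longlongrightarrow> p) ?F" by (rule filterlim_mono[OF filterlim_ident order_refl inf_le1])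
  have "((\<lambda>q. k (snd q) (fst q)) \<longlongrightarrow> k (snd p) (fst p)) ?F"
    using p by (intro continuous_kernelD[OF assms] tendsto_fst tendsto_snd id)
      (auto simp: same_src_def eventually_inf_principal intro!: always_eventually)
  from tendsto_cnj[OF this] show "((\<lambda>(a, b). cnj (k b a)) \<longlongrightarrow> (case p of (a, b) \<Rightarrow> cnj (k b a))) ?F"
    by (simp add: case_prod_unfold)
qed

section \<open>Moving arrows over a dense set of units\<close>

lemma dense_filter_not_bot:
  assumes "units G \<subseteq> closure X" "x \<in> units G"
  shows "inf (nhds x) (principal X) \<noteq> bot"
proof
  assume "inf (nhds x) (principal X) = bot"
  then have "\<forall>\<^sub>F y in inf (nhds x) (principal X). False" by simp
  then obtain S where S: "open S" "x \<in> S" "S \<inter> X = {}"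
    unfolding eventually_inf_principal eventually_nhds by blast
  then have "S \<inter> closure X = {}" by (simp add: open_Int_closure_eq_empty)
  then show False using S assms by blast
qed

text \<open>Distinct arrows over \<open>x\<close> stay distinct when moved to nearby units, by the
  Hausdorff property, so sums and norms over \<open>F\<close> can be reindexed. Finiteness of
  \<open>F\<close> lets the conditions on the single arrows hold simultaneously near
  \<open>x\<close>.\<close>

lemma finite_sections:
  assumes "X \<subseteq> units G" "x \<in> units G" "finite F" "F \<subseteq> fiber G x"
  obtains sec where "\<And>a. a \<in> F \<Longrightarrow> (sec a \<longlongrightarrow> a) (inf (nhds x) (principal X))"
    "\<forall>\<^sub>F y in inf (nhds x) (principal X).
      y \<in> X \<and> (\<forall>a\<in>F. gsrc G (sec a y) = y) \<and> inj_on (\<lambda>a. sec a y) F"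
proof -
  let ?N = "inf (nhds x) (principal X)"
  have N: "?N \<le> near_unit x" using assms(1) by (intro inf_mono) auto
  have "\<exists>s. (s \<longlongrightarrow> a) (near_unit (gsrc G a)) \<and> (\<forall>\<^sub>F y in near_unit (gsrc G a). gsrc G (s y) = y)" for a
    using local_section_near[of a] by metis
  then obtain sec where sec: "\<And>a. (sec a \<longlongrightarrow> a) (near_unit (gsrc G a))"
      "\<And>a. \<forall>\<^sub>F y in near_unit (gsrc G a). gsrc G (sec a y) = y" by metis
  have lim: "(sec a \<longlongrightarrow> a) ?N" if "a \<in> F" for a
    using tendsto_mono[OF N] sec(1)[of a] that assms(4) by (auto simp: fiber_iff subset_iff)
  have src: "\<forall>\<^sub>F y in ?N. gsrc G (sec a y) = y" if "a \<in> F" for a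
    using filter_leD[OF N] sec(2)[of a] that assms(4) by (auto simp: fiber_iff subset_iff)
  have "\<forall>\<^sub>F y in ?N. a \<noteq> b \<longrightarrow> sec a y \<noteq> sec b y" if "a \<in> F" "b \<in> F" for a b
  proof (cases "a = b")
    case False
    then obtain U V where UV: "open U" "open V" "a \<in> U" "b \<in> V" "U \<inter> V = {}"
      using hausdorff by metis
    have "\<forall>\<^sub>F y in ?N. sec a y \<in> U" "\<forall>\<^sub>F y in ?N. sec b y \<in> V"
      using topological_tendstoD[OF lim] UV that by auto
    then show ?thesis by eventually_elim (use UV in auto)
  qed simp
  then have "\<forall>\<^sub>F y in ?N. \<forall>a\<in>F. \<forall>b\<in>F. a \<noteq> b \<longrightarrow> sec a y \<noteq> sec b y"
    using assms(3) by (intro eventually_ball_finite ballI) auto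
  moreover have "\<forall>\<^sub>F y in ?N. \<forall>a\<in>F. gsrc G (sec a y) = y"
    using assms(3) src by (intro eventually_ball_finite ballI) auto
  moreover have "\<forall>\<^sub>F y in ?N. y \<in> X" by (simp add: eventually_inf_principal)
  ultimately have "\<forall>\<^sub>F y in ?N. y \<in> X \<and> (\<forall>a\<in>F. gsrc G (sec a y) = y) \<and> inj_on (\<lambda>a. sec a y) F"
    by eventually_elim (auto simp: inj_on_def)
  with lim show thesis by (rule that)
qed

text \<open>Local sections through both arrows, evaluated at units of \<open>X\<close> near the
  common source, give pairs over \<open>X\<close> that tend to \<open>p\<close>.\<close>

lemma dense_pairs:
  assumes X: "X \<subseteq> units G" "units G \<subseteq> closure X" and p: "p \<in> same_src"
  shows "inf (nhds p) (principal {(a, b). gsrc G a = gsrc G b \<and> gsrc G b \<in> X}) \<noteq> bot"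
proof
  let ?D = "{(a, b). gsrc G a = gsrc G b \<and> gsrc G b \<in> X}"
  obtain a b where ab: "p = (a, b)" "gsrc G a = gsrc G b" using p by (auto simp: same_src_def)
  let ?x = "gsrc G b"
  let ?N = "inf (nhds ?x) (principal X)"
  obtain sec where sec: "\<And>c. c \<in> {a, b} \<Longrightarrow> (sec c \<longlongrightarrow> c) ?N"
    "\<forall>\<^sub>F y in ?N. y \<in> X \<and> (\<forall>c\<in>{a, b}. gsrc G (sec c y) = y) \<and> inj_on (\<lambda>c. sec c y) {a, b}"
    by (rule finite_sections[OF X(1), of ?x "{a, b}"]) (use ab in \<open>auto simp: fiber_iff\<close>)
  have "filterlim (\<lambda>y. (sec a y, sec b y)) (inf (nhds p) (principal ?D)) ?N"
    unfolding filterlim_inf filterlim_principal ab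
  proof
    show "((\<lambda>y. (sec a y, sec b y)) \<longlongrightarrow> (a, b)) ?N" by (intro tendsto_Pair sec) auto
    show "\<forall>\<^sub>F y in ?N. (sec a y, sec b y) \<in> ?D" using sec(2) by eventually_elim auto
  qed
  moreover assume "inf (nhds p) (principal ?D) = bot"
  \<comment> \<open>A map that converges to the trivial filter eventually satisfies every predicate,
    even \<open>False\<close>; this contradicts the density of \<open>X\<close>.\<close>
  ultimately have "\<forall>P. \<forall>\<^sub>F y in ?N. P (sec a y, sec b y)" unfolding filterlim_iff by simp
  from this[rule_format, of "\<lambda>_. False"] show False using dense_filter_not_bot[OF X(2), of ?x] by (simp add: trivial_limit_def)
qed

text \<open>The coefficients over \<open>X\<close> have a limit at every pair with a common source:
  by continuity of \<open>\<sigma>\<close> if the source lies in \<open>X\<close>, by extendability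
  otherwise. The limits depend continuously on the pair by
  \<open>tendsto_extension_from_dense\<close>.\<close>

lemma extendable_section_kernel:
  assumes X: "X \<subseteq> units G" "units G \<subseteq> closure X"
    and \<sigma>: "continuous_section G X \<sigma>" "extendable G X \<sigma>"
  obtains k where "continuous_kernel k"
    "\<And>x a b. x \<in> X \<Longrightarrow> a \<in> fiber G x \<Longrightarrow> b \<in> fiber G x \<Longrightarrow> k a b = \<sigma> x (delta b) a"
proof -
  let ?D = "{(a, b). gsrc G a = gsrc G b \<and> gsrc G b \<in> X}"
  define k0 where "k0 p = coeff (fiber G (gsrc G (snd p))) (\<sigma> (gsrc G (snd p))) (fst p) (snd p)" for p
  have ex: "\<exists>c. (k0 \<longlongrightarrow> c) (inf (nhds p) (principal ?D))" if "p \<in> same_src" for p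
  proof -
    let ?F = "inf (nhds p) (principal ?D)" and ?y = "\<lambda>q. gsrc G (snd q)"
    have id: "((\<lambda>q. q) \<longlongrightarrow> p) ?F" by (rule filterlim_mono[OF filterlim_ident order_refl inf_le1])
    have fs: "(fst \<longlongrightarrow> fst p) ?F" "(snd \<longlongrightarrow> snd p) ?F"
      using tendsto_fst[OF id] tendsto_snd[OF id] by auto
    have y: "(?y \<longlongrightarrow> ?y p) ?F" by (rule filterlim_compose[OF src_tendsto fs(2)])
    have D: "\<forall>\<^sub>F q in ?F. gsrc G (fst q) = ?y q \<and> ?y q \<in> X"
      by (auto simp: eventually_inf_principal intro!: always_eventually)
    show ?thesis
    proof (cases "?y p \<in> X")
      case True
      have "\<forall>\<^sub>F q in ?F. ?y q \<in> X" using D by eventually_elim auto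
      from continuous_sectionD[OF \<sigma>(1) True this y]
      have "E_tendsto G (\<lambda>q. (?y q, \<sigma> (?y q))) (?y p, \<sigma> (?y p)) ?F" .
      moreover have "\<forall>\<^sub>F q in ?F. gsrc G (snd q) = ?y q \<and> gsrc G (fst q) = ?y q"
        using D by eventually_elim auto
      ultimately have "((\<lambda>q. coeff (fiber G (?y q)) (\<sigma> (?y q)) (fst q) (snd q))
          \<longlongrightarrow> coeff (fiber G (?y p)) (\<sigma> (?y p)) (fst p) (snd p)) ?F"
        using fs unfolding E_tendsto_def fst_conv snd_conv by blast
      then show ?thesis unfolding k0_def by blast
    next
      case False
      have *: "?y p \<in> units G - X" "snd p \<in> fiber G (?y p)" "fst p \<in> fiber G (?y p)"
        using False that by (auto simp: fiber_iff same_src_def)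
      \<comment> \<open>Extendability refers to filters on \<open>'g \<times> 'g\<close>, the type
        of the filter of pairs, so the definition is instantiated directly. The column index
        \<open>snd\<close> plays the part of \<open>g'\<close>, the row index \<open>fst\<close>
        that of \<open>g''\<close>.\<close>
      obtain c where c: "\<forall>(F :: ('g \<times> 'g) filter) y g' g''.
         (\<forall>\<^sub>F i in F. y i \<in> X \<and> g' i \<in> fiber G (y i) \<and> g'' i \<in> fiber G (y i)) \<and>
         (y \<longlongrightarrow> ?y p) F \<and> (g' \<longlongrightarrow> snd p) F \<and> (g'' \<longlongrightarrow> fst p) F \<longrightarrow>
         ((\<lambda>i. coeff (fiber G (y i)) (\<sigma> (y i)) (g'' i) (g' i)) \<longlongrightarrow> c) F"
        using bspec[OF bspec[OF bspec[OF \<sigma>(2)[unfolded extendable_def] *(1)] *(2)] *(3)] by (elim exE)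
      have "\<forall>\<^sub>F q in ?F. ?y q \<in> X \<and> snd q \<in> fiber G (?y q) \<and> fst q \<in> fiber G (?y q)"
        using D by eventually_elim (auto simp: fiber_iff)
      with c[THEN spec[of _ ?F], THEN spec[of _ ?y], THEN spec[of _ snd], THEN spec[of _ fst]] y fs
      show ?thesis unfolding k0_def by blast
    qed
  qed
  define c where "c p = (SOME c. (k0 \<longlongrightarrow> c) (inf (nhds p) (principal ?D)))" for p
  have c: "(k0 \<longlongrightarrow> c p) (inf (nhds p) (principal ?D))" if "p \<in> same_src" for p
    unfolding c_def by (rule someI_ex[OF ex[OF that]])
  have cont: "(c \<longlongrightarrow> c p) (inf (nhds p) (principal same_src))" if "p \<in> same_src" for p
    by (rule tendsto_extension_from_dense[OF c dense_pairs[OF X] that])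
  have on_D: "c p = k0 p" if "p \<in> ?D" for p
  proof -
    have "p \<in> same_src" using that by (auto simp: same_src_def)
    \<comment> \<open>The neighbourhood filter is not punctured: at a point of \<open>?D\<close> the
      limit can be read off at the point itself, so \<open>c\<close> extends
      \<open>k0\<close>.\<close>
    moreover have "principal {p} \<le> inf (nhds p) (principal ?D)"
      using that by (auto simp: le_principal eventually_principal le_nhds)
    ultimately have "(k0 \<longlongrightarrow> c p) (principal {p})" using c tendsto_mono by blast
    moreover have "(k0 \<longlongrightarrow> k0 p) (principal {p})"
      by (simp add: tendsto_def eventually_principal)
    ultimately show ?thesis by (intro tendsto_unique[of "principal {p}" k0]) (simp_all add: principal_eq_bot_iff)
  qed
  show thesis
  proof (rule that[of "\<lambda>a b. c (a, b)"])
    show "continuous_kernel (\<lambda>a b. c (a, b))" using cont by (simp add: continuous_kernel_def)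
    fix x a b assume x: "x \<in> X" "a \<in> fiber G x" "b \<in> fiber G x"
    then have "c (a, b) = k0 (a, b)" by (intro on_D) (auto simp: fiber_iff)
    also have "\<dots> = \<sigma> x (delta b) a" using x by (simp add: k0_def fiber_iff coeff_def)
    finally show "c (a, b) = \<sigma> x (delta b) a" .
  qed
qed

text \<open>Each inequality in \<open>matrix_bound\<close> over \<open>x\<close> is a limit of
  inequalities for the moved arrows over units of \<open>X\<close>, with the coefficients
  \<open>f\<close> and \<open>g\<close> carried along.\<close>

lemma matrix_bound_from_dense:
  assumes X: "X \<subseteq> units G" "units G \<subseteq> closure X" and k: "continuous_kernel k"
    and M: "0 \<le> M" "\<And>x. x \<in> X \<Longrightarrow> matrix_bound (fiber G x) k M" and x: "x \<in> units G"
  shows "matrix_bound (fiber G x) k M"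
  unfolding matrix_bound_def
proof (intro conjI allI impI M(1))
  fix F H and f g :: "'g \<Rightarrow> complex"
  assume *: "finite F \<and> F \<subseteq> fiber G x \<and> finite H \<and> H \<subseteq> fiber G x"
  let ?N = "inf (nhds x) (principal X)"
  obtain sec where sec: "\<And>a. a \<in> F \<union> H \<Longrightarrow> (sec a \<longlongrightarrow> a) ?N"
    and ev: "\<forall>\<^sub>F y in ?N. y \<in> X \<and> (\<forall>a\<in>F \<union> H. gsrc G (sec a y) = y) \<and> inj_on (\<lambda>a. sec a y) (F \<union> H)"
    by (rule finite_sections[OF X(1) x, of "F \<union> H"]) (use * in auto)
  let ?B = "M * L2_set (\<lambda>a. cmod (g a)) F * L2_set (\<lambda>b. cmod (f b)) H"
  show "cmod (\<Sum>a\<in>F. \<Sum>b\<in>H. cnj (g a) * k a b * f b) \<le> ?B"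
  proof (rule tendsto_upperbound[OF tendsto_norm _ dense_filter_not_bot[OF X(2) x]])
    show "((\<lambda>y. \<Sum>a\<in>F. \<Sum>b\<in>H. cnj (g a) * k (sec a y) (sec b y) * f b)
        \<longlongrightarrow> (\<Sum>a\<in>F. \<Sum>b\<in>H. cnj (g a) * k a b * f b)) ?N"
    proof (intro tendsto_sum tendsto_mult tendsto_const continuous_kernelD[OF k] sec)
      fix a b assume "a \<in> F" "b \<in> H"
      then show "gsrc G a = gsrc G b" using * by (auto simp: fiber_iff subset_iff)
      show "\<forall>\<^sub>F y in ?N. gsrc G (sec a y) = gsrc G (sec b y)"
        using ev by eventually_elim (use \<open>a \<in> F\<close> \<open>b \<in> H\<close> in auto)
    qed auto
    show "\<forall>\<^sub>F y in ?N. cmod (\<Sum>a\<in>F. \<Sum>b\<in>H. cnj (g a) * k (sec a y) (sec b y) * f b) \<le> ?B"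
      using ev
    proof eventually_elim
      case (elim y)
      let ?s = "\<lambda>a. sec a y"
      \<comment> \<open>\<open>?i\<close> takes a moved arrow back to its origin, so that the old
        coefficients label the new arrows; injectivity preserves both norms.\<close>
      let ?i = "the_inv_into (F \<union> H) ?s"
      have inj: "inj_on ?s (F \<union> H)" "inj_on ?s F" "inj_on ?s H"
        using elim by (auto intro: inj_on_subset)
      have i: "?i (?s a) = a" if "a \<in> F \<union> H" for a
        by (rule the_inv_into_f_f[OF inj(1) that])
      have "(\<Sum>a\<in>F. \<Sum>b\<in>H. cnj (g a) * k (?s a) (?s b) * f b)
          = (\<Sum>a\<in>?s ` F. \<Sum>b\<in>?s ` H. cnj (g (?i a)) * k a b * f (?i b))"
        using i by (simp add: sum.reindex inj)
      moreover have "cmod \<dots> \<le> M * L2_set (\<lambda>a. cmod (g (?i a))) (?s ` F) * L2_set (\<lambda>b. cmod (f (?i b))) (?s ` H)"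
        using elim * by (intro matrix_boundD[OF M(2)]) (auto simp: fiber_iff)
      moreover have "L2_set (\<lambda>a. cmod (g (?i a))) (?s ` F) = L2_set (\<lambda>a. cmod (g a)) F"
        "L2_set (\<lambda>b. cmod (f (?i b))) (?s ` H) = L2_set (\<lambda>b. cmod (f b)) H"
        using i by (simp_all add: L2_set_def sum.reindex inj)
      ultimately show ?case by simp
    qed
  qed
qed

section \<open>Operators given by continuous kernels\<close>

definition kernel_op :: "('g \<Rightarrow> 'g \<Rightarrow> complex) \<Rightarrow> 'g operator" where
  "kernel_op k \<xi> = (\<lambda>g. matrix_op (fiber G (gsrc G g)) k (chi (fiber G (gsrc G g)) \<xi>) g)"

lemma chi_fiber_kernel_op:
  assumes "chi (fiber G x) \<xi> \<in> ell2 (fiber G x)"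
  shows "chi (fiber G x) (kernel_op k \<xi>) = matrix_op (fiber G x) k (chi (fiber G x) \<xi>)"
proof
  fix g
  show "chi (fiber G x) (kernel_op k \<xi>) g = matrix_op (fiber G x) k (chi (fiber G x) \<xi>) g"
    using assms by (cases "g \<in> fiber G x") (auto simp: chi_apply fiber_iff kernel_op_def matrix_op_def)
qed

lemma chi_fiber_bisection:
  assumes "inj_on (gsrc G) V" "\<And>a. a \<notin> V \<Longrightarrow> \<xi> a = 0" "c \<in> V" "c \<in> fiber G x"
  shows "chi (fiber G x) \<xi> = (\<lambda>g. \<xi> c * delta c g)"
proof
  fix g
  show "chi (fiber G x) \<xi> g = \<xi> c * delta c g"
  proof (cases "g = c")
    case False
    have "\<xi> g = 0" if "g \<in> fiber G x"
    proof (rule assms(2))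
      show "g \<notin> V" using False that assms(1,3,4) by (metis fiber_iff inj_onD)
    qed
    with False show ?thesis by (simp add: chi_apply delta_apply)
  qed (use assms(4) in \<open>simp add: chi_apply delta_apply\<close>)
qed

text \<open>For \<open>\<xi>\<close> supported in a bisection there is at most one term,
  \<open>\<xi> c * k g c\<close>, with \<open>c\<close> the arrow of the bisection over the source
  of \<open>g\<close>. Locally \<open>c\<close> moves continuously with \<open>g\<close>, which is
  where the joint continuity of \<open>k\<close> enters.\<close>

lemma continuous_kernel_op:
  assumes k: "continuous_kernel k" and M: "\<And>x. x \<in> units G \<Longrightarrow> matrix_bound (fiber G x) k M"
    and \<xi>: "\<xi> \<in> Cc G"
  shows "continuous_on UNIV (kernel_op k \<xi>)"
  using \<xi>
proof (induction rule: Cc_bisection_induct)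
  case (add \<xi> \<eta>)
  have "kernel_op k (\<lambda>a. \<xi> a + \<eta> a) = (\<lambda>g. kernel_op k \<xi> g + kernel_op k \<eta> g)"
  proof
    fix g
    let ?S = "fiber G (gsrc G g)"
    have "chi ?S (\<lambda>a. \<xi> a + \<eta> a) = (\<lambda>a. chi ?S \<xi> a + chi ?S \<eta> a)" by (auto simp: chi_apply)
    moreover have "matrix_op ?S k \<in> bounded_ops ?S" by (rule matrix_op_in_bounded_ops[OF M]) simp
    ultimately show "kernel_op k (\<lambda>a. \<xi> a + \<eta> a) g = kernel_op k \<xi> g + kernel_op k \<eta> g"
      using bounded_ops_add[of "matrix_op ?S k" ?S] Cc_fiber_ell2[OF add(1)] Cc_fiber_ell2[OF add(2)]
      by (simp add: kernel_op_def)
  qed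
  then show ?case using add by (simp add: continuous_on_add)
next
  case (bisection \<xi> V L)
  have \<xi>_cont: "(\<xi> \<longlongrightarrow> \<xi> a) (nhds a)" for a
    using bisection(1) by (simp add: Cc_def continuous_on_UNIV_iff_nhds)
  have "(kernel_op k \<xi> \<longlongrightarrow> kernel_op k \<xi> g0) (nhds g0)" for g0
  proof (cases "gsrc G g0 \<in> gsrc G ` L")
    case True
    then obtain a where a: "a \<in> L" "gsrc G a = gsrc G g0" by auto
    then have aV: "a \<in> V" using bisection by auto
    obtain sec where sec: "sec (gsrc G a) = a" "(sec \<longlongrightarrow> a) (near_unit (gsrc G a))"
        "\<forall>\<^sub>F y in near_unit (gsrc G a). gsrc G (sec y) = y"
      using local_section_near[of a] by metis
    have src: "filterlim (gsrc G) (near_unit (gsrc G a)) (nhds g0)"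
      using src_tendsto[of g0] a(2) by (simp add: filterlim_inf filterlim_principal)
    let ?c = "\<lambda>g. sec (gsrc G g)"
    have c: "(?c \<longlongrightarrow> a) (nhds g0)" by (rule filterlim_compose[OF sec(2) src])
    have c_src: "\<forall>\<^sub>F g in nhds g0. gsrc G (?c g) = gsrc G g"
      using src sec(3) unfolding filterlim_iff by blast
    have c_V: "\<forall>\<^sub>F g in nhds g0. ?c g \<in> V" by (rule topological_tendstoD[OF c bisection(2) aV])
    have formula: "kernel_op k \<xi> g = \<xi> c * k g c" if "c \<in> V" "gsrc G c = gsrc G g" for c g
    proof -
      let ?S = "fiber G (gsrc G g)"
      have "chi ?S \<xi> = (\<lambda>g. \<xi> c * delta c g)"
        by (rule chi_fiber_bisection[OF bisection(3)]) (use bisection that in \<open>auto simp: fiber_iff\<close>)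
      moreover have "matrix_op ?S k \<in> bounded_ops ?S" by (rule matrix_op_in_bounded_ops[OF M]) simp
      moreover have "c \<in> ?S" "g \<in> ?S" using that by (auto simp: fiber_iff)
      ultimately show ?thesis
        by (simp add: kernel_op_def bounded_ops_scale matrix_op_delta)
    qed
    have "((\<lambda>g. \<xi> (?c g) * k g (?c g)) \<longlongrightarrow> \<xi> a * k g0 a) (nhds g0)"
      using c_src a(2)
      by (intro tendsto_mult filterlim_compose[OF \<xi>_cont c] continuous_kernelD[OF k] c filterlim_ident)
        (auto simp: eq_commute)
    moreover have "\<forall>\<^sub>F g in nhds g0. \<xi> (?c g) * k g (?c g) = kernel_op k \<xi> g"
      using c_src c_V by eventually_elim (simp add: formula)
    ultimately have "(kernel_op k \<xi> \<longlongrightarrow> \<xi> a * k g0 a) (nhds g0)"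
      by (rule Lim_transform_eventually)
    then show ?thesis by (simp add: formula[OF aV a(2)])
  next
    case False
    \<comment> \<open>The sources of \<open>L\<close> form a closed set; off it, nearby sources also
      miss it and the image is locally zero.\<close>
    have "closed (gsrc G ` L)"
      by (intro compact_imp_closed compact_continuous_image bisection continuous_on_subset[OF continuous_src]) auto
    then have "\<forall>\<^sub>F g in nhds g0. gsrc G g \<in> - (gsrc G ` L)"
      using False by (intro topological_tendstoD[OF src_tendsto]) auto
    moreover have zero: "kernel_op k \<xi> g = 0" if "gsrc G g \<notin> gsrc G ` L" for g
    proof -
      have "chi (fiber G (gsrc G g)) \<xi> = (\<lambda>a. 0)"
      proof
        fix a
        show "chi (fiber G (gsrc G g)) \<xi> a = 0"
        proof (cases "a \<in> L")
          case True
          then have "gsrc G a \<noteq> gsrc G g" using that by (metis imageI)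
          then show ?thesis by (simp add: chi_apply fiber_iff)
        qed (simp add: chi_apply bisection(6))
      qed
      moreover have "matrix_op (fiber G (gsrc G g)) k \<in> bounded_ops (fiber G (gsrc G g))"
        by (rule matrix_op_in_bounded_ops[OF M]) simp
      ultimately show ?thesis by (simp add: kernel_op_def bounded_ops_zero)
    qed
    ultimately have "\<forall>\<^sub>F g in nhds g0. 0 = kernel_op k \<xi> g" by (auto elim: eventually_mono)
    then have "(kernel_op k \<xi> \<longlongrightarrow> 0) (nhds g0)" by (rule Lim_transform_eventually[OF tendsto_const])
    then show ?thesis by (simp add: zero[OF False])
  qed
  then show ?case by (simp add: continuous_on_UNIV_iff_nhds)
qed

section \<open>Decay at infinity\<close>

text \<open>One half of (2), for a family of operators that will be \<open>\<sigma>\<close> or its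
  adjoint, so that one argument serves both halves.\<close>

definition decays :: "'g set \<Rightarrow> ('g \<Rightarrow> 'g operator) \<Rightarrow> bool" where
  "decays X \<tau> \<longleftrightarrow> (\<forall>\<epsilon>>0. \<forall>\<xi>\<in>Cc G. \<exists>K. compact K \<and> (\<forall>x\<in>X. \<forall>A\<subseteq>fiber G x. A \<inter> K = {} \<longrightarrow>
     norm2 (fiber G x) (chi A (\<tau> x (chi (fiber G x) \<xi>))) < \<epsilon>))"

definition decays_off_products :: "'g set \<Rightarrow> ('g \<Rightarrow> 'g operator) \<Rightarrow> bool" where
  "decays_off_products X \<tau> \<longleftrightarrow> (\<forall>\<epsilon>>0. \<forall>\<xi>\<in>Cc G. \<exists>K. compact K \<and>
     (\<forall>x\<in>X. \<forall>A\<subseteq>fiber G x. \<forall>B\<subseteq>fiber G x. A \<inter> setmul G K B = {} \<longrightarrow>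
       norm2 (fiber G x) (chi A (\<tau> x (chi B (chi (fiber G x) \<xi>)))) < \<epsilon>))"

lemma decaysE:
  assumes "decays X \<tau>" "\<epsilon> > 0" "\<xi> \<in> Cc G"
  obtains K where "compact K" "\<And>x A. x \<in> X \<Longrightarrow> A \<subseteq> fiber G x \<Longrightarrow> A \<inter> K = {} \<Longrightarrow>
    norm2 (fiber G x) (chi A (\<tau> x (chi (fiber G x) \<xi>))) < \<epsilon>"
proof -
  have "\<exists>K. compact K \<and> (\<forall>x\<in>X. \<forall>A\<subseteq>fiber G x. A \<inter> K = {} \<longrightarrow>
      norm2 (fiber G x) (chi A (\<tau> x (chi (fiber G x) \<xi>))) < \<epsilon>)"
    using assms by (simp add: decays_def)
  then show thesis by (elim exE conjE) (rule that, auto)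
qed

lemma decays_off_productsE:
  assumes "decays_off_products X \<tau>" "\<epsilon> > 0" "\<xi> \<in> Cc G"
  obtains K where "compact K" "\<And>x A B. x \<in> X \<Longrightarrow> A \<subseteq> fiber G x \<Longrightarrow> B \<subseteq> fiber G x \<Longrightarrow>
    A \<inter> setmul G K B = {} \<Longrightarrow> norm2 (fiber G x) (chi A (\<tau> x (chi B (chi (fiber G x) \<xi>)))) < \<epsilon>"
proof -
  have "\<exists>K. compact K \<and> (\<forall>x\<in>X. \<forall>A\<subseteq>fiber G x. \<forall>B\<subseteq>fiber G x. A \<inter> setmul G K B = {} \<longrightarrow>
      norm2 (fiber G x) (chi A (\<tau> x (chi B (chi (fiber G x) \<xi>)))) < \<epsilon>)"
    using assms by (simp add: decays_off_products_def)
  then show thesis by (elim exE conjE) (rule that, auto)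
qed

text \<open>The two halves give two compact sets, and their union serves both.\<close>

lemma decays_conj:
  "decays X \<tau> \<and> decays X \<rho> \<longleftrightarrow>
    (\<forall>\<epsilon>>0. \<forall>\<xi>\<in>Cc G. \<exists>K. compact K \<and> (\<forall>x\<in>X. \<forall>A\<subseteq>fiber G x. A \<inter> K = {} \<longrightarrow>
       norm2 (fiber G x) (chi A (\<tau> x (chi (fiber G x) \<xi>))) < \<epsilon> \<and>
       norm2 (fiber G x) (chi A (\<rho> x (chi (fiber G x) \<xi>))) < \<epsilon>))"
  (is "?L \<longleftrightarrow> ?R")
proof
  assume L: ?L
  show ?R
  proof (intro allI impI ballI)
    fix \<epsilon> :: real and \<xi> assume *: "\<epsilon> > 0" "\<xi> \<in> Cc G"
    obtain K where K: "compact K" "\<And>x A. x \<in> X \<Longrightarrow> A \<subseteq> fiber G x \<Longrightarrow> A \<inter> K = {} \<Longrightarrow>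
        norm2 (fiber G x) (chi A (\<tau> x (chi (fiber G x) \<xi>))) < \<epsilon>"
      using decaysE[OF conjunct1[OF L] *] by metis
    obtain K' where K': "compact K'" "\<And>x A. x \<in> X \<Longrightarrow> A \<subseteq> fiber G x \<Longrightarrow> A \<inter> K' = {} \<Longrightarrow>
        norm2 (fiber G x) (chi A (\<rho> x (chi (fiber G x) \<xi>))) < \<epsilon>"
      using decaysE[OF conjunct2[OF L] *] by metis
    show "\<exists>K. compact K \<and> (\<forall>x\<in>X. \<forall>A\<subseteq>fiber G x. A \<inter> K = {} \<longrightarrow>
       norm2 (fiber G x) (chi A (\<tau> x (chi (fiber G x) \<xi>))) < \<epsilon> \<and>
       norm2 (fiber G x) (chi A (\<rho> x (chi (fiber G x) \<xi>))) < \<epsilon>)"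
      by (rule exI[of _ "K \<union> K'"]) (use K K' in \<open>simp add: Int_Un_distrib compact_Un\<close>)
  qed
next
  assume R: ?R
  show ?L
    unfolding decays_def
  proof (intro conjI allI impI ballI)
    fix \<epsilon> :: real and \<xi> assume *: "\<epsilon> > 0" "\<xi> \<in> Cc G"
    from R[rule_format, OF *] show "\<exists>K. compact K \<and> (\<forall>x\<in>X. \<forall>A\<subseteq>fiber G x. A \<inter> K = {} \<longrightarrow>
        norm2 (fiber G x) (chi A (\<tau> x (chi (fiber G x) \<xi>))) < \<epsilon>)"
      by (elim ex_forward) simp
    from R[rule_format, OF *] show "\<exists>K. compact K \<and> (\<forall>x\<in>X. \<forall>A\<subseteq>fiber G x. A \<inter> K = {} \<longrightarrow>
        norm2 (fiber G x) (chi A (\<rho> x (chi (fiber G x) \<xi>))) < \<epsilon>)"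
      by (elim ex_forward) simp
  qed
qed

section \<open>Decay off compact sets and decay off products\<close>

lemma setmulI: "a \<in> A \<Longrightarrow> b \<in> B \<Longrightarrow> gsrc G a = grng G b \<Longrightarrow> gmul G a b \<in> setmul G A B"
  unfolding setmul_def by blast

lemma setmul_Un: "setmul G (K \<union> K') B = setmul G K B \<union> setmul G K' B"
  unfolding setmul_def by blast

lemma decays_off_products_conj:
  "decays_off_products X \<tau> \<and> decays_off_products X \<rho> \<longleftrightarrow>
    (\<forall>\<epsilon>>0. \<forall>\<xi>\<in>Cc G. \<exists>K. compact K \<and> (\<forall>x\<in>X. \<forall>A\<subseteq>fiber G x. \<forall>B\<subseteq>fiber G x. A \<inter> setmul G K B = {} \<longrightarrow>
       norm2 (fiber G x) (chi A (\<tau> x (chi B (chi (fiber G x) \<xi>)))) < \<epsilon> \<and>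
       norm2 (fiber G x) (chi A (\<rho> x (chi B (chi (fiber G x) \<xi>)))) < \<epsilon>))"
  (is "?L \<longleftrightarrow> ?R")
proof
  assume L: ?L
  show ?R
  proof (intro allI impI ballI)
    fix \<epsilon> :: real and \<xi> assume *: "\<epsilon> > 0" "\<xi> \<in> Cc G"
    obtain K where K: "compact K" "\<And>x A B. x \<in> X \<Longrightarrow> A \<subseteq> fiber G x \<Longrightarrow> B \<subseteq> fiber G x \<Longrightarrow>
        A \<inter> setmul G K B = {} \<Longrightarrow> norm2 (fiber G x) (chi A (\<tau> x (chi B (chi (fiber G x) \<xi>)))) < \<epsilon>"
      using decays_off_productsE[OF conjunct1[OF L] *] by metis
    obtain K' where K': "compact K'" "\<And>x A B. x \<in> X \<Longrightarrow> A \<subseteq> fiber G x \<Longrightarrow> B \<subseteq> fiber G x \<Longrightarrow>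
        A \<inter> setmul G K' B = {} \<Longrightarrow> norm2 (fiber G x) (chi A (\<rho> x (chi B (chi (fiber G x) \<xi>)))) < \<epsilon>"
      using decays_off_productsE[OF conjunct2[OF L] *] by metis
    show "\<exists>K. compact K \<and> (\<forall>x\<in>X. \<forall>A\<subseteq>fiber G x. \<forall>B\<subseteq>fiber G x. A \<inter> setmul G K B = {} \<longrightarrow>
       norm2 (fiber G x) (chi A (\<tau> x (chi B (chi (fiber G x) \<xi>)))) < \<epsilon> \<and>
       norm2 (fiber G x) (chi A (\<rho> x (chi B (chi (fiber G x) \<xi>)))) < \<epsilon>)"
      by (rule exI[of _ "K \<union> K'"]) (use K K' in \<open>simp add: setmul_Un Int_Un_distrib compact_Un\<close>)
  qed
next
  assume R: ?R
  show ?L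
    unfolding decays_off_products_def
  proof (intro conjI allI impI ballI)
    fix \<epsilon> :: real and \<xi> assume *: "\<epsilon> > 0" "\<xi> \<in> Cc G"
    from R[rule_format, OF *]
    show "\<exists>K. compact K \<and> (\<forall>x\<in>X. \<forall>A\<subseteq>fiber G x. \<forall>B\<subseteq>fiber G x. A \<inter> setmul G K B = {} \<longrightarrow>
        norm2 (fiber G x) (chi A (\<tau> x (chi B (chi (fiber G x) \<xi>)))) < \<epsilon>)"
      by (elim ex_forward) simp
    from R[rule_format, OF *]
    show "\<exists>K. compact K \<and> (\<forall>x\<in>X. \<forall>A\<subseteq>fiber G x. \<forall>B\<subseteq>fiber G x. A \<inter> setmul G K B = {} \<longrightarrow>
        norm2 (fiber G x) (chi A (\<rho> x (chi B (chi (fiber G x) \<xi>)))) < \<epsilon>)"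
      by (elim ex_forward) simp
  qed
qed

lemma decays_iff_decays_off_products:
  assumes \<tau>: "\<And>x. x \<in> X \<Longrightarrow> \<tau> x \<in> bounded_ops (fiber G x)"
  shows "decays X \<tau> \<longleftrightarrow> decays_off_products X \<tau>"
proof
  assume decays: "decays X \<tau>"
  \<comment> \<open>The quantifier over \<open>\<epsilon>\<close> is part of the induction property,
    since a sum of two functions calls for \<open>\<epsilon> / 2\<close> in each.\<close>
  have "\<forall>\<epsilon>>0. \<exists>K. compact K \<and>
     (\<forall>x\<in>X. \<forall>A\<subseteq>fiber G x. \<forall>B\<subseteq>fiber G x. A \<inter> setmul G K B = {} \<longrightarrow>
       norm2 (fiber G x) (chi A (\<tau> x (chi B (chi (fiber G x) \<xi>)))) < \<epsilon>)" if "\<xi> \<in> Cc G" for \<xi>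
    using that
  proof (induction rule: Cc_bisection_induct)
    case (add \<xi> \<eta>)
    show ?case
    proof (intro allI impI)
      fix \<epsilon> :: real assume "\<epsilon> > 0"
      then have \<epsilon>: "\<epsilon> / 2 > 0" by simp
      obtain K where K: "compact K" "\<And>x A B. x \<in> X \<Longrightarrow> A \<subseteq> fiber G x \<Longrightarrow> B \<subseteq> fiber G x \<Longrightarrow>
          A \<inter> setmul G K B = {} \<Longrightarrow> norm2 (fiber G x) (chi A (\<tau> x (chi B (chi (fiber G x) \<xi>)))) < \<epsilon> / 2"
        using add.IH(1) \<epsilon> by meson
      obtain K' where K': "compact K'" "\<And>x A B. x \<in> X \<Longrightarrow> A \<subseteq> fiber G x \<Longrightarrow> B \<subseteq> fiber G x \<Longrightarrow>
          A \<inter> setmul G K' B = {} \<Longrightarrow> norm2 (fiber G x) (chi A (\<tau> x (chi B (chi (fiber G x) \<eta>)))) < \<epsilon> / 2"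
        using add.IH(2) \<epsilon> by meson
      show "\<exists>K. compact K \<and> (\<forall>x\<in>X. \<forall>A\<subseteq>fiber G x. \<forall>B\<subseteq>fiber G x. A \<inter> setmul G K B = {} \<longrightarrow>
          norm2 (fiber G x) (chi A (\<tau> x (chi B (chi (fiber G x) (\<lambda>a. \<xi> a + \<eta> a))))) < \<epsilon>)"
      proof (intro exI[of _ "K \<union> K'"] conjI compact_Un K K' ballI allI impI)
        fix x A B assume x: "x \<in> X" "A \<subseteq> fiber G x" "B \<subseteq> fiber G x"
          and disj: "A \<inter> setmul G (K \<union> K') B = {}"
        let ?S = "fiber G x"
        let ?f = "chi B (chi ?S \<xi>)" and ?g = "chi B (chi ?S \<eta>)"
        have fg: "?f \<in> ell2 ?S" "?g \<in> ell2 ?S" by (intro chi_in_ell2 Cc_fiber_ell2 add.hyps)+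
        have "chi B (chi ?S (\<lambda>a. \<xi> a + \<eta> a)) = (\<lambda>a. ?f a + ?g a)" by (auto simp: chi_apply)
        then have "chi A (\<tau> x (chi B (chi ?S (\<lambda>a. \<xi> a + \<eta> a)))) = (\<lambda>a. chi A (\<tau> x ?f) a + chi A (\<tau> x ?g) a)"
          using bounded_ops_add[OF \<tau>[OF x(1)] fg] by (auto simp: chi_apply)
        then have "norm2 ?S (chi A (\<tau> x (chi B (chi ?S (\<lambda>a. \<xi> a + \<eta> a)))))
            \<le> norm2 ?S (chi A (\<tau> x ?f)) + norm2 ?S (chi A (\<tau> x ?g))"
          by (simp only:) (intro norm2_triangle chi_in_ell2 bounded_ops_mem[OF \<tau>[OF x(1)]] fg)
        also have "\<dots> < \<epsilon> / 2 + \<epsilon> / 2"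
          using disj by (intro add_strict_mono K K' x) (auto simp: setmul_Un)
        finally show "norm2 ?S (chi A (\<tau> x (chi B (chi ?S (\<lambda>a. \<xi> a + \<eta> a))))) < \<epsilon>" by simp
      qed
    qed
  next
    case (bisection \<xi> V L)
    show ?case
    proof (intro allI impI)
      fix \<epsilon> :: real assume \<epsilon>: "\<epsilon> > 0"
      obtain K where K: "compact K" "\<And>x A. x \<in> X \<Longrightarrow> A \<subseteq> fiber G x \<Longrightarrow> A \<inter> K = {} \<Longrightarrow>
          norm2 (fiber G x) (chi A (\<tau> x (chi (fiber G x) \<xi>))) < \<epsilon>"
        using decaysE[OF decays \<epsilon> bisection(1)] by metis
      have "compact (ginv G ` L)"
        by (intro compact_continuous_image bisection continuous_on_subset[OF continuous_inv]) auto
      then have compact: "compact (setmul G K (ginv G ` L))" by (intro compact_setmul K)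
      show "\<exists>K. compact K \<and> (\<forall>x\<in>X. \<forall>A\<subseteq>fiber G x. \<forall>B\<subseteq>fiber G x. A \<inter> setmul G K B = {} \<longrightarrow>
          norm2 (fiber G x) (chi A (\<tau> x (chi B (chi (fiber G x) \<xi>)))) < \<epsilon>)"
      proof (intro exI[of _ "setmul G K (ginv G ` L)"] conjI compact ballI allI impI)
        fix x A B assume x: "x \<in> X" "A \<subseteq> fiber G x" "B \<subseteq> fiber G x"
          and disj: "A \<inter> setmul G (setmul G K (ginv G ` L)) B = {}"
        let ?S = "fiber G x"
        show "norm2 ?S (chi A (\<tau> x (chi B (chi ?S \<xi>)))) < \<epsilon>"
        proof (cases "B \<inter> L = {}")
          case True
          have "chi B (chi ?S \<xi>) = (\<lambda>a. 0)"
          proof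
            fix a
            show "chi B (chi ?S \<xi>) a = 0"
              using True bisection(6)[of a] by (cases "a \<in> B") (auto simp: chi_apply)
          qed
          then have "chi A (\<tau> x (chi B (chi ?S \<xi>))) = (\<lambda>a. 0)"
            using bounded_ops_zero[OF \<tau>[OF x(1)]] by (simp add: chi_def)
          then show ?thesis using \<epsilon> by simp
        next
          case False
          then obtain b where b: "b \<in> B" "b \<in> L" by blast
          then have "b \<in> V" "b \<in> ?S" using bisection(5) x by auto
          then have "chi ?S \<xi> = (\<lambda>g. \<xi> b * delta b g)"
            by (intro chi_fiber_bisection[OF bisection(3)]) (use bisection in auto)
          then have "chi B (chi ?S \<xi>) = chi ?S \<xi>" using b by (auto simp: chi_apply delta_apply)
          \<comment> \<open>An arrow \<open>a\<close> in \<open>A \<inter> K\<close> would equal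
            \<open>(a b\<inverse>) b\<close> with \<open>b\<close> in both \<open>L\<close> and
            \<open>B\<close>, and so lie in the excluded product.\<close>
          moreover have "A \<inter> K = {}"
          proof (rule ccontr)
            assume "A \<inter> K \<noteq> {}"
            then obtain a where a: "a \<in> A" "a \<in> K" by blast
            have ab: "gsrc G a = gsrc G b" using a x \<open>b \<in> ?S\<close> by (auto simp: fiber_iff)
            let ?c = "gmul G a (ginv G b)"
            have "?c \<in> setmul G K (ginv G ` L)"
              using a b ab by (intro setmulI) (auto simp: rng_inv)
            moreover have "gsrc G ?c = grng G b" using ab by (simp add: src_mul rng_inv src_inv)
            moreover have "gmul G ?c b = a"
              using ab mul_assoc[of a "ginv G b" b] mul_src[of a] by (simp add: rng_inv src_inv inv_mul)
            ultimately have "a \<in> setmul G (setmul G K (ginv G ` L)) B"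
              using setmulI[OF _ b(1), of ?c] by simp
            with disj a show False by blast
          qed
          ultimately show ?thesis using K(2)[OF x(1,2)] by simp
        qed
      qed
    qed
  qed
  then show "decays_off_products X \<tau>" unfolding decays_off_products_def by blast
next
  assume dp: "decays_off_products X \<tau>"
  show "decays X \<tau>"
    unfolding decays_def
  proof (intro allI impI ballI)
    fix \<epsilon> :: real and \<xi> assume *: "\<epsilon> > 0" "\<xi> \<in> Cc G"
    obtain L where L: "compact L" "\<And>a. a \<notin> L \<Longrightarrow> \<xi> a = 0" using CcE[OF *(2)] by metis
    obtain K where K: "compact K" "\<And>x A B. x \<in> X \<Longrightarrow> A \<subseteq> fiber G x \<Longrightarrow> B \<subseteq> fiber G x \<Longrightarrow>
        A \<inter> setmul G K B = {} \<Longrightarrow> norm2 (fiber G x) (chi A (\<tau> x (chi B (chi (fiber G x) \<xi>)))) < \<epsilon>"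
      using decays_off_productsE[OF dp *] by metis
    show "\<exists>K. compact K \<and> (\<forall>x\<in>X. \<forall>A\<subseteq>fiber G x. A \<inter> K = {} \<longrightarrow>
        norm2 (fiber G x) (chi A (\<tau> x (chi (fiber G x) \<xi>))) < \<epsilon>)"
    proof (intro exI[of _ "setmul G K L"] conjI compact_setmul K L ballI allI impI)
      fix x A assume x: "x \<in> X" "A \<subseteq> fiber G x" "A \<inter> setmul G K L = {}"
      \<comment> \<open>Cutting off to \<open>?B\<close> does not change \<open>\<xi>\<close> on the
        fiber, and \<open>K ?B\<close> lies in \<open>K L\<close> whatever \<open>x\<close>
        is.\<close>
      let ?B = "L \<inter> fiber G x"
      have "chi ?B (chi (fiber G x) \<xi>) = chi (fiber G x) \<xi>" using L by (auto simp: chi_apply)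
      moreover have "A \<inter> setmul G K ?B = {}" using x(3) unfolding setmul_def by blast
      ultimately show "norm2 (fiber G x) (chi A (\<tau> x (chi (fiber G x) \<xi>))) < \<epsilon>"
        using K(2)[of x A ?B] x by simp
    qed
  qed
qed

section \<open>Decay of adjointable operators\<close>

lemma L2_decay:
  assumes "\<zeta> \<in> L2 G" "\<epsilon> > 0"
  obtains K where "compact K" "\<And>x A. x \<in> units G \<Longrightarrow> A \<subseteq> fiber G x \<Longrightarrow> A \<inter> K = {} \<Longrightarrow>
    norm2 (fiber G x) (chi A (chi (fiber G x) \<zeta>)) < \<epsilon>"
proof -
  obtain \<eta> where \<eta>: "\<eta> \<in> Cc G" "\<And>x. x \<in> units G \<Longrightarrow> chi (fiber G x) (\<lambda>a. \<zeta> a - \<eta> a) \<in> ell2 (fiber G x)"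
      "\<And>x. x \<in> units G \<Longrightarrow> norm2 (fiber G x) (\<lambda>a. \<zeta> a - \<eta> a) \<le> \<epsilon> / 2"
    by (rule L2_approx[OF assms(1) half_gt_zero[OF assms(2)]]) blast
  obtain K where K: "compact K" "\<And>a. a \<notin> K \<Longrightarrow> \<eta> a = 0" using CcE[OF \<eta>(1)] by metis
  show thesis
  proof (rule that[OF K(1)])
    fix x A assume x: "x \<in> units G" "A \<subseteq> fiber G x" "A \<inter> K = {}"
    let ?S = "fiber G x"
    \<comment> \<open>Off \<open>K\<close> the approximant \<open>\<eta>\<close> vanishes, so what
      is left of \<open>\<zeta>\<close> there is only the error.\<close>
    have "chi A (chi ?S \<zeta>) = chi A (chi ?S (\<lambda>a. \<zeta> a - \<eta> a))"
    proof
      fix a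
      show "chi A (chi ?S \<zeta>) a = chi A (chi ?S (\<lambda>a. \<zeta> a - \<eta> a)) a"
        using K(2)[of a] x(3) by (cases "a \<in> A") (auto simp: chi_apply)
    qed
    then have "norm2 ?S (chi A (chi ?S \<zeta>)) \<le> norm2 ?S (\<lambda>a. \<zeta> a - \<eta> a)"
      using norm2_chi_le[OF \<eta>(2)[OF x(1)], of A] by simp
    also have "\<dots> \<le> \<epsilon> / 2" by (rule \<eta>(3)[OF x(1)])
    finally show "norm2 ?S (chi A (chi ?S \<zeta>)) < \<epsilon>" using assms(2) by simp
  qed
qed

lemma adjointable_imp_decays:
  assumes T: "T \<in> adjointable_ops G" and X: "X \<subseteq> units G"
  shows "decays X (\<lambda>x. slice G x T)" and "decays X (\<lambda>x. adj (fiber G x) (slice G x T))"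
proof -
  obtain R where T_mem: "\<And>\<xi>. \<xi> \<in> L2 G \<Longrightarrow> T \<xi> \<in> L2 G" and R_mem: "\<And>\<xi>. \<xi> \<in> L2 G \<Longrightarrow> R \<xi> \<in> L2 G"
    and adj: "\<And>\<xi> \<eta> x. \<xi> \<in> L2 G \<Longrightarrow> \<eta> \<in> L2 G \<Longrightarrow> x \<in> units G \<Longrightarrow>
      inner2 (fiber G x) (T \<xi>) \<eta> = inner2 (fiber G x) \<xi> (R \<eta>)"
    by (rule adjointable_opsE[OF T]) blast
  \<comment> \<open>Both halves follow in one way: fiber operators induced by a map \<open>U\<close>
    of \<open>L2 G\<close> into itself decay because each \<open>U \<xi>\<close> does.\<close>
  have decays: "decays X \<tau>" if U: "\<And>\<xi>. \<xi> \<in> L2 G \<Longrightarrow> U \<xi> \<in> L2 G"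
    "\<And>x \<xi>. x \<in> X \<Longrightarrow> \<xi> \<in> L2 G \<Longrightarrow> \<tau> x (chi (fiber G x) \<xi>) = chi (fiber G x) (U \<xi>)" for \<tau> U
    unfolding decays_def
  proof (intro allI impI ballI)
    fix \<epsilon> :: real and \<xi> assume *: "\<epsilon> > 0" "\<xi> \<in> Cc G"
    then have \<xi>: "\<xi> \<in> L2 G" using Cc_subset_L2 by auto
    obtain K where K: "compact K" "\<And>x A. x \<in> units G \<Longrightarrow> A \<subseteq> fiber G x \<Longrightarrow> A \<inter> K = {} \<Longrightarrow>
        norm2 (fiber G x) (chi A (chi (fiber G x) (U \<xi>))) < \<epsilon>"
      using L2_decay[OF U(1)[OF \<xi>] *(1)] by metis
    show "\<exists>K. compact K \<and> (\<forall>x\<in>X. \<forall>A\<subseteq>fiber G x. A \<inter> K = {} \<longrightarrow>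
        norm2 (fiber G x) (chi A (\<tau> x (chi (fiber G x) \<xi>))) < \<epsilon>)"
    proof (intro exI[of _ K] conjI K(1) ballI allI impI)
      fix x A assume "x \<in> X" "A \<subseteq> fiber G x" "A \<inter> K = {}"
      then show "norm2 (fiber G x) (chi A (\<tau> x (chi (fiber G x) \<xi>))) < \<epsilon>"
        using K(2)[of x A] X U(2)[OF _ \<xi>] by (simp add: subset_iff)
    qed
  qed
  show "decays X (\<lambda>x. slice G x T)"
    by (rule decays[OF T_mem]) (use slice_chi[OF T] X in auto)
  show "decays X (\<lambda>x. adj (fiber G x) (slice G x T))"
  proof (rule decays[OF R_mem])
    fix x \<xi> assume x: "x \<in> X" and \<xi>: "\<xi> \<in> L2 G"
    then have x': "x \<in> units G" using X by auto
    let ?S = "fiber G x"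
    let ?P = "slice G x T"
    note P = slice_bounded(1)[OF T x'] and r\<xi> = L2_fiber_ell2[OF \<xi> x']
    \<comment> \<open>The adjoint of the slice is induced by \<open>R\<close>; the value at
      \<open>a\<close> is tested with a lift of \<open>delta a\<close>, because the relation between
      \<open>T\<close> and \<open>R\<close> concerns elements of \<open>L2 G\<close>.\<close>
    show "adj ?S ?P (chi ?S \<xi>) = chi ?S (R \<xi>)"
    proof
      fix a
      show "adj ?S ?P (chi ?S \<xi>) a = chi ?S (R \<xi>) a"
      proof (cases "a \<in> ?S")
        case True
        obtain \<eta> where "\<eta> \<in> Cc G" and \<eta>: "chi ?S \<eta> = delta a" using delta_lift[OF True] .
        then have \<eta>_mem: "\<eta> \<in> L2 G" using Cc_subset_L2 by auto
        have "adj ?S ?P (chi ?S \<xi>) a = inner2 ?S (delta a) (adj ?S ?P (chi ?S \<xi>))"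
          using True by simp
        also have "\<dots> = inner2 ?S (?P (delta a)) (chi ?S \<xi>)"
          by (rule inner2_adj[OF P _ r\<xi>, symmetric]) (use True in simp)
        also have "\<dots> = inner2 ?S (chi ?S (T \<eta>)) (chi ?S \<xi>)"
          using slice_chi[OF T x' \<eta>_mem] \<eta> by simp
        also have "\<dots> = inner2 ?S (T \<eta>) \<xi>" by (rule inner2_cong) (auto simp: chi_apply)
        also have "\<dots> = inner2 ?S \<eta> (R \<xi>)" by (rule adj[OF \<eta>_mem \<xi> x'])
        also have "\<dots> = inner2 ?S (delta a) (R \<xi>)"
          by (rule inner2_cong) (auto simp: \<eta>[symmetric] chi_apply)
        finally show ?thesis using True by (simp add: chi_apply)
      next
        case False
        then show ?thesis
          using ell2_eq_0[OF bounded_ops_mem[OF adj_bounded_op(1)[OF P] r\<xi>]] by (simp add: chi_apply)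
      qed
    qed
  qed
qed

text \<open>A bump function equal to 1 on \<open>K\<close> cuts the image down to a function in
  \<open>Cc G\<close>. Over \<open>X\<close> the rest is dominated by the part of the image off
  \<open>K\<close>. For a general unit, finitely many arrows are moved into fibers over
  \<open>X\<close>, and continuity of the rest carries the bound back, with \<open><\<close>
  weakened to \<open>\<le>\<close>.\<close>

lemma kernel_op_Cc_in_L2:
  assumes X: "X \<subseteq> units G" "units G \<subseteq> closure X" and k: "continuous_kernel k"
    and M: "\<And>x. x \<in> units G \<Longrightarrow> matrix_bound (fiber G x) k M"
    and decays: "decays X (\<lambda>x. matrix_op (fiber G x) k)" and \<xi>: "\<xi> \<in> Cc G"
  shows "kernel_op k \<xi> \<in> L2 G"
proof (rule L2_closed)
  fix \<epsilon> :: real assume \<epsilon>: "\<epsilon> > 0"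
  obtain K where K: "compact K" "\<And>x A. x \<in> X \<Longrightarrow> A \<subseteq> fiber G x \<Longrightarrow> A \<inter> K = {} \<Longrightarrow>
      norm2 (fiber G x) (chi A (matrix_op (fiber G x) k (chi (fiber G x) \<xi>))) < \<epsilon>"
    using decaysE[OF decays \<epsilon> \<xi>] by metis
  obtain b :: "'g \<Rightarrow> real" and L where b: "continuous_on UNIV b" "compact L" "\<And>a. a \<notin> L \<Longrightarrow> b a = 0"
      "\<And>a. a \<in> K \<Longrightarrow> b a = 1" "\<And>a. 0 \<le> b a" "\<And>a. b a \<le> 1"
    using Urysohn_compact_support[OF K(1), of UNIV] by (metis open_UNIV subset_UNIV)
  note cont = continuous_kernel_op[OF k M \<xi>]
  let ?\<eta> = "\<lambda>a. complex_of_real (b a) * kernel_op k \<xi> a"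
  let ?\<psi> = "\<lambda>a. kernel_op k \<xi> a - ?\<eta> a"
  have \<psi>_cont: "(?\<psi> \<longlongrightarrow> ?\<psi> a) (nhds a)" for a
  proof -
    have "continuous_on UNIV ?\<psi>" by (intro continuous_intros cont b)
    then show ?thesis unfolding continuous_on_UNIV_iff_nhds by blast
  qed
  have "?\<eta> \<in> Cc G" by (rule CcI[of _ L]) (auto intro!: continuous_intros cont b simp: b)
  then have "?\<eta> \<in> L2 G" using Cc_subset_L2 by auto
  moreover have "chi (fiber G x) ?\<psi> \<in> ell2 (fiber G x) \<and> norm2 (fiber G x) ?\<psi> \<le> \<epsilon>"
    if x: "x \<in> units G" for x
  proof -
    have "L2_set (\<lambda>a. cmod (?\<psi> a)) F \<le> \<epsilon>" if F: "finite F" "F \<subseteq> fiber G x" for F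
    proof -
      let ?N = "inf (nhds x) (principal X)"
      obtain sec where sec: "\<And>a. a \<in> F \<Longrightarrow> (sec a \<longlongrightarrow> a) ?N"
        and ev: "\<forall>\<^sub>F y in ?N. y \<in> X \<and> (\<forall>a\<in>F. gsrc G (sec a y) = y) \<and> inj_on (\<lambda>a. sec a y) F"
        by (rule finite_sections[OF X(1) x F]) blast
      show ?thesis
      proof (rule tendsto_upperbound[OF _ _ dense_filter_not_bot[OF X(2) x]])
        show "((\<lambda>y. L2_set (\<lambda>a. cmod (?\<psi> (sec a y))) F) \<longlongrightarrow> L2_set (\<lambda>a. cmod (?\<psi> a)) F) ?N"
          unfolding L2_set_def
          by (intro tendsto_real_sqrt tendsto_sum tendsto_power tendsto_norm filterlim_compose[OF \<psi>_cont] sec)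
        show "\<forall>\<^sub>F y in ?N. L2_set (\<lambda>a. cmod (?\<psi> (sec a y))) F \<le> \<epsilon>"
          using ev
        proof eventually_elim
          case (elim y)
          let ?S = "fiber G y"
          let ?u = "matrix_op ?S k (chi ?S \<xi>)" and ?A = "fiber G y - K" and ?s = "\<lambda>a. sec a y"
          have y: "y \<in> units G" using elim X by auto
          have u: "?u \<in> ell2 ?S" by (rule matrix_op_bound(1)[OF M[OF y] Cc_fiber_ell2[OF \<xi>]])
          \<comment> \<open>On \<open>K\<close> the rest vanishes; elsewhere the factor
            \<open>1 - b a\<close> lies between 0 and 1.\<close>
          have le: "cmod (?\<psi> a) \<le> cmod (chi ?A ?u a)" if "a \<in> ?S" for a
          proof (cases "a \<in> K")
            case False
            have "?u a = kernel_op k \<xi> a" using that by (simp add: kernel_op_def fiber_iff)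
            then have "?\<psi> a = complex_of_real (1 - b a) * ?u a" by (simp add: algebra_simps)
            then have "cmod (?\<psi> a) = (1 - b a) * cmod (?u a)"
              using b(6)[of a] by (simp add: norm_mult del: of_real_diff)
            also have "\<dots> \<le> 1 * cmod (?u a)" using b(5)[of a] by (intro mult_right_mono) auto
            finally show ?thesis using False that by (simp add: chi_apply)
          qed (simp add: b)
          have "L2_set (\<lambda>a. cmod (?\<psi> (?s a))) F = L2_set (\<lambda>a. cmod (?\<psi> a)) (?s ` F)"
            using elim by (simp add: L2_set_def sum.reindex)
          also have "\<dots> \<le> L2_set (\<lambda>a. cmod (chi ?A ?u a)) (?s ` F)"
            using elim by (intro L2_set_mono le) (auto simp: fiber_iff)
          also have "\<dots> \<le> norm2 ?S (chi ?A ?u)"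
            using elim F by (intro L2_set_le_norm2 chi_in_ell2 u) (auto simp: fiber_iff)
          also have "\<dots> < \<epsilon>" using elim by (intro K) auto
          finally show ?case by simp
        qed
      qed
    qed
    then show ?thesis using sq_summable_bounded[of "fiber G x" ?\<psi> \<epsilon>] by (simp add: chi_in_ell2_iff)
  qed
  ultimately show "\<exists>\<eta>\<in>L2 G. \<forall>x\<in>units G. chi (fiber G x) (\<lambda>a. kernel_op k \<xi> a - \<eta> a) \<in> ell2 (fiber G x)
      \<and> norm2 (fiber G x) (\<lambda>a. kernel_op k \<xi> a - \<eta> a) \<le> \<epsilon>"
    by (intro bexI[of _ ?\<eta>] ballI) simp_all
qed

text \<open>The fiber operators share the bound \<open>M\<close>, so approximations of
  \<open>\<xi>\<close> in the module norm give approximations of its image.\<close>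

lemma kernel_op_in_L2:
  assumes X: "X \<subseteq> units G" "units G \<subseteq> closure X" and k: "continuous_kernel k"
    and M: "\<And>x. x \<in> units G \<Longrightarrow> matrix_bound (fiber G x) k M" "0 \<le> M"
    and decays: "decays X (\<lambda>x. matrix_op (fiber G x) k)" and \<xi>: "\<xi> \<in> L2 G"
  shows "kernel_op k \<xi> \<in> L2 G"
proof (rule L2_closed)
  fix \<epsilon> :: real assume \<epsilon>: "\<epsilon> > 0"
  \<comment> \<open>The added 1 avoids a division by zero for \<open>M = 0\<close>.\<close>
  have "\<epsilon> / (M + 1) > 0" using \<epsilon> M(2) by simp
  then obtain \<eta> where \<eta>: "\<eta> \<in> Cc G" "\<And>x. x \<in> units G \<Longrightarrow> chi (fiber G x) (\<lambda>a. \<xi> a - \<eta> a) \<in> ell2 (fiber G x)"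
      "\<And>x. x \<in> units G \<Longrightarrow> norm2 (fiber G x) (\<lambda>a. \<xi> a - \<eta> a) \<le> \<epsilon> / (M + 1)"
    using L2_approx[OF \<xi>] by metis
  show "\<exists>\<eta>\<in>L2 G. \<forall>x\<in>units G. chi (fiber G x) (\<lambda>a. kernel_op k \<xi> a - \<eta> a) \<in> ell2 (fiber G x)
      \<and> norm2 (fiber G x) (\<lambda>a. kernel_op k \<xi> a - \<eta> a) \<le> \<epsilon>"
  proof (intro bexI[of _ "kernel_op k \<eta>"] ballI)
    show "kernel_op k \<eta> \<in> L2 G" by (rule kernel_op_Cc_in_L2[OF X k M(1) decays \<eta>(1)])
    fix x assume x: "x \<in> units G"
    let ?S = "fiber G x"
    let ?d = "chi ?S (\<lambda>a. \<xi> a - \<eta> a)"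
    note B = matrix_op_in_bounded_ops[OF M(1)[OF x]]
    note mem = L2_fiber_ell2[OF \<xi> x] Cc_fiber_ell2[OF \<eta>(1), of x]
    have "chi ?S (\<lambda>a. kernel_op k \<xi> a - kernel_op k \<eta> a)
        = (\<lambda>a. chi ?S (kernel_op k \<xi>) a - chi ?S (kernel_op k \<eta>) a)"
      by (auto simp: chi_apply)
    also have "\<dots> = matrix_op ?S k (\<lambda>a. chi ?S \<xi> a - chi ?S \<eta> a)"
      by (simp add: chi_fiber_kernel_op mem bounded_ops_diff[OF B])
    also have "(\<lambda>a. chi ?S \<xi> a - chi ?S \<eta> a) = ?d" by (auto simp: chi_apply)
    finally have eq: "chi ?S (\<lambda>a. kernel_op k \<xi> a - kernel_op k \<eta> a) = matrix_op ?S k ?d" .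
    have "norm2 ?S (matrix_op ?S k ?d) \<le> M * norm2 ?S ?d"
      by (rule norm2_matrix_op[OF M(1)[OF x] \<eta>(2)[OF x]])
    also have "\<dots> \<le> M * (\<epsilon> / (M + 1))" using \<eta>(3)[OF x] M(2) by (intro mult_left_mono) auto
    also have "\<dots> \<le> \<epsilon>" using M(2) \<epsilon> by (simp add: field_simps)
    finally have "norm2 ?S (\<lambda>a. kernel_op k \<xi> a - kernel_op k \<eta> a) \<le> \<epsilon>"
      unfolding eq[symmetric] by simp
    moreover have "chi ?S (\<lambda>a. kernel_op k \<xi> a - kernel_op k \<eta> a) \<in> ell2 ?S"
      unfolding eq by (rule bounded_ops_mem[OF B \<eta>(2)[OF x]])
    ultimately show "chi ?S (\<lambda>a. kernel_op k \<xi> a - kernel_op k \<eta> a) \<in> ell2 ?S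
        \<and> norm2 ?S (\<lambda>a. kernel_op k \<xi> a - kernel_op k \<eta> a) \<le> \<epsilon>" by blast
  qed
qed

text \<open>The conjugate transposed kernel is again continuous and bounded by \<open>M\<close>, and
  the second decay condition puts its images in \<open>L2 G\<close>; it therefore provides the
  adjoint. The restriction to \<open>L2 G\<close> follows the convention that operators are
  \<open>undefined\<close> elsewhere.\<close>

lemma kernel_op_adjointable:
  assumes X: "X \<subseteq> units G" "units G \<subseteq> closure X" and k: "continuous_kernel k"
    and M: "\<And>x. x \<in> units G \<Longrightarrow> matrix_bound (fiber G x) k M" "0 \<le> M"
    and decays: "decays X (\<lambda>x. matrix_op (fiber G x) k)"
      "decays X (\<lambda>x. matrix_op (fiber G x) (\<lambda>a b. cnj (k b a)))"
  defines "T \<equiv> restrict (kernel_op k) (L2 G)"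
  shows "T \<in> adjointable_ops G"
    and slice_kernel_op: "x \<in> units G \<Longrightarrow> slice G x T = matrix_op (fiber G x) k"
proof -
  let ?k' = "\<lambda>a b. cnj (k b a)"
  note T_mem = kernel_op_in_L2[OF X k M decays(1)]
  note R_mem = kernel_op_in_L2[OF X continuous_kernel_adjoint[OF k] matrix_bound_adjoint[OF M(1)] M(2) decays(2)]
  have adj: "inner2 (fiber G x) (kernel_op k \<xi>) \<eta> = inner2 (fiber G x) \<xi> (kernel_op ?k' \<eta>)"
    if x: "x \<in> units G" and \<xi>: "\<xi> \<in> L2 G" and \<eta>: "\<eta> \<in> L2 G" for x \<xi> \<eta>
  proof -
    let ?S = "fiber G x"
    note mem = L2_fiber_ell2[OF \<xi> x] L2_fiber_ell2[OF \<eta> x]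
    have "inner2 ?S (kernel_op k \<xi>) \<eta> = inner2 ?S (chi ?S (kernel_op k \<xi>)) (chi ?S \<eta>)"
      by (rule inner2_cong) (auto simp: chi_apply)
    also have "\<dots> = inner2 ?S (chi ?S \<xi>) (chi ?S (kernel_op ?k' \<eta>))"
      by (simp add: chi_fiber_kernel_op mem inner2_matrix_op[OF M(1)[OF x]])
    also have "\<dots> = inner2 ?S \<xi> (kernel_op ?k' \<eta>)"
      by (rule inner2_cong) (auto simp: chi_apply)
    finally show ?thesis .
  qed
  show T: "T \<in> adjointable_ops G"
    unfolding adjointable_ops_def
  proof (intro CollectI conjI bexI[of _ "restrict (kernel_op ?k') (L2 G)"])
    show "T \<in> L2 G \<rightarrow>\<^sub>E L2 G" unfolding T_def using T_mem by auto
    show "restrict (kernel_op ?k') (L2 G) \<in> L2 G \<rightarrow>\<^sub>E L2 G" using R_mem by auto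
  qed (simp add: T_def adj)
  show "slice G x T = matrix_op (fiber G x) k" if x: "x \<in> units G"
    by (rule slice_eqI[OF T x matrix_op_in_bounded_ops[OF M(1)[OF x]]])
      (simp add: T_def chi_fiber_kernel_op L2_fiber_ell2 x)
qed

text \<open>The kernel reproduces \<open>\<sigma>\<close> over \<open>X\<close>, so both decay
  conditions become conditions on \<open>k\<close> and on its conjugate transpose, as
  \<open>kernel_op_adjointable\<close> requires.\<close>

lemma extends_iff_decays:
  assumes X: "X \<subseteq> units G" "units G \<subseteq> closure X"
    and \<sigma>: "\<sigma> \<in> Gamma_b G X" "extendable G X \<sigma>"
  shows "(\<exists>T\<in>adjointable_ops G. \<forall>x\<in>X. slice G x T = \<sigma> x) \<longleftrightarrow>
    decays X \<sigma> \<and> decays X (\<lambda>x. adj (fiber G x) (\<sigma> x))"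
proof
  assume "\<exists>T\<in>adjointable_ops G. \<forall>x\<in>X. slice G x T = \<sigma> x"
  then obtain T where T: "T \<in> adjointable_ops G" "\<And>x. x \<in> X \<Longrightarrow> slice G x T = \<sigma> x" by blast
  show "decays X \<sigma> \<and> decays X (\<lambda>x. adj (fiber G x) (\<sigma> x))"
    using adjointable_imp_decays[OF T(1) X(1)] T(2) by (simp add: decays_def)
next
  assume decays: "decays X \<sigma> \<and> decays X (\<lambda>x. adj (fiber G x) (\<sigma> x))"
  have cont: "continuous_section G X \<sigma>" using \<sigma>(1) by (simp add: Gamma_b_def)
  have \<sigma>_op: "\<sigma> x \<in> bounded_ops (fiber G x)" if "x \<in> X" for x
    using cont that by (auto simp: continuous_section_def E_bundle_def)
  obtain M where M: "\<And>x. x \<in> X \<Longrightarrow> opnorm (fiber G x) (\<sigma> x) \<le> M"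
    using \<sigma>(1) by (auto simp: Gamma_b_def bdd_above_def)
  obtain k where k: "continuous_kernel k"
      "\<And>x a b. x \<in> X \<Longrightarrow> a \<in> fiber G x \<Longrightarrow> b \<in> fiber G x \<Longrightarrow> k a b = \<sigma> x (delta b) a"
    using extendable_section_kernel[OF X cont \<sigma>(2)] by metis
  have \<sigma>_k: "\<sigma> x = matrix_op (fiber G x) k" if "x \<in> X" for x
    by (subst bounded_op_eq_matrix_op[OF \<sigma>_op[OF that]], rule matrix_op_cong) (simp add: k(2)[OF that])
  \<comment> \<open>\<open>M\<close> is an upper bound with no recorded sign, while
    \<open>matrix_bound\<close> asks for a nonnegative one.\<close>
  have bound_X: "matrix_bound (fiber G x) k (max M 0)" if x: "x \<in> X" for x
  proof -
    have "norm2 (fiber G x) (\<sigma> x f) \<le> max M 0 * norm2 (fiber G x) f" if "f \<in> ell2 (fiber G x)" for f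
      using norm2_le_opnorm[OF \<sigma>_op[OF x] that] M[OF x]
      by (meson max.coboundedI1 mult_right_mono norm2_nonneg order_trans)
    then have "matrix_bound (fiber G x) (\<lambda>a b. \<sigma> x (delta b) a) (max M 0)"
      by (intro bounded_op_matrix_bound \<sigma>_op x) auto
    then show ?thesis
      unfolding matrix_bound_def by (auto simp: k(2)[OF x] subset_iff cong: sum.cong)
  qed
  have bound: "matrix_bound (fiber G x) k (max M 0)" if "x \<in> units G" for x
    by (rule matrix_bound_from_dense[OF X k(1) _ bound_X that]) auto
  have "adj (fiber G x) (\<sigma> x) = matrix_op (fiber G x) (\<lambda>a b. cnj (k b a))" if "x \<in> X" for x
    using adj_matrix_op[OF bound_X[OF that]] \<sigma>_k[OF that] by simp
  then have "decays X (\<lambda>x. matrix_op (fiber G x) k)"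
      "decays X (\<lambda>x. matrix_op (fiber G x) (\<lambda>a b. cnj (k b a)))"
    using decays \<sigma>_k by (simp_all add: decays_def)
  note T = kernel_op_adjointable[OF X k(1) bound _ this]
  have "slice G x (restrict (kernel_op k) (L2 G)) = \<sigma> x" if "x \<in> X" for x
    using T(2)[of x] \<sigma>_k[OF that] X that by auto
  then show "\<exists>T\<in>adjointable_ops G. \<forall>x\<in>X. slice G x T = \<sigma> x"
    using T(1) by auto
qed

end

theorem proposition3p18:
  fixes G :: "'g::t2_space groupoid" and X :: "'g set" and \<sigma> :: "'g \<Rightarrow> 'g operator"
  assumes "lc_etale_groupoid G"
    and "X \<subseteq> units G" and "units G \<subseteq> closure X"
    and "\<sigma> \<in> Gamma_b G X" and "extendable G X \<sigma>"
  shows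
    "((\<exists>T\<in>adjointable_ops G. \<forall>x\<in>X. slice G x T = \<sigma> x)
      \<longleftrightarrow>
      (\<forall>\<epsilon>>0. \<forall>\<xi>\<in>Cc G. \<exists>K. compact K \<and>
        (\<forall>x\<in>X. \<forall>A\<subseteq>fiber G x. A \<inter> K = {} \<longrightarrow>
          norm2 (fiber G x) (chi A (\<sigma> x (chi (fiber G x) \<xi>))) < \<epsilon> \<and>
          norm2 (fiber G x) (chi A (adj (fiber G x) (\<sigma> x) (chi (fiber G x) \<xi>))) < \<epsilon>)))
     \<and>
     ((\<exists>T\<in>adjointable_ops G. \<forall>x\<in>X. slice G x T = \<sigma> x)
      \<longleftrightarrow>
      (\<forall>\<epsilon>>0. \<forall>\<xi>\<in>Cc G. \<exists>K. compact K \<and>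
        (\<forall>x\<in>X. \<forall>A\<subseteq>fiber G x. \<forall>B\<subseteq>fiber G x. A \<inter> setmul G K B = {} \<longrightarrow>
          norm2 (fiber G x) (chi A (\<sigma> x (chi B (chi (fiber G x) \<xi>)))) < \<epsilon> \<and>
          norm2 (fiber G x) (chi A (adj (fiber G x) (\<sigma> x) (chi B (chi (fiber G x) \<xi>)))) < \<epsilon>)))"
proof -
  interpret lc_etale_groupoid G by fact
  have \<sigma>: "\<sigma> x \<in> bounded_ops (fiber G x)" if "x \<in> X" for x
    using assms(4) that by (auto simp: Gamma_b_def continuous_section_def E_bundle_def)
  have 1: "decays X \<sigma> \<longleftrightarrow> decays_off_products X \<sigma>"
    by (rule decays_iff_decays_off_products[OF \<sigma>])
  have 2: "decays X (\<lambda>x. adj (fiber G x) (\<sigma> x)) \<longleftrightarrow> decays_off_products X (\<lambda>x. adj (fiber G x) (\<sigma> x))"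
    by (rule decays_iff_decays_off_products[OF adj_bounded_op(1)[OF \<sigma>]])
  show ?thesis
    \<comment> \<open>Once both right sides are folded into pairs of decay conditions, (2) and (3)
      agree half by half, and (1) is compared with (2) alone.\<close>
    unfolding decays_conj[of X \<sigma> "\<lambda>x. adj (fiber G x) (\<sigma> x)", symmetric]
      decays_off_products_conj[of X \<sigma> "\<lambda>x. adj (fiber G x) (\<sigma> x)", symmetric]
    using extends_iff_decays[OF assms(2-5)] 1 2 by simp
qed

end
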